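(* Fix $M>0$ and $Q\in\mathbb{R}$ with $0<|Q|<\frac{3M}{2\sqrt{2}}$. There exists $\Lambda_0>0$ such that for all $\Lambda\in(0,\Lambda_0)$ (for which the standing assumption on $\mu$ stated in the context holds) there exists a constant $c_0(\Lambda)>0$ such that the following holds. Suppose $m>0$ and $q\in\mathbb{R}$ satisfy $m^2\le c_0(\Lambda)q^2$. Then for $|q|>0$ sufficiently small there exists $\sigma\in\mathbb{C}$ with $\operatorname{Im}\sigma\ge c_1q^2>0$ such that, with $s=qQ$, $$\operatorname{Ker}\hat P(\sigma,s,m)\cap\operatorname{Ker}(\Delta_{\mathbb{S}^2_\omega})\neq\{0\}.$$ Here the smallness threshold for $|q|$ and the constant $c_1>0$ do not depend on $q$ or $m$.
   Context: Setting (De Sitter-Reissner-Nordström). Let $M>0$ (black hole mass), $Q\in\mathbb{R}$ (black hole charge), $\Lambda>0$ (cosmological constant), and $$\mu(r)=1-\frac{2M}{r}+\frac{Q^2}{r^2}-\frac{\Lambda r^2}{3}.$$ Standing assumption: $|Q|<\frac{3M}{2\sqrt2}$ and $\Lambda$ is small enough that $\mu$ has four real roots $r_n<0<r_c<r_-<r_+$, $\mu>0$ on $(r_-,r_+)$, and $\mu/r^2$ has a single non-degenerate maximum on $(r_-,r_+)$. Let $\mathfrak r\in(r_-,r_+)$ be the unique non-degenerate maximum of $\mu$ in $(r_-,r_+)$, and let $c>0$ be defined by $c^2=\mu(\mathfrak r)^{-1}$. Define $\nu(r)=\mp\sqrt{1-\mu(r)c^2}$ for $\pm(r-\mathfrak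 r)\ge 0$; this is a smooth function, with $\nu(r_-)=1$, $\nu(r_+)=-1$. Here $q\in\mathbb{R}$ is the charge and $m>0$ the mass of the field, $s:=qQ$, and $V(r):=1/r$. Fix $\eta_0>0$ small so that $\mu$ has no root on $(r_--\eta_0,r_-)\cup(r_+,r_++\eta_0)$, and let $Y=(r_--\eta_0,r_++\eta_0)_r\times\mathbb{S}^2_\omega$ with measure $\mathrm{d}r\,\mathrm{d}\omega$. For $\gamma\in\mathbb{R}$, $\bar H^\gamma(Y)$ denotes the Sobolev space of order $\gamma$ of extendible distributions on $Y$ (restrictions to $Y$ of $H^\gamma$ distributions on a larger manifold). For $\sigma\in\mathbb{C}$ let $$\hat P(\sigma,s,m)=-c^2(\sigma+sV)^2+\frac{i}{r}(\sigma+sV)r^2\nu\,\partial_r\frac1r+\frac{i}{r}\partial_r\,r^2\nu(\sigma+sV)\frac1r-\frac1r\partial_r\,\mu r^2\,\partial_r\frac1r-\frac{1}{r^2}\Delta_{\mathbb{S}^2_\omega}+m^2,$$ where functions denote multiplication operators, products denote compositions of operators, and $\Delta_{\mathbb{S}^2_\omega}$ is the Laplacian of the standard metric on $\mathbb{S}^2$. (This is the charged Klein-Gordon operator on the De Sitter-Reissner-Nordström metric, gauge-transformed, conjugated by $r$ and acting on functions of the form $e^{-i\sigma t_*}u$.) Fix $\gamma>5/2$. The operator acts as $\hat P(\sigma,s,m):\mathcal{X}^\gamma\to\bar H^{\gamma-1}(Y)$ with $\mathcal{X}^\gamma=\{u\in\bar H^\gamma(Y):\hat P(0,0,0)u\in\bar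 H^{\gamma-1}(Y)\}$ (this space equals $\{u\in\bar H^\gamma(Y):\hat P(\sigma,s,m)u\in\bar H^{\gamma-1}(Y)\}$ for all $\sigma,s,m$), and its kernel is taken in $\mathcal{X}^\gamma$. *)

theory Defs
  imports "HOL-Analysis.Analysis"
begin

section \<open>The De Sitter-Reissner-Nordstroem function \<open>\<mu>\<close> and its standing assumption\<close>

definition mu :: "real \<Rightarrow> real \<Rightarrow> real \<Rightarrow> real \<Rightarrow> real" where
  "mu M Q \<Lambda> r = 1 - 2 * M / r + Q\<^sup>2 / r\<^sup>2 - \<Lambda> * r\<^sup>2 / 3"

text \<open>``\<open>x\<close> is the single, non-degenerate maximum of \<open>f\<close> on \<open>(a,b)\<close>'': \<open>f\<close> attains its maximum over
  \<open>(a,b)\<close> at \<open>x\<close>, has no other local maximum in \<open>(a,b)\<close>, and \<open>f'' x < 0\<close>.\<close>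

definition single_nondegenerate_max :: "(real \<Rightarrow> real) \<Rightarrow> real \<Rightarrow> real \<Rightarrow> real \<Rightarrow> bool" where
  "single_nondegenerate_max f a b x \<longleftrightarrow>
     a < x \<and> x < b \<and> (\<forall>y\<in>{a<..<b}. f y \<le> f x) \<and>
     (\<forall>y\<in>{a<..<b}. (\<forall>\<^sub>F z in nhds y. f z \<le> f y) \<longrightarrow> y = x) \<and>
     deriv (deriv f) x < 0"

definition dsrn_assumption ::
    "real \<Rightarrow> real \<Rightarrow> real \<Rightarrow> real \<Rightarrow> real \<Rightarrow> real \<Rightarrow> real \<Rightarrow> bool" where
  "dsrn_assumption M Q \<Lambda> r_n r_c r_minus r_plus \<longleftrightarrow>
     r_n < 0 \<and> 0 < r_c \<and> r_c < r_minus \<and> r_minus < r_plus \<and>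
     {r. r \<noteq> 0 \<and> mu M Q \<Lambda> r = 0} = {r_n, r_c, r_minus, r_plus} \<and>
     (\<forall>r\<in>{r_minus<..<r_plus}. mu M Q \<Lambda> r > 0) \<and>
     (\<exists>x. single_nondegenerate_max (\<lambda>r. mu M Q \<Lambda> r / r\<^sup>2) r_minus r_plus x)"

text \<open>In the following two definitions \<open>r0\<close> is the location of the maximum of \<open>\<mu>\<close> on
  \<open>(r\<^sub>-, r\<^sub>+)\<close>.\<close>

definition c_const :: "real \<Rightarrow> real \<Rightarrow> real \<Rightarrow> real \<Rightarrow> real" where
  "c_const M Q \<Lambda> r0 = sqrt (inverse (mu M Q \<Lambda> r0))"

definition nu :: "real \<Rightarrow> real \<Rightarrow> real \<Rightarrow> real \<Rightarrow> real \<Rightarrow> real" where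
  "nu M Q \<Lambda> r0 r =
     (if r \<ge> r0 then - sqrt (1 - mu M Q \<Lambda> r * (c_const M Q \<Lambda> r0)\<^sup>2)
      else sqrt (1 - mu M Q \<Lambda> r * (c_const M Q \<Lambda> r0)\<^sup>2))"


section \<open>Distributions on \<open>(a,b) \<times> S\<^sup>2\<close>\<close>

text \<open>For \<open>0 \<le> a < b\<close> the manifold \<open>(a,b) \<times> S\<^sup>2\<close> is identified with an open spherical shell of
  \<open>\<real>\<^sup>3\<close> by the diffeomorphism \<open>(r,\<omega>) \<mapsto> r\<omega>\<close>; thus \<open>r = norm x\<close>, \<open>\<omega> = sgn x = x / norm x\<close>, and
  the measure \<open>dr d\<omega>\<close> becomes \<open>dx / |x|\<^sup>2\<close>.\<close>

definition shell :: "real \<Rightarrow> real \<Rightarrow> (real^3) set" where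
  "shell a b = {x. a < norm x \<and> norm x < b}"

definition partial :: "3 \<Rightarrow> (real^3 \<Rightarrow> complex) \<Rightarrow> real^3 \<Rightarrow> complex" where
  "partial i f x = frechet_derivative f (at x) (axis i 1)"

primrec C_k :: "nat \<Rightarrow> (real^3 \<Rightarrow> complex) \<Rightarrow> bool" where
  "C_k 0 f \<longleftrightarrow> continuous_on UNIV f"
| "C_k (Suc k) f \<longleftrightarrow> (\<forall>x. f differentiable (at x)) \<and> (\<forall>i. C_k k (partial i f))"

definition test_functions :: "(real^3) set \<Rightarrow> (real^3 \<Rightarrow> complex) set" where
  "test_functions Y =
     {\<phi>. (\<forall>k. C_k k \<phi>) \<and> compact (closure {x. \<phi> x \<noteq> 0}) \<and> closure {x. \<phi> x \<noteq> 0} \<subseteq> Y}"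

text \<open>A distribution on \<open>Y\<close> is represented by a functional of which only the values on
  \<open>test_functions Y\<close> are meaningful; equality of distributions on \<open>Y\<close> always means equality on
  \<open>test_functions Y\<close>. A function \<open>u\<close> on \<open>Y\<close> is identified with the distribution
  \<open>\<phi> \<mapsto> \<integral> u \<phi> dr d\<omega>\<close>.\<close>

type_synonym distribution = "(real^3 \<Rightarrow> complex) \<Rightarrow> complex"

definition vanishes_on :: "(real^3) set \<Rightarrow> distribution \<Rightarrow> bool" where
  "vanishes_on Y u \<longleftrightarrow> (\<forall>\<phi>\<in>test_functions Y. u \<phi> = 0)"

definition mult_op :: "(real \<Rightarrow> complex) \<Rightarrow> distribution \<Rightarrow> distribution" where
  "mult_op f u = (\<lambda>\<phi>. u (\<lambda>x. f (norm x) * \<phi> x))"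

definition radial_deriv :: "(real^3 \<Rightarrow> complex) \<Rightarrow> real^3 \<Rightarrow> complex" where
  "radial_deriv \<phi> x = vector_derivative (\<lambda>r. \<phi> (r *\<^sub>R sgn x)) (at (norm x))"

text \<open>With respect to \<open>dr d\<omega>\<close> the transpose of \<open>\<partial>\<^sub>r\<close> is \<open>- \<partial>\<^sub>r\<close>.\<close>

definition d_r :: "distribution \<Rightarrow> distribution" where
  "d_r u = (\<lambda>\<phi>. - u (radial_deriv \<phi>))"

definition laplacian :: "(real^3 \<Rightarrow> complex) \<Rightarrow> real^3 \<Rightarrow> complex" where
  "laplacian f x = (\<Sum>i\<in>UNIV. partial i (partial i f) x)"

text \<open>The Laplacian of the standard metric of the unit sphere, applied to \<open>f = \<phi>(r \<cdot>)\<close> for fixed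
  \<open>r\<close>: it is the Euclidean Laplacian of the extension \<open>y \<mapsto> f (y / |y|)\<close> of \<open>f\<close>, evaluated on the
  unit sphere. It is symmetric with respect to \<open>dr d\<omega>\<close>.\<close>

definition sphere_laplacian_fun :: "(real^3 \<Rightarrow> complex) \<Rightarrow> real^3 \<Rightarrow> complex" where
  "sphere_laplacian_fun \<phi> x = laplacian (\<lambda>y. \<phi> (norm x *\<^sub>R sgn y)) (sgn x)"

definition sphere_laplacian :: "distribution \<Rightarrow> distribution" where
  "sphere_laplacian u = (\<lambda>\<phi>. u (sphere_laplacian_fun \<phi>))"


section \<open>Extendible Sobolev distributions\<close>

definition fourier :: "(real^3 \<Rightarrow> complex) \<Rightarrow> real^3 \<Rightarrow> complex" where
  "fourier \<psi> \<xi> = (LINT x|lborel. exp (- \<i> * complex_of_real (\<xi> \<bullet> x)) * \<psi> x)"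

text \<open>The elements of \<open>H\<^sup>\<gamma>(\<real>\<^sup>3)\<close> are the tempered distributions \<open>v\<close> whose Fourier transform is
  a function \<open>g\<close> with \<open>(1 + |\<xi>|\<^sup>2)\<^bsup>\<gamma>/2\<^esup> g \<in> L\<^sup>2\<close>; the pairing of \<open>v\<close> with \<open>\<psi>\<close> (with respect to
  \<open>dx\<close>) is recovered from \<open>g\<close> by the Fourier inversion formula.\<close>

definition inverse_fourier_distr :: "(real^3 \<Rightarrow> complex) \<Rightarrow> (real^3 \<Rightarrow> complex) \<Rightarrow> complex" where
  "inverse_fourier_distr g \<psi> =
     complex_of_real (1 / (2 * pi) ^ 3) * (LINT \<xi>|lborel. g \<xi> * fourier \<psi> (- \<xi>))"

definition H_weighted :: "real \<Rightarrow> (real^3 \<Rightarrow> complex) set" where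
  "H_weighted \<gamma> =
     {g \<in> borel_measurable lborel.
        integrable lborel (\<lambda>\<xi>. (1 + (norm \<xi>)\<^sup>2) powr \<gamma> * (norm (g \<xi>))\<^sup>2)}"

text \<open>Restrictions to \<open>Y\<close> of elements of \<open>H\<^sup>\<gamma>(\<real>\<^sup>3)\<close>. The factor \<open>|x|\<^sup>-\<^sup>2\<close> converts the pairing
  with respect to \<open>dx\<close> into the one with respect to \<open>dr d\<omega>\<close>; it is smooth on the relevant shells,
  whose closures do not contain the origin.\<close>

definition H_bar :: "real \<Rightarrow> (real^3) set \<Rightarrow> distribution set" where
  "H_bar \<gamma> Y =
     {u. \<exists>g\<in>H_weighted \<gamma>. \<forall>\<phi>\<in>test_functions Y.
           u \<phi> = inverse_fourier_distr g (\<lambda>x. \<phi> x / complex_of_real ((norm x)\<^sup>2))}"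


section \<open>The operator\<close>

definition P_hat :: "real \<Rightarrow> real \<Rightarrow> real \<Rightarrow> real \<Rightarrow>
    complex \<Rightarrow> real \<Rightarrow> real \<Rightarrow> distribution \<Rightarrow> distribution" where
  "P_hat M Q \<Lambda> r0 \<sigma> s m u =
    (let c = complex_of_real (c_const M Q \<Lambda> r0);
         \<mu> = (\<lambda>r. complex_of_real (mu M Q \<Lambda> r));
         \<nu> = (\<lambda>r. complex_of_real (nu M Q \<Lambda> r0 r));
         V = (\<lambda>r. 1 / complex_of_real r);
         S = (\<lambda>r. \<sigma> + complex_of_real s * V r);
         R = complex_of_real
     in (\<lambda>\<phi>.
         mult_op (\<lambda>r. - c\<^sup>2 * (S r)\<^sup>2) u \<phi>
       + (mult_op (\<lambda>r. \<i> / R r) \<circ> mult_op (\<lambda>r. S r * (R r)\<^sup>2 * \<nu> r) \<circ> d_r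
            \<circ> mult_op (\<lambda>r. 1 / R r)) u \<phi>
       + (mult_op (\<lambda>r. \<i> / R r) \<circ> d_r \<circ> mult_op (\<lambda>r. (R r)\<^sup>2 * \<nu> r * S r)
            \<circ> mult_op (\<lambda>r. 1 / R r)) u \<phi>
       - (mult_op (\<lambda>r. 1 / R r) \<circ> d_r \<circ> mult_op (\<lambda>r. \<mu> r * (R r)\<^sup>2) \<circ> d_r
            \<circ> mult_op (\<lambda>r. 1 / R r)) u \<phi>
       - (mult_op (\<lambda>r. 1 / (R r)\<^sup>2) \<circ> sphere_laplacian) u \<phi>
       + complex_of_real (m\<^sup>2) * u \<phi>))"

definition X_space :: "real \<Rightarrow> real \<Rightarrow> real \<Rightarrow> real \<Rightarrow> real \<Rightarrow> (real^3) set \<Rightarrow> distribution set" where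
  "X_space M Q \<Lambda> r0 \<gamma> Y =
     {u \<in> H_bar \<gamma> Y. P_hat M Q \<Lambda> r0 0 0 0 u \<in> H_bar (\<gamma> - 1) Y}"

definition Ker_P_hat :: "real \<Rightarrow> real \<Rightarrow> real \<Rightarrow> real \<Rightarrow> real \<Rightarrow> (real^3) set \<Rightarrow>
    complex \<Rightarrow> real \<Rightarrow> real \<Rightarrow> distribution set" where
  "Ker_P_hat M Q \<Lambda> r0 \<gamma> Y \<sigma> s m =
     {u \<in> X_space M Q \<Lambda> r0 \<gamma> Y. vanishes_on Y (P_hat M Q \<Lambda> r0 \<sigma> s m u)}"

definition Ker_sphere_laplacian :: "(real^3) set \<Rightarrow> distribution set" where
  "Ker_sphere_laplacian Y = {u. vanishes_on Y (sphere_laplacian u)}"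

text \<open>Admissible collar widths. Including the end points of the two collars only excludes the
  borderline width \<open>r\<^sub>- - r\<^sub>c\<close>, for which \<open>\<mu>\<close> would vanish on the boundary of the domain.\<close>

definition admissible_collar :: "real \<Rightarrow> real \<Rightarrow> real \<Rightarrow> real \<Rightarrow> real \<Rightarrow> real \<Rightarrow> bool" where
  "admissible_collar M Q \<Lambda> r_minus r_plus \<eta> \<longleftrightarrow>
     \<eta> > 0 \<and> (\<forall>r \<in> {r_minus - \<eta>..<r_minus} \<union> {r_plus<..r_plus + \<eta>}. mu M Q \<Lambda> r \<noteq> 0)"

end

theory Submission
  imports Defs "HOL-Complex_Analysis.Complex_Analysis" "HOL-Probability.Probability"
begin

text \<open>On functions \<open>r w(r)\<close> the operator becomes an ordinary differential operator with regular singular points at the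
  horizons, and for \<open>\<sigma> = s = m = 0\<close> it annihilates \<open>w = 1\<close>. One looks for \<open>\<sigma> = q \<sigma>'\<close> and \<open>w = 1 + q \<integral> y\<close> with \<open>y\<close> bounded and
  holomorphic on a convex complex neighbourhood of the closed interval between the ends of the collar, on which \<open>\<nu>\<close> continues
  holomorphically. Regularity at both horizons is one scalar condition that determines \<open>\<sigma>'\<close>, and \<open>(\<sigma>', y)\<close> is the fixed point
  of a contraction. At order \<open>q\<close> one finds the real number \<open>\<sigma> = - s (r\<^sub>- + r\<^sub>+) / (r\<^sub>-\<^sup>2 + r\<^sub>+\<^sup>2)\<close>; at order \<open>q\<^sup>2\<close>, the
  imaginary part of \<open>\<sigma>\<close> is a positive multiple of \<open>J - (m / q)\<^sup>2 (r\<^sub>+\<^sup>3 - r\<^sub>-\<^sup>3) / 3\<close>, where \<open>J\<close> is the integral of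
  \<open>(e\<^sup>2 - e(r\<^sub>-)\<^sup>2) / (\<mu> r\<^sup>2)\<close> over \<open>(r\<^sub>-, r\<^sub>+)\<close> for \<open>e = Q r - Q r\<^sup>2 (r\<^sub>- + r\<^sub>+) / (r\<^sub>-\<^sup>2 + r\<^sub>+\<^sup>2)\<close>. It is positive
  once \<open>r\<^sub>+ > 5 r\<^sub>-\<close>, which small \<open>\<Lambda>\<close> guarantees.\<close>

section \<open>Calculus of \<open>C\<^sup>k\<close> functions and radial test functions\<close>

text \<open>One integration of the radial equation leaves a first-order equation with leading
  coefficient \<open>A = r^2 \<mu>\<close>, whose simple zeros at the horizons force the right-hand
  side to vanish there. Starting the integral at \<open>a\<close> settles one end; at
  \<open>b\<close> the unknown frequency enters with the coefficient \<open>a^2 + b^2\<close>, since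
  \<open>\<nu>\<close> has opposite signs at the horizons, so the condition can be solved for it.
  Holomorphic functions on a fixed domain are used because dividing by \<open>A\<close> then costs
  nothing in sup norm, and because a uniform limit of iterates stays holomorphic: smoothness across
  the horizons, hence every Sobolev order, comes for free. The Sobolev spaces are defined through
  Fourier transforms on the whole space, which is why cutoff extensions and Fourier inversion have
  to be established. Growth is a second-order effect: the leading frequency is real, so the sign of
  the imaginary part is decided by a competition between charge and mass, and the bound on
  \<open>m^2 / q^2\<close> lets the charge win.\<close>

lemma partial_eq: "(f has_derivative D) (at x) \<Longrightarrow> partial i f x = D (axis i 1)"
  unfolding partial_def by (metis frechet_derivative_at)

lemma partial_cong_open:
  assumes "open S" "x \<in> S" "\<And>y. y \<in> S \<Longrightarrow> f y = g y"
  shows "partial i f x = partial i g x"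
proof -
  have "(f has_derivative D) (at x) \<longleftrightarrow> (g has_derivative D) (at x)" for D
    using has_derivative_transform_within_open[of f D x UNIV S g] has_derivative_transform_within_open[of g D x UNIV S f] assms
    by metis
  then show ?thesis by (simp add: partial_def frechet_derivative_def)
qed

lemma C_k_Suc_D: "C_k (Suc k) f \<Longrightarrow> C_k k f"
proof (induction k arbitrary: f)
  case 0
  then show ?case
    by (auto simp: continuous_on_eq_continuous_at differentiable_imp_continuous_within)
qed auto

lemma C_k_mono: "C_k k f \<Longrightarrow> j \<le> k \<Longrightarrow> C_k j f"
  by (induction k) (metis C_k_Suc_D le_Suc_eq le_0_eq)+

lemma C_k_continuous: "C_k k f \<Longrightarrow> continuous_on UNIV f"
  using C_k_mono[of k f 0] by simp

lemma C_k_partial: "C_k (Suc k) f \<Longrightarrow> C_k k (partial i f)"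
  by simp

lemma C_k_differentiable: "C_k (Suc k) f \<Longrightarrow> f differentiable (at x)"
  by simp

lemma C_k_SucI:
  assumes "\<And>x. (f has_derivative f' x) (at x)" "\<And>i. C_k k (\<lambda>x. f' x (axis i 1))"
  shows "C_k (Suc k) f"
proof -
  have "partial i f = (\<lambda>x. f' x (axis i 1))" for i
    using partial_eq[OF assms(1)] by blast
  then show ?thesis using assms by (auto simp: differentiable_def)
qed

lemma partial_add: "f differentiable (at x) \<Longrightarrow> g differentiable (at x) \<Longrightarrow>
    partial i (\<lambda>x. f x + g x) x = partial i f x + partial i g x"
  by (subst partial_eq[OF has_derivative_add]) (auto simp: frechet_derivative_works partial_def)

lemma partial_mult: "f differentiable (at x) \<Longrightarrow> g differentiable (at x) \<Longrightarrow>
    partial i (\<lambda>x. f x * g x) x = f x * partial i g x + partial i f x * g x"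
  by (subst partial_eq[OF has_derivative_mult]) (auto simp: frechet_derivative_works partial_def)

lemma C_k_const [simp]: "C_k k (\<lambda>x. c)"
proof (induction k arbitrary: c)
  case (Suc k)
  have "partial i (\<lambda>x. c) = (\<lambda>x. 0)" for i by (rule ext) (simp add: partial_eq[OF has_derivative_const])
  then show ?case using Suc by auto
qed auto

lemma C_k_add: "C_k k f \<Longrightarrow> C_k k g \<Longrightarrow> C_k k (\<lambda>x. f x + g x)"
proof (induction k arbitrary: f g)
  case (Suc k)
  then have "partial i (\<lambda>x. f x + g x) = (\<lambda>x. partial i f x + partial i g x)" for i
    by (intro ext partial_add) auto
  then show ?case using Suc by (auto intro: differentiable_add)
qed (auto intro: continuous_intros)

lemma C_k_mult: "C_k k f \<Longrightarrow> C_k k g \<Longrightarrow> C_k k (\<lambda>x. f x * g x)"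
proof (induction k arbitrary: f g)
  case (Suc k)
  then have "partial i (\<lambda>x. f x * g x) = (\<lambda>x. f x * partial i g x + partial i f x * g x)" for i
    by (intro ext partial_mult) auto
  then show ?case using Suc.IH Suc.prems C_k_Suc_D[OF Suc.prems(1)] C_k_Suc_D[OF Suc.prems(2)]
    by (auto intro!: differentiable_mult C_k_add simp del: C_k.simps(1))
qed (auto intro: continuous_intros)

lemma C_k_sum: "(\<And>i. i \<in> I \<Longrightarrow> C_k k (f i)) \<Longrightarrow> C_k k (\<lambda>x. \<Sum>i\<in>I. f i x)"
  by (induction I rule: infinite_finite_induct) (auto intro: C_k_add)

lemma C_k_minus: "C_k k f \<Longrightarrow> C_k k (\<lambda>x. - f x)"
  using C_k_mult[of k "\<lambda>x. -1" f] by simp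

lemma C_k_diff: "C_k k f \<Longrightarrow> C_k k g \<Longrightarrow> C_k k (\<lambda>x. f x - g x)"
  using C_k_add[of k f "\<lambda>x. - g x"] C_k_minus by simp

lemma coord_has_derivative: "((\<lambda>x. of_real (x $ j) :: complex) has_derivative (\<lambda>h. of_real (h $ j))) (at x)"
  by (intro bounded_linear_imp_has_derivative bounded_linear_compose[OF bounded_linear_of_real] bounded_linear_vec_nth)

lemma C_k_coord: "C_k k (\<lambda>x. of_real (x $ j))"
proof (cases k)
  case 0 then show ?thesis by (auto intro!: continuous_intros)
next
  case (Suc k) then show ?thesis by (simp only:) (rule C_k_SucI[OF coord_has_derivative], simp)
qed

lemma partial_coord: "partial i (\<lambda>x. of_real (x $ j)) x = (if i = j then 1 else 0)"
  by (subst partial_eq[OF coord_has_derivative]) (simp add: axis_def)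

lemmas C_k_intros = C_k_add C_k_mult C_k_sum C_k_minus C_k_diff C_k_coord C_k_const

section \<open>Smooth cutoff functions on the line and radial functions built from them\<close>

definition flat :: "nat \<Rightarrow> real \<Rightarrow> real" where
  "flat n t = (if t > 0 then exp (- 1 / t) / t ^ n else 0)"

text \<open>The power in the denominator closes the family under differentiation up to linear
  combinations. At 0 the difference quotient from the right is
  \<open>exp (- 1 / h) / h ^ (n + 1)\<close>, which the exponential still forces to 0.\<close>

lemma flat_deriv: "(flat n has_real_derivative (flat (n + 2) t - real n * flat (n + 1) t)) (at t)"
proof -
  consider "t > 0" | "t < 0" | "t = 0" by linarith
  then show ?thesis
  proof cases
    case 1
    have "((\<lambda>t. exp (- 1 / t) / t ^ n) has_real_derivative (flat (n + 2) t - real n * flat (n + 1) t)) (at t)"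
      using 1 by (auto intro!: derivative_eq_intros simp: flat_def field_simps power2_eq_square)
        (cases n; simp add: field_simps)
    then show ?thesis
      by (rule has_field_derivative_transform_within_open[of _ _ _ "{0<..}"]) (use 1 in \<open>auto simp: flat_def\<close>)
  next
    case 2
    have "((\<lambda>t. 0) has_real_derivative 0) (at t)" by simp
    then have "(flat n has_real_derivative 0) (at t)"
      by (rule has_field_derivative_transform_within_open[of _ _ _ "{..<0}"]) (use 2 in \<open>auto simp: flat_def\<close>)
    then show ?thesis using 2 by (simp add: flat_def)
  next
    case 3
    have "((\<lambda>h::real. exp (- 1 / h) / h ^ (n + 1)) \<longlongrightarrow> 0) (at_right 0)" by real_asymp
    then have r: "((\<lambda>h. flat n h / h) \<longlongrightarrow> 0) (at_right 0)"
      by (rule Lim_transform_eventually) (auto simp: flat_def eventually_at_filter mult.commute)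
    have l: "((\<lambda>h. flat n h / h) \<longlongrightarrow> 0) (at_left 0)"
      by (rule Lim_transform_eventually[OF tendsto_const]) (auto simp: flat_def eventually_at_filter)
    have "((\<lambda>h. flat n h / h) \<longlongrightarrow> 0) (at 0)" using l r by (rule filterlim_split_at)
    then show ?thesis using 3 by (simp add: has_field_derivative_iff flat_def)
  qed
qed

text \<open>A syntactic stand-in for smoothness: once every member is known to have a derivative
  inside the class, derivatives of all orders follow, so one induction over these rules replaces an
  induction over the order.\<close>

inductive_set smooth_funs :: "(real \<Rightarrow> real) set" where
  flat: "(\<lambda>t. flat n (a * t + b)) \<in> smooth_funs"
| const: "(\<lambda>t. c) \<in> smooth_funs"
| add: "f \<in> smooth_funs \<Longrightarrow> g \<in> smooth_funs \<Longrightarrow> (\<lambda>t. f t + g t) \<in> smooth_funs"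
| mult: "f \<in> smooth_funs \<Longrightarrow> g \<in> smooth_funs \<Longrightarrow> (\<lambda>t. f t * g t) \<in> smooth_funs"
| inverse: "f \<in> smooth_funs \<Longrightarrow> (\<And>t. f t > 0) \<Longrightarrow> (\<lambda>t. inverse (f t)) \<in> smooth_funs"

lemma smooth_funs_deriv:
  assumes "f \<in> smooth_funs"
  shows "\<exists>f'\<in>smooth_funs. \<forall>t. (f has_real_derivative f' t) (at t)"
  using assms
proof induction
  case (flat n a b)
  have d: "((\<lambda>t. flat n (a * t + b)) has_real_derivative
      (flat (n + 2) (a * t + b) + - real n * flat (n + 1) (a * t + b)) * a) (at t)" for t
    by (rule DERIV_chain2[where f = "flat n", OF flat_deriv, THEN DERIV_cong]) (auto intro!: derivative_eq_intros)
  have m: "(\<lambda>t. (flat (n + 2) (a * t + b) + - real n * flat (n + 1) (a * t + b)) * a) \<in> smooth_funs"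
    by (intro smooth_funs.intros)
  show ?case by (rule bexI[OF _ m]) (intro allI d)
next
  case (const c)
  then show ?case by (intro bexI[of _ "\<lambda>t. 0"]) (auto intro: smooth_funs.intros)
next
  case (add f g)
  then obtain f' g' where "f' \<in> smooth_funs" "g' \<in> smooth_funs"
    "\<And>t. (f has_real_derivative f' t) (at t)" "\<And>t. (g has_real_derivative g' t) (at t)" by blast
  then show ?case by (intro bexI[of _ "\<lambda>t. f' t + g' t"] allI) (auto intro!: smooth_funs.intros derivative_intros)
next
  case (mult f g)
  then obtain f' g' where "f' \<in> smooth_funs" "g' \<in> smooth_funs"
    "\<And>t. (f has_real_derivative f' t) (at t)" "\<And>t. (g has_real_derivative g' t) (at t)" by blast
  with mult show ?case
    by (intro bexI[of _ "\<lambda>t. f' t * g t + g' t * f t"] allI) (auto intro!: smooth_funs.intros DERIV_mult)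
next
  case (inverse f)
  then obtain f' where f': "f' \<in> smooth_funs" "\<And>t. (f has_real_derivative f' t) (at t)" by blast
  have d: "((\<lambda>t. inverse (f t)) has_real_derivative (- 1 * (inverse (f t) * f' t * inverse (f t)))) (at t)" for t
    using DERIV_inverse'[OF f'(2)] inverse(2)[of t] by simp
  have m: "(\<lambda>t. - 1 * (inverse (f t) * f' t * inverse (f t))) \<in> smooth_funs"
    by (intro smooth_funs.intros f' inverse)
  show ?case by (rule bexI[OF _ m]) (intro allI d)
qed

text \<open>The cutoff is delivered together with the full sequence of its derivatives, because
  \<open>C_k_radial\<close> consumes exactly such a sequence.\<close>

lemma smooth_cutoff:
  fixes p p' q q' :: real
  assumes "p < p'" "p' \<le> q'" "q' < q"
  shows "\<exists>G :: nat \<Rightarrow> real \<Rightarrow> real. (\<forall>n t. (G n has_real_derivative G (Suc n) t) (at t)) \<and>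
     (\<forall>n t. t \<notin> {p..q} \<longrightarrow> G n t = 0) \<and> (\<forall>t\<in>{p'..q'}. G 0 t = 1) \<and> (\<forall>t. 0 \<le> G 0 t)"
proof -
  \<comment> \<open>The standard smooth step: 0 where \<open>a * t + b \<le> 0\<close> and 1 where
    \<open>a * t + b \<ge> 1\<close>. The cutoff is the product of a rising and a falling
    one.\<close>
  define s where "s a b t = flat 0 (a * t + b) * inverse (flat 0 (a * t + b) + flat 0 ((- a) * t + (1 - b)))" for a b t
  have pos: "flat 0 (a * t + b) + flat 0 ((- a) * t + (1 - b)) > 0" for a b t
    by (auto simp: flat_def add_pos_pos algebra_simps)
  have s: "s a b \<in> smooth_funs" for a b
    unfolding s_def[abs_def] by (intro smooth_funs.intros pos)
  have s0: "s a b t = 0" if "a * t + b \<le> 0" for a b t using that by (simp add: s_def flat_def)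
  have s1: "s a b t = 1" if "a * t + b \<ge> 1" for a b t
    using that pos[of a t b] by (simp add: s_def flat_def field_simps)
  have snn: "s a b t \<ge> 0" for a b t
    using pos[of a t b] by (auto simp: s_def flat_def)
  let ?a = "1 / (p' - p)" and ?b = "- p / (p' - p)" and ?c = "- 1 / (q - q')" and ?d = "q / (q - q')"
  define f where "f t = s ?a ?b t * s ?c ?d t" for t
  have fS: "f \<in> smooth_funs" unfolding f_def[abs_def] by (intro smooth_funs.intros s)
  have a: "?a * t + ?b = (t - p) / (p' - p)" "?c * t + ?d = (q - t) / (q - q')" for t
    by (simp_all add: diff_divide_distrib)
  have f0: "f t = 0" if "t \<notin> {p..q}" for t
    using that assms s0[of ?a t ?b] s0[of ?c t ?d] unfolding f_def a by (auto simp: divide_le_0_iff)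
  have f1: "f t = 1" if "t \<in> {p'..q'}" for t
    using that assms s1[of ?a t ?b] s1[of ?c t ?d] unfolding f_def a by auto
  \<comment> \<open>Dependent choice picks a derivative within \<open>smooth_funs\<close> at each
    stage; the clause for \<open>n = 0\<close> pins the start to \<open>f\<close>.\<close>
  have "\<exists>G. \<forall>n. (G n \<in> smooth_funs \<and> (n = 0 \<longrightarrow> G n = f)) \<and> (\<forall>t. (G n has_real_derivative G (Suc n) t) (at t))"
    by (rule dependent_nat_choice) (use fS smooth_funs_deriv in \<open>auto simp: Bex_def\<close>)
  then obtain G where G: "G 0 = f" "\<And>n t. (G n has_real_derivative G (Suc n) t) (at t)" by blast
  have "\<forall>t. t \<notin> {p..q} \<longrightarrow> G n t = 0" for n
  proof (induction n)
    case 0 then show ?case using f0 G by auto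
  next
    case (Suc n)
    show ?case
    proof (intro allI impI)
      fix t assume t: "t \<notin> {p..q}"
      have "((\<lambda>t. 0) has_real_derivative 0) (at t)" by simp
      then have "(G n has_real_derivative 0) (at t)"
        by (rule has_field_derivative_transform_within_open[of _ _ _ "- {p..q}"]) (use t Suc in auto)
      then show "G (Suc n) t = 0" using G(2) DERIV_unique by blast
    qed
  qed
  then show ?thesis
    using G f1 snn by (intro exI[of _ G]) (auto simp: f_def)
qed

text \<open>Composing with \<open>x \<bullet> x\<close> instead of the norm avoids the singularity
  of the norm at the origin. \<open>W\<close> has to be differentiable only on the interval that
  supports \<open>G\<close>, as the product vanishes elsewhere. Each partial derivative is
  \<open>2 * x $ l\<close> times a sum of two products of the same kind with raised indices, hence
  the induction with \<open>i\<close> and \<open>j\<close> arbitrary.\<close>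

lemma C_k_radial:
  fixes G :: "nat \<Rightarrow> real \<Rightarrow> real" and W :: "nat \<Rightarrow> real \<Rightarrow> complex"
  assumes G: "\<And>n t. (G n has_real_derivative G (Suc n) t) (at t)" "\<And>n t. t \<notin> {p..q} \<Longrightarrow> G n t = 0"
    and W: "\<And>n t. t \<in> {p..q} \<Longrightarrow> (W n has_vector_derivative W (Suc n) t) (at t)"
  shows "C_k k (\<lambda>x. of_real (G i (x \<bullet> x)) * W j (x \<bullet> x))"
proof -
  have prod: "((\<lambda>t. of_real (G i t) * W j t) has_vector_derivative
      (of_real (G (Suc i) t) * W j t + of_real (G i t) * W (Suc j) t)) (at t)" for i j t
  proof (cases "t \<in> {p..q}")
    case True
    have "((\<lambda>t. complex_of_real (G i t)) has_vector_derivative of_real (G (Suc i) t)) (at t)"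
      using G(1)[of i t] has_vector_derivative_of_real by (simp add: has_real_derivative_iff_has_vector_derivative)
    from has_vector_derivative_mult[OF this W[OF True]] show ?thesis by (simp add: add.commute)
  next
    case False
    have "((\<lambda>t. 0::complex) has_vector_derivative 0) (at t)" by simp
    then have "((\<lambda>t. of_real (G i t) * W j t) has_vector_derivative 0) (at t)"
      by (rule has_vector_derivative_transform_within_open[of _ _ _ "- {p..q}"]) (use G(2) False in auto)
    then show ?thesis using G(2)[OF False] by simp
  qed
  have der: "((\<lambda>x. of_real (G i (x \<bullet> x)) * W j (x \<bullet> x)) has_derivative
      (\<lambda>h. (2 * (x \<bullet> h)) *\<^sub>R (of_real (G (Suc i) (x \<bullet> x)) * W j (x \<bullet> x) + of_real (G i (x \<bullet> x)) * W (Suc j) (x \<bullet> x)))) (at x)"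
    for i j and x :: "real^3"
  proof -
    have 1: "((\<lambda>x. x \<bullet> x) has_derivative (\<lambda>h. 2 * (x \<bullet> h))) (at x)"
      by (rule derivative_eq_intros refl)+ (simp add: inner_commute)
    from prod[of i j "x \<bullet> x", unfolded has_vector_derivative_def]
    show ?thesis by (rule has_derivative_compose[OF 1, of "\<lambda>t. of_real (G i t) * W j t"])
  qed
  show ?thesis
  proof (induction k arbitrary: i j)
    case 0
    have "continuous (at x) (\<lambda>x. of_real (G i (x \<bullet> x)) * W j (x \<bullet> x))" for x :: "real^3"
      using der has_derivative_continuous by blast
    then show ?case by (simp add: continuous_on_eq_continuous_at)
  next
    case (Suc k)
    have "C_k k (\<lambda>x. 2 * of_real (x $ l) * (of_real (G (Suc i) (x \<bullet> x)) * W j (x \<bullet> x) + of_real (G i (x \<bullet> x)) * W (Suc j) (x \<bullet> x)))" for l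
      by (intro C_k_intros Suc)
    then show ?case
      by (intro C_k_SucI[OF der]) (simp add: inner_axis scaleR_conv_of_real)
  qed
qed

text \<open>In terms of \<open>t = x \<bullet> x\<close> the function \<open>f (norm x)\<close> is
  \<open>f (csqrt t)\<close>, holomorphic near the relevant squared radii, so its higher complex
  derivatives serve as \<open>W\<close> in \<open>C_k_radial\<close>.\<close>

lemma radial_extension:
  assumes f: "f holomorphic_on U" "open U" and ab: "0 < a" "a \<le> b" and sub: "of_real ` {a..b} \<subseteq> U"
  shows "\<exists>F R. (\<forall>k. C_k k F) \<and> (\<forall>x. norm x > R \<longrightarrow> F x = 0) \<and>
    (\<forall>x. a \<le> norm x \<and> norm x \<le> b \<longrightarrow> F x = f (of_real (norm x)))"
proof -
  define J where "J = {t::real. of_real t \<in> U}"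
  have J: "open J" unfolding J_def using continuous_open_vimage[OF f(2), of complex_of_real] by (simp add: vimage_def continuous_on_eq_continuous_at)
  have "{a..b} \<subseteq> J" using sub by (auto simp: J_def)
  then obtain d where d: "d > 0" "(\<Union>x\<in>{a..b}. cball x d) \<subseteq> J"
    using compact_subset_open_imp_cball_epsilon_subset[OF compact_Icc J] by metis
  \<comment> \<open>The margin keeps the widened interval inside \<open>U\<close> and, through
    \<open>a / 2\<close>, away from 0, where the square root is singular.\<close>
  define e where "e = min d (a / 2)"
  have e: "e > 0" "a - e > 0" "e \<le> d" using d ab by (auto simp: e_def min_def)
  have eJ: "t \<in> J" if "a - e \<le> t" "t \<le> b + e" for t
  proof -
    have "t \<in> cball (max a (min b t)) d" using that e ab by (auto simp: dist_real_def)
    moreover have "max a (min b t) \<in> {a..b}" using ab by auto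
    ultimately show ?thesis using d by blast
  qed
  define V where "V = {z. Re z > 0} \<inter> csqrt -` U"
  have rV: "open {z. Re z > 0}" by (rule open_halfspace_Re_gt)
  have cs: "csqrt holomorphic_on {z. Re z > 0}" by (rule holomorphic_on_csqrt') (auto simp: complex_nonpos_Reals_iff)
  have V: "open V" unfolding V_def
    by (rule continuous_open_preimage[OF holomorphic_on_imp_continuous_on[OF cs] rV f(2)])
  define g where "g = f \<circ> csqrt"
  have g: "g holomorphic_on V" unfolding g_def
    by (rule holomorphic_on_compose_gen[OF holomorphic_on_subset[OF cs] f(1)]) (auto simp: V_def)
  define W where "W n t = (deriv ^^ n) g (of_real t)" for n and t :: real
  let ?p = "(a - e)\<^sup>2" and ?q = "(b + e)\<^sup>2"
  have cV: "complex_of_real t \<in> V" if "t \<in> {?p..?q}" for t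
  proof -
    have "t > 0" using that e by (metis atLeastAtMost_iff less_le_trans zero_less_power)
    moreover have "a - e \<le> sqrt t" "sqrt t \<le> b + e"
      using that e ab by (auto intro: real_le_rsqrt real_le_lsqrt)
    ultimately show ?thesis using eJ[of "sqrt t"] by (simp add: V_def J_def csqrt_of_real_nonneg)
  qed
  have W: "(W n has_vector_derivative W (Suc n) t) (at t)" if "t \<in> {?p..?q}" for n t
  proof -
    have "(deriv ^^ n) g holomorphic_on V" by (rule holomorphic_higher_deriv[OF g V])
    from holomorphic_derivI[OF this V cV[OF that]]
    have "((deriv ^^ n) g has_field_derivative (deriv ^^ Suc n) g (of_real t)) (at (of_real t))" by simp
    from has_vector_derivative_real_field[OF this] show ?thesis by (simp add: W_def[abs_def])
  qed
  have "?p < a\<^sup>2" "a\<^sup>2 \<le> b\<^sup>2" "b\<^sup>2 < ?q" using e ab by (auto intro!: power_strict_mono power_mono)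
  from smooth_cutoff[OF this] obtain G where "\<forall>n t. (G n has_real_derivative G (Suc n) t) (at t)"
    "\<forall>n t. t \<notin> {?p..?q} \<longrightarrow> G n t = 0" "\<forall>t\<in>{a\<^sup>2..b\<^sup>2}. G 0 t = (1::real)" by (elim exE conjE)
  then have G: "(G n has_real_derivative G (Suc n) t) (at t)" "t \<notin> {?p..?q} \<Longrightarrow> G n t = 0"
    "t \<in> {a\<^sup>2..b\<^sup>2} \<Longrightarrow> G 0 t = 1" for n t by simp_all
  define F where "F x = of_real (G 0 (x \<bullet> x)) * W 0 (x \<bullet> x)" for x :: "real^3"
  have "F x = 0" if "norm x > b + e" for x
  proof -
    have "norm x ^ 2 > ?q" using that ab e by (intro power_strict_mono) auto
    then show ?thesis by (simp add: F_def G(2) power2_norm_eq_inner)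
  qed
  moreover have "F x = f (of_real (norm x))" if "a \<le> norm x" "norm x \<le> b" for x
  proof -
    have "x \<bullet> x \<in> {a\<^sup>2..b\<^sup>2}" using that ab unfolding power2_norm_eq_inner[symmetric] by (auto intro!: power_mono)
    then show ?thesis
      by (simp add: F_def G(3) W_def g_def csqrt_of_real_nonneg norm_eq_sqrt_inner)
  qed
  moreover have "C_k k F" for k unfolding F_def[abs_def]
    by (rule C_k_radial[where p = ?p and q = ?q]) (use G W in auto)
  ultimately show ?thesis by blast
qed

lemma radial_bump:
  fixes a b :: real
  assumes "0 < a" "a < b"
  shows "\<exists>F. (\<forall>k. C_k k F) \<and> (\<forall>x. F x \<in> \<real> \<and> 0 \<le> Re (F x)) \<and> (\<forall>x. norm x \<notin> {a..b} \<longrightarrow> F x = 0) \<and> (\<exists>x. F x = 1)"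
proof -
  have m: "a\<^sup>2 < ((a + b) / 2)\<^sup>2" "((a + b) / 2)\<^sup>2 < b\<^sup>2" using assms by (auto intro!: power_strict_mono)
  \<comment> \<open>The plateau degenerates to a single squared radius; the value 1 there makes the
    bump nonzero.\<close>
  from smooth_cutoff[OF m(1) order_refl m(2)] obtain G where *: "\<forall>n t. (G n has_real_derivative G (Suc n) t) (at t)"
    "\<forall>n t. t \<notin> {a\<^sup>2..b\<^sup>2} \<longrightarrow> G n t = 0" "\<forall>t\<in>{((a + b) / 2)\<^sup>2..((a + b) / 2)\<^sup>2}. G 0 t = (1::real)" "\<forall>t. 0 \<le> G 0 t"
    by (elim exE conjE)
  then have G: "(G n has_real_derivative G (Suc n) t) (at t)" "t \<notin> {a\<^sup>2..b\<^sup>2} \<Longrightarrow> G n t = 0"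
    "G 0 (((a + b) / 2)\<^sup>2) = 1" "0 \<le> G 0 t" for n t by simp_all
  have "C_k k (\<lambda>x. of_real (G 0 (x \<bullet> x)) * 1)" for k
    using C_k_radial[where G = G and p = "a\<^sup>2" and q = "b\<^sup>2" and i = 0 and W = "\<lambda>n t. if n = 0 then 1 else 0" and j = 0] G
    by (simp cong: if_cong)
  moreover have "norm x \<notin> {a..b} \<longrightarrow> of_real (G 0 (x \<bullet> x)) = (0::complex)" for x :: "real^3"
    using G(2)[of "x \<bullet> x" 0] assms unfolding power2_norm_eq_inner[symmetric]
    by (auto simp: abs_le_square_iff[symmetric])
  moreover have "of_real (G 0 (axis 1 ((a + b) / 2) \<bullet> axis 1 ((a + b) / 2))) = (1::complex)"
    using G(3) by (simp add: inner_axis_axis power2_eq_square)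
  ultimately show ?thesis using G(4)
    by (intro exI[of _ "\<lambda>x. of_real (G 0 (x \<bullet> x))"]) (auto intro: exI[of _ "axis 1 ((a + b) / 2)"])
qed

section \<open>Radial distributions on a shell\<close>

lemma integrable_compact_support:
  fixes f :: "real^3 \<Rightarrow> complex"
  assumes "continuous_on UNIV f" "\<And>x. norm x > R \<Longrightarrow> f x = 0"
  shows "integrable lborel f"
proof -
  have "integrable lborel (\<lambda>x. indicator (cball 0 R) x *\<^sub>R f x)"
    using assms(1) by (intro borel_integrable_compact compact_cball) (rule continuous_on_subset, auto)
  also have "(\<lambda>x. indicator (cball 0 R) x *\<^sub>R f x) = f"
    using assms(2) by (force simp: indicator_def not_le)
  finally show ?thesis .
qed

lemma partial_zero_outside:
  assumes "\<And>x. norm x > R \<Longrightarrow> f x = 0" "norm x > R"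
  shows "partial i f x = 0"
proof -
  have "open {x::real^3. norm x > R}" by (simp add: open_Collect_less continuous_on_norm)
  then have "partial i f x = partial i (\<lambda>_. 0) x"
    by (rule partial_cong_open) (use assms in auto)
  then show ?thesis by (simp add: partial_eq[OF has_derivative_const])
qed

lemma partial_line:
  assumes "f differentiable (at (x + t *\<^sub>R axis i 1))"
  shows "((\<lambda>t. f (x + t *\<^sub>R axis i 1)) has_vector_derivative partial i f (x + t *\<^sub>R axis i 1)) (at t)"
proof -
  let ?g = "\<lambda>t. x + t *\<^sub>R axis i (1::real)"
  have 1: "(?g has_derivative (\<lambda>h. h *\<^sub>R axis i 1)) (at t)"
    by (auto intro!: derivative_eq_intros)
  have f: "(f has_derivative frechet_derivative f (at (?g t))) (at (?g t))"
    using assms by (simp add: frechet_derivative_works)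
  have "frechet_derivative f (at (?g t)) (h *\<^sub>R axis i 1) = h *\<^sub>R partial i f (?g t)" for h
    using linear_frechet_derivative[OF assms] by (simp add: partial_def linear_scale)
  with has_derivative_compose[OF 1 f] show ?thesis
    by (simp add: has_vector_derivative_def)
qed

text \<open>Difference quotients integrate to 0 by translation invariance of Lebesgue measure, and
  they converge to the partial derivative under a common integrable bound. Every integration by
  parts below rests on this.\<close>

lemma integral_partial_eq_0:
  assumes f: "C_k (Suc 0) f" and R: "\<And>x. norm x > R \<Longrightarrow> f x = 0"
  shows "(LINT x|lborel. partial i f x) = 0"
proof -
  let ?e = "axis i (1::real) :: real^3"
  define g where "g n x = (real n + 1) *\<^sub>R (f (x + (1 / (real n + 1)) *\<^sub>R ?e) - f x)" for n :: nat and x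
  have cf: "continuous_on UNIV f" using f by (rule C_k_continuous)
  have cp: "continuous_on UNIV (partial i f)" using f by simp
  have intf: "integrable lborel f" by (rule integrable_compact_support[OF cf R])
  have meas: "f \<in> borel_measurable borel" using cf by (rule borel_measurable_continuous_onI)
  have trans: "integrable lborel (\<lambda>x. f (x + v))" "(LINT x|lborel. f (x + v)) = (LINT x|lborel. f x)" for v
  proof -
    have l: "distr lborel borel ((+) v) = lborel" by (rule lborel_distr_plus)
    have "integrable (distr lborel borel ((+) v)) f" unfolding l by (rule intf)
    then show "integrable lborel (\<lambda>x. f (x + v))"
      using meas by (simp add: integrable_distr_eq add.commute[of v])
    have "(LINT x|distr lborel borel ((+) v). f x) = (LINT x|lborel. f (v + x))"
      using meas by (subst integral_distr) auto
    then show "(LINT x|lborel. f (x + v)) = (LINT x|lborel. f x)" by (simp add: l add.commute)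
  qed
  have g0: "(LINT x|lborel. g n x) = 0" for n
    unfolding g_def integral_scaleR_right Bochner_Integration.integral_diff[OF trans(1) intf] trans(2) by simp
  have "compact (partial i f ` cball 0 (max 0 R))"
    using cp by (intro compact_continuous_image compact_cball) (rule continuous_on_subset, auto)
  then obtain B where B': "\<forall>y\<in>partial i f ` cball 0 (max 0 R). norm y \<le> B"
    using compact_imp_bounded bounded_iff by blast
  then have B: "norm (partial i f x) \<le> B" if "x \<in> cball 0 (max 0 R)" for x using that by blast
  have B0: "B \<ge> 0" using order_trans[OF norm_ge_zero B[of 0]] by simp
  have Bx: "norm (partial i f x) \<le> B" for x
  proof (cases "norm x \<le> max 0 R")
    case True then show ?thesis using B[of x] by simp
  next
    case False
    then have "partial i f x = 0" by (intro partial_zero_outside[of R] R) auto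
    then show ?thesis using B0 by simp
  qed
  \<comment> \<open>The steps are at most 1, so all quotients are supported in the ball of radius
    \<open>\<bar>R\<bar> + 1\<close>; there the mean value inequality bounds them by
    \<open>B\<close>.\<close>
  have bound: "norm (g n x) \<le> indicator (cball 0 (\<bar>R\<bar> + 1)) x *\<^sub>R B" for n x
  proof (cases "norm x \<le> \<bar>R\<bar> + 1")
    case True
    let ?h = "1 / (real n + 1)"
    have "norm (f (x + ?h *\<^sub>R ?e) - f (x + 0 *\<^sub>R ?e)) \<le> B * norm (?h - 0)"
    proof (rule differentiable_bound[where f = "\<lambda>t. f (x + t *\<^sub>R ?e)" and S = UNIV])
      fix t
      have "((\<lambda>t. f (x + t *\<^sub>R ?e)) has_vector_derivative partial i f (x + t *\<^sub>R ?e)) (at t)"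
        by (rule partial_line) (use f in simp)
      then show "((\<lambda>t. f (x + t *\<^sub>R ?e)) has_derivative (\<lambda>h. h *\<^sub>R partial i f (x + t *\<^sub>R ?e))) (at t)"
        by (simp add: has_vector_derivative_def)
      show "onorm (\<lambda>h. h *\<^sub>R partial i f (x + t *\<^sub>R ?e)) \<le> B"
        by (rule onorm_le) (simp add: mult.commute[of B] mult_left_mono Bx)
    qed auto
    then have "norm (f (x + ?h *\<^sub>R ?e) - f x) \<le> B * ?h" by simp
    then have "(real n + 1) * norm (f (x + ?h *\<^sub>R ?e) - f x) \<le> (real n + 1) * (B * ?h)"
      by (intro mult_left_mono) auto
    then show ?thesis using True by (simp add: g_def)
  next
    case False
    have "norm (x + (1 / (real n + 1)) *\<^sub>R ?e) \<ge> norm x - 1"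
    proof -
      have "norm ((1 / (real n + 1)) *\<^sub>R ?e) \<le> 1" by simp
      then show ?thesis using norm_diff_ineq[of x "(1 / (real n + 1)) *\<^sub>R ?e"] by linarith
    qed
    then have "f (x + (1 / (real n + 1)) *\<^sub>R ?e) = 0" "f x = 0" using False by (intro R; linarith)+
    then show ?thesis using B0 by (simp add: g_def)
  qed
  have lim: "(\<lambda>n. g n x) \<longlonglongrightarrow> partial i f x" for x
  proof -
    have "((\<lambda>t. f (x + t *\<^sub>R ?e)) has_vector_derivative partial i f (x + 0 *\<^sub>R ?e)) (at 0)"
      by (rule partial_line) (use f in simp)
    then have "((\<lambda>h. norm (f (x + h *\<^sub>R ?e) - f x - h *\<^sub>R partial i f x) / norm h) \<longlongrightarrow> 0) (at 0)"
      by (simp add: has_vector_derivative_def has_derivative_at)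
    then have "((\<lambda>h. norm ((f (x + h *\<^sub>R ?e) - f x) /\<^sub>R h - partial i f x)) \<longlongrightarrow> 0) (at 0)"
    proof (rule Lim_transform_eventually)
      have "norm (f (x + h *\<^sub>R ?e) - f x - h *\<^sub>R partial i f x) / norm h = norm ((f (x + h *\<^sub>R ?e) - f x) /\<^sub>R h - partial i f x)"
        if "h \<noteq> 0" for h
      proof -
        have "(f (x + h *\<^sub>R ?e) - f x) /\<^sub>R h - partial i f x = (f (x + h *\<^sub>R ?e) - f x - h *\<^sub>R partial i f x) /\<^sub>R h"
          using that by (simp add: scaleR_diff_right)
        then show ?thesis by (simp only: norm_scaleR abs_inverse divide_inverse real_norm_def mult.commute)
      qed
      then show "\<forall>\<^sub>F h in at 0. norm (f (x + h *\<^sub>R ?e) - f x - h *\<^sub>R partial i f x) / norm h = norm ((f (x + h *\<^sub>R ?e) - f x) /\<^sub>R h - partial i f x)"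
        by (auto simp: eventually_at_filter)
    qed
    then have *: "((\<lambda>t. (f (x + t *\<^sub>R ?e) - f x) /\<^sub>R t) \<longlongrightarrow> partial i f x) (at 0)"
      by (rule LIM_zero_cancel[OF tendsto_norm_zero_cancel])
    have "filterlim (\<lambda>n. 1 / (real n + 1)) (at 0) sequentially"
    proof -
      have "(\<lambda>n. 1 / (real n + 1)) \<longlonglongrightarrow> 0" by real_asymp
      moreover have "1 / (real n + 1) \<noteq> 0" for n using of_nat_0_le_iff[of n, where 'a = real] by auto
      ultimately show ?thesis by (auto simp: filterlim_at)
    qed
    from filterlim_compose[OF * this] show ?thesis by (simp add: g_def[abs_def])
  qed
  have "(\<lambda>n. LINT x|lborel. g n x) \<longlonglongrightarrow> (LINT x|lborel. partial i f x)"
  proof (rule integral_dominated_convergence[where w = "\<lambda>x. indicator (cball 0 (\<bar>R\<bar> + 1)) x *\<^sub>R B"])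
    show "partial i f \<in> borel_measurable lborel"
      using borel_measurable_continuous_onI[OF cp] by simp
    show "g n \<in> borel_measurable lborel" for n
      unfolding g_def[abs_def]
      by (intro borel_measurable_integrable integrable_scaleR_right Bochner_Integration.integrable_diff trans(1) intf)
    show "integrable lborel (\<lambda>x. indicator (cball 0 (\<bar>R\<bar> + 1)) x *\<^sub>R B)"
      by (rule borel_integrable_compact) auto
    show "AE x in lborel. (\<lambda>n. g n x) \<longlonglongrightarrow> partial i f x" by (rule AE_I2) (rule lim)
    show "AE x in lborel. norm (g n x) \<le> indicator (cball 0 (\<bar>R\<bar> + 1)) x *\<^sub>R B" for n
      by (rule AE_I2) (rule bound)
  qed
  then have "(\<lambda>n. 0) \<longlonglongrightarrow> (LINT x|lborel. partial i f x)" unfolding g0 .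
  from LIMSEQ_unique[OF this tendsto_const] show ?thesis by simp
qed

text \<open>Test functions of finite regularity: the index \<open>k\<close> records how many
  derivatives remain, since the differential operators applied to a test function consume
  them.\<close>

definition csupp :: "(real^3) set \<Rightarrow> nat \<Rightarrow> (real^3 \<Rightarrow> complex) \<Rightarrow> bool" where
  "csupp Y k \<phi> \<longleftrightarrow> C_k k \<phi> \<and> compact (closure {x. \<phi> x \<noteq> 0}) \<and> closure {x. \<phi> x \<noteq> 0} \<subseteq> Y"

lemma test_functions_csupp: "\<phi> \<in> test_functions Y \<longleftrightarrow> (\<forall>k. csupp Y k \<phi>)"
  by (auto simp: test_functions_def csupp_def)

lemma csupp_mono: "csupp Y k \<phi> \<Longrightarrow> j \<le> k \<Longrightarrow> csupp Y j \<phi>"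
  using C_k_mono by (auto simp: csupp_def)

lemma csupp_outside: "csupp Y k \<phi> \<Longrightarrow> x \<notin> Y \<Longrightarrow> \<phi> x = 0"
  using closure_subset[of "{x. \<phi> x \<noteq> 0}"] by (auto simp: csupp_def)

lemma csupp_subset:
  assumes "csupp Y j \<phi>" "C_k k \<psi>" "\<And>x. x \<notin> closure {x. \<phi> x \<noteq> 0} \<Longrightarrow> \<psi> x = 0"
  shows "csupp Y k \<psi>"
proof -
  have "closure {x. \<psi> x \<noteq> 0} \<subseteq> closure {x. \<phi> x \<noteq> 0}"
    using assms(3) by (intro closure_minimal) auto
  moreover from this have "compact (closure {x. \<psi> x \<noteq> 0})"
    using compact_Int_closed[of "closure {x. \<phi> x \<noteq> 0}" "closure {x. \<psi> x \<noteq> 0}"] assms(1)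
    by (simp add: csupp_def Int_absorb1)
  ultimately show ?thesis using assms unfolding csupp_def by blast
qed

lemma csupp_mult: "csupp Y k \<phi> \<Longrightarrow> C_k k F \<Longrightarrow> csupp Y k (\<lambda>x. F x * \<phi> x)"
  by (rule csupp_subset[of Y k \<phi>]) (use closure_subset[of "{x. \<phi> x \<noteq> 0}"] in \<open>auto simp: csupp_def C_k_mult\<close>)

lemma partial_zero_off_support:
  assumes "x \<notin> closure {x. \<phi> x \<noteq> 0}" shows "partial i \<phi> x = 0"
proof -
  have "partial i \<phi> x = partial i (\<lambda>_. 0) x"
    by (rule partial_cong_open[of "- closure {x. \<phi> x \<noteq> 0}"])
      (use assms closure_subset[of "{x. \<phi> x \<noteq> 0}"] in auto)
  then show ?thesis by (simp add: partial_eq[OF has_derivative_const])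
qed

lemma csupp_partial: "csupp Y (Suc k) \<phi> \<Longrightarrow> csupp Y k (partial i \<phi>)"
  by (rule csupp_subset[of Y "Suc k" \<phi>]) (auto simp: partial_zero_off_support csupp_def)

lemma csupp_bounded:
  assumes "csupp Y k \<phi>" shows "\<exists>R. \<forall>x. norm x > R \<longrightarrow> \<phi> x = 0"
proof -
  have "bounded (closure {x. \<phi> x \<noteq> 0})" using assms compact_imp_bounded by (auto simp: csupp_def)
  then obtain R where R: "\<forall>x\<in>closure {x. \<phi> x \<noteq> 0}. norm x \<le> R" unfolding bounded_iff by blast
  have "\<phi> x = 0" if "norm x > R" for x
    using R closure_subset[of "{x. \<phi> x \<noteq> 0}"] that by (meson CollectI not_le subset_eq)
  then show ?thesis by blast
qed

lemma csupp_integrable: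
  assumes "csupp Y k \<phi>" shows "integrable lborel \<phi>"
proof -
  from csupp_bounded[OF assms] obtain R where R: "\<forall>x. norm x > R \<longrightarrow> \<phi> x = 0" by blast
  have "continuous_on UNIV \<phi>" using assms C_k_continuous unfolding csupp_def by blast
  then show ?thesis by (rule integrable_compact_support[where R = R]) (use R in simp)
qed

lemma csupp_integral_partial:
  assumes "csupp Y (Suc 0) \<phi>" shows "(LINT x|lborel. partial i \<phi> x) = 0"
proof -
  from csupp_bounded[OF assms] obtain R where R: "\<forall>x. norm x > R \<longrightarrow> \<phi> x = 0" by blast
  show ?thesis by (rule integral_partial_eq_0[of \<phi> R]) (use R assms in \<open>simp_all add: csupp_def del: C_k.simps\<close>)
qed

lemma csupp_sum: "finite I \<Longrightarrow> (\<And>i. i \<in> I \<Longrightarrow> csupp Y k (f i)) \<Longrightarrow> csupp Y k (\<lambda>x. \<Sum>i\<in>I. f i x)"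
proof (induction I rule: finite_induct)
  case empty
  then show ?case by (simp add: csupp_def)
next
  case (insert i I)
  then have *: "csupp Y k (f i)" "csupp Y k (\<lambda>x. \<Sum>i\<in>I. f i x)" by auto
  have "closure {x. f i x + (\<Sum>i\<in>I. f i x) \<noteq> 0} \<subseteq> closure {x. f i x \<noteq> 0} \<union> closure {x. (\<Sum>i\<in>I. f i x) \<noteq> 0}" (is "?A \<subseteq> ?B")
    unfolding closure_Un[symmetric] by (rule closure_mono) auto
  moreover have "compact ?B" using * by (auto simp: csupp_def)
  ultimately have "compact ?A" using compact_Int_closed[of ?B ?A] by (simp add: Int_absorb1)
  then show ?case using insert(1,2) * \<open>?A \<subseteq> ?B\<close> by (auto simp: csupp_def C_k_add)
qed

lemma frechet_derivative_expand:
  assumes "f differentiable (at x)"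
  shows "frechet_derivative f (at x) h = (\<Sum>i\<in>UNIV. of_real (h $ i) * partial i f x)"
proof -
  have "h = (\<Sum>i\<in>UNIV. (h $ i) *\<^sub>R axis i 1)"
    using basis_expansion[of h] by (simp add: scalar_mult_eq_scaleR)
  then have "frechet_derivative f (at x) h = frechet_derivative f (at x) (\<Sum>i\<in>UNIV. (h $ i) *\<^sub>R axis i 1)" by simp
  also have "\<dots> = (\<Sum>i\<in>UNIV. (h $ i) *\<^sub>R partial i f x)"
    using linear_frechet_derivative[OF assms] by (simp add: linear_sum linear_scale partial_def)
  finally show ?thesis by (simp add: scaleR_conv_of_real)
qed

lemma radial_deriv_eq:
  assumes "\<phi> differentiable (at x)"
  shows "radial_deriv \<phi> x = (\<Sum>i\<in>UNIV. of_real (x $ i) / of_real (norm x) * partial i \<phi> x)"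
proof (cases "x = 0")
  case True then show ?thesis by (simp add: radial_deriv_def)
next
  case False
  have 1: "((\<lambda>r. r *\<^sub>R sgn x) has_derivative (\<lambda>h. h *\<^sub>R sgn x)) (at (norm x))"
    by (auto intro!: derivative_eq_intros)
  have n: "norm x *\<^sub>R sgn x = x" using False by (simp add: sgn_div_norm)
  have "(\<phi> has_derivative frechet_derivative \<phi> (at x)) (at (norm x *\<^sub>R sgn x))"
    using assms n by (simp add: frechet_derivative_works)
  from has_derivative_compose[OF 1 this]
  have "((\<lambda>r. \<phi> (r *\<^sub>R sgn x)) has_derivative (\<lambda>h. h *\<^sub>R frechet_derivative \<phi> (at x) (sgn x))) (at (norm x))"
    using linear_frechet_derivative[OF assms] by (simp add: linear_scale)
  then have "radial_deriv \<phi> x = frechet_derivative \<phi> (at x) (sgn x)"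
    unfolding radial_deriv_def by (intro vector_derivative_at) (simp add: has_vector_derivative_def)
  then show ?thesis by (simp add: frechet_derivative_expand[OF assms] sgn_div_norm divide_inverse mult_ac)
qed

lemma of_real_norm_has_derivative:
  assumes "x \<noteq> (0::real^3)"
  shows "(norm has_derivative (\<lambda>h. (x \<bullet> h) / norm x)) (at x)"
  using has_derivative_norm[OF assms]
  by (simp add: sgn_div_norm divide_inverse inner_commute mult.commute)

lemma sum_coord_sq: "(\<Sum>i\<in>UNIV. complex_of_real (x $ i) * of_real (x $ i)) = (of_real (norm x))\<^sup>2" for x :: "real^3"
proof -
  have "(\<Sum>i\<in>UNIV. x $ i * x $ i) = (norm x)\<^sup>2" by (simp add: power2_norm_eq_inner inner_vec_def)
  then have "complex_of_real (\<Sum>i\<in>UNIV. x $ i * x $ i) = of_real ((norm x)\<^sup>2)" by (rule arg_cong)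
  then show ?thesis by (simp only: of_real_sum of_real_mult of_real_power)
qed

locale radial_shell =
  fixes U :: "complex set" and a b :: real
  assumes U: "open U" and ab: "0 < a" "a < b" and sub: "of_real ` {a..b} \<subseteq> U" and U_nonzero: "\<And>z. z \<in> U \<Longrightarrow> z \<noteq> 0"
begin

abbreviation "Y \<equiv> shell a b"

lemma Y_norm: "x \<in> Y \<Longrightarrow> a < norm x \<and> norm x < b \<and> x \<noteq> 0 \<and> of_real (norm x) \<in> U"
  using ab sub by (auto simp: shell_def)

lemma open_Y: "open Y"
  unfolding shell_def by (intro open_Collect_conj open_Collect_less continuous_intros)

text \<open>\<open>C_k\<close> asks for differentiability on all of the space, whereas
  \<open>f (norm x)\<close> is controlled only near the shell. The extension supplies a global
  smooth representative that agrees with it on the closed shell.\<close>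

definition ext :: "(complex \<Rightarrow> complex) \<Rightarrow> real^3 \<Rightarrow> complex" where
  "ext f = (SOME F. (\<forall>k. C_k k F) \<and> (\<exists>R. \<forall>x. norm x > R \<longrightarrow> F x = 0) \<and>
     (\<forall>x. a \<le> norm x \<and> norm x \<le> b \<longrightarrow> F x = f (of_real (norm x))))"

lemma ext:
  assumes "f holomorphic_on U"
  shows "C_k k (ext f)" "\<exists>R. \<forall>x. norm x > R \<longrightarrow> ext f x = 0"
    "a \<le> norm x \<Longrightarrow> norm x \<le> b \<Longrightarrow> ext f x = f (of_real (norm x))"
proof -
  have "\<exists>F. (\<forall>k. C_k k F) \<and> (\<exists>R. \<forall>x. norm x > R \<longrightarrow> F x = 0) \<and>
     (\<forall>x. a \<le> norm x \<and> norm x \<le> b \<longrightarrow> F x = f (of_real (norm x)))"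
    using radial_extension[OF assms U ab(1) less_imp_le[OF ab(2)] sub] by blast
  from someI_ex[OF this] have *: "(\<forall>k. C_k k (ext f)) \<and> (\<exists>R. \<forall>x. norm x > R \<longrightarrow> ext f x = 0) \<and>
     (\<forall>x. a \<le> norm x \<and> norm x \<le> b \<longrightarrow> ext f x = f (of_real (norm x)))"
    unfolding ext_def .
  show "C_k k (ext f)" using * by simp
  show "\<exists>R. \<forall>x. norm x > R \<longrightarrow> ext f x = 0" using * by (elim conjE)
  show "a \<le> norm x \<Longrightarrow> norm x \<le> b \<Longrightarrow> ext f x = f (of_real (norm x))" using * by simp
qed

lemma ext_Y: "f holomorphic_on U \<Longrightarrow> x \<in> Y \<Longrightarrow> ext f x = f (of_real (norm x))"
  using ext(3)[of f x] Y_norm[of x] by auto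

lemma partial_ext:
  assumes f: "f holomorphic_on U" and x: "x \<in> Y"
  shows "partial i (ext f) x = deriv f (of_real (norm x)) * of_real (x $ i) / of_real (norm x)"
proof -
  have "partial i (ext f) x = partial i (\<lambda>y. f (of_real (norm y))) x"
    by (rule partial_cong_open[OF open_Y x]) (rule ext_Y[OF f])
  moreover have "((\<lambda>y. f (of_real (norm y))) has_derivative
      (\<lambda>h. deriv f (of_real (norm x)) * of_real ((x \<bullet> h) / norm x))) (at x)"
  proof -
    have 1: "((\<lambda>y. complex_of_real (norm y)) has_derivative (\<lambda>h. of_real ((x \<bullet> h) / norm x))) (at x)"
      by (rule has_derivative_of_real) (rule of_real_norm_has_derivative, use Y_norm[OF x] in simp)
    have "(f has_derivative (*) (deriv f (of_real (norm x)))) (at (of_real (norm x)))"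
      using holomorphic_derivI[OF f U] Y_norm[OF x] by (simp add: has_field_derivative_def)
    from has_derivative_compose[OF 1 this] show ?thesis .
  qed
  ultimately show ?thesis by (simp add: partial_eq inner_axis)
qed

text \<open>A factor supported in \<open>Y\<close> cannot see the difference between
  \<open>f (norm x)\<close> and the globally smooth \<open>ext f\<close>.\<close>

lemma csupp_radial_mult:
  assumes f: "f holomorphic_on U" and c: "csupp Y k \<phi>"
  shows "csupp Y k (\<lambda>x. f (of_real (norm x)) * \<phi> x)"
proof -
  have "(\<lambda>x. f (of_real (norm x)) * \<phi> x) = (\<lambda>x. ext f x * \<phi> x)"
    using ext_Y[OF f] csupp_outside[OF c] by force
  then show ?thesis using csupp_mult[OF c ext(1)[OF f]] by simp
qed

lemma csupp_radial_deriv: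
  assumes c: "csupp Y (Suc k) \<phi>"
  shows "csupp Y k (radial_deriv \<phi>)"
proof -
  have "radial_deriv \<phi> = (\<lambda>x. \<Sum>i\<in>UNIV. inverse (of_real (norm x)) * (of_real (x $ i) * partial i \<phi> x))"
    using c by (intro HOL.ext) (simp add: csupp_def radial_deriv_eq divide_inverse mult_ac)
  moreover have "csupp Y k (\<lambda>x. inverse (of_real (norm x)) * (of_real (x $ i) * partial i \<phi> x))" for i
    by (rule csupp_radial_mult[where f = inverse]; intro csupp_mult csupp_partial c C_k_coord holomorphic_intros U_nonzero)
  ultimately show ?thesis by (simp add: csupp_sum)
qed

text \<open>The weight \<open>1 / |x|\<^sup>2\<close> turns Lebesgue measure on \<open>\<real>\<^sup>3\<close> into \<open>dr d\<omega>\<close>.\<close>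

definition ud :: "(complex \<Rightarrow> complex) \<Rightarrow> distribution" where
  "ud f \<psi> = (LINT x|lborel. f (of_real (norm x)) * \<psi> x / of_real ((norm x)\<^sup>2))"

lemma ud_integrable:
  assumes "f holomorphic_on U" "csupp Y k \<phi>"
  shows "integrable lborel (\<lambda>x. f (of_real (norm x)) * \<phi> x / of_real ((norm x)\<^sup>2))"
proof -
  have "(\<lambda>z. f z / z\<^sup>2) holomorphic_on U"
    by (intro holomorphic_on_divide assms holomorphic_on_power holomorphic_on_ident) (simp add: U_nonzero)
  from csupp_integrable[OF csupp_radial_mult[OF this assms(2)]] show ?thesis
    by (simp only: times_divide_eq_left of_real_power)
qed

lemma ud_mult: "ud f (\<lambda>x. g (of_real (norm x)) * \<psi> x) = ud (\<lambda>z. f z * g z) \<psi>"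
  by (simp add: ud_def mult.assoc)

lemma ud_add:
  assumes "f holomorphic_on U" "g holomorphic_on U" "csupp Y k \<phi>"
  shows "ud f \<phi> + ud g \<phi> = ud (\<lambda>z. f z + g z) \<phi>"
  using Bochner_Integration.integral_add[OF ud_integrable[OF assms(1,3)] ud_integrable[OF assms(2,3)]]
  by (simp only: ud_def add_divide_distrib distrib_right)

lemma ud_uminus: "ud (\<lambda>z. - f z) \<phi> = - ud f \<phi>"
  by (simp add: ud_def)

lemma ud_cong:
  assumes "csupp Y k \<phi>" "\<And>z. z \<in> U \<Longrightarrow> f z = g z"
  shows "ud f \<phi> = ud g \<phi>"
  unfolding ud_def
proof (rule Bochner_Integration.integral_cong)
  fix x
  show "f (of_real (norm x)) * \<phi> x / of_real ((norm x)\<^sup>2) = g (of_real (norm x)) * \<phi> x / of_real ((norm x)\<^sup>2)"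
    using assms(2) Y_norm[of x] csupp_outside[OF assms(1), of x] by (cases "x \<in> Y") auto
qed simp

lemma partial_mult3:
  assumes "f differentiable (at x)" "g differentiable (at x)"
  shows "partial i (\<lambda>x. f x * of_real (x $ j) * g x) x =
    f x * of_real (x $ j) * partial i g x + (partial i f x * of_real (x $ j) + (if i = j then f x else 0)) * g x"
proof -
  have c: "(\<lambda>x. complex_of_real (x $ j)) differentiable (at x)"
    using C_k_coord[of "Suc 0" j] by (simp only: C_k.simps)
  show ?thesis
    by (subst partial_mult, (intro differentiable_mult assms c)+, subst partial_mult, (intro assms c)+)
      (simp add: partial_coord)
qed

text \<open>There is no zeroth-order term because \<open>x / |x|\<^sup>3\<close> is divergence free away from the origin.\<close>

lemma ud_ibp:
  assumes f: "f holomorphic_on U" and c: "csupp Y (Suc 0) \<phi>"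
  shows "ud f (radial_deriv \<phi>) = - ud (deriv f) \<phi>"
proof -
  \<comment> \<open>The field whose divergence is integrated is
    \<open>\<phi> * f |x| * x / |x|^3\<close>. With \<open>g\<close> as radial factor, the
    divergence of \<open>g |x| * x\<close> is \<open>z * g' + 3 * g\<close>, the 3 being the
    dimension, and this equals \<open>f' / z^2\<close>.\<close>
  define g where "g z = f z / z ^ 3" for z
  have g: "g holomorphic_on U" unfolding g_def[abs_def] using f U_nonzero by (auto intro!: holomorphic_intros)
  have dg: "deriv g z * z + 3 * g z = deriv f z / z\<^sup>2" if "z \<in> U" for z
  proof -
    have "(g has_field_derivative (deriv f z * z ^ 3 - f z * (3 * z ^ 2)) / (z ^ 3 * z ^ 3)) (at z)"
      unfolding g_def[abs_def] using U_nonzero[OF that]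
      by (auto intro!: derivative_eq_intros holomorphic_derivI[OF f U that])
    then show ?thesis using U_nonzero[OF that]
      by (simp add: DERIV_imp_deriv g_def field_simps power2_eq_square power3_eq_cube)
  qed
  have dif: "ext g differentiable (at x)" "\<phi> differentiable (at x)" for x
    using ext(1)[OF g, of "Suc 0"] c by (simp_all add: csupp_def)
  have cs: "csupp Y (Suc 0) (\<lambda>x. ext g x * of_real (x $ i) * \<phi> x)" for i
    by (intro csupp_mult c C_k_intros ext g)
  have eq: "f (of_real (norm x)) * radial_deriv \<phi> x / of_real ((norm x)\<^sup>2) =
      (\<Sum>i\<in>UNIV. partial i (\<lambda>x. ext g x * of_real (x $ i) * \<phi> x) x) - deriv f (of_real (norm x)) * \<phi> x / of_real ((norm x)\<^sup>2)" for x
  proof (cases "x \<in> Y")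
    case True
    let ?r = "complex_of_real (norm x)"
    have r: "?r \<noteq> 0" "?r \<in> U" using Y_norm[OF True] by auto
    have "(\<Sum>i\<in>UNIV. partial i (\<lambda>x. ext g x * of_real (x $ i) * \<phi> x) x) =
        (\<Sum>i\<in>UNIV. g ?r * (of_real (x $ i) * partial i \<phi> x) + (deriv g ?r / ?r * (of_real (x $ i) * of_real (x $ i)) + g ?r) * \<phi> x)"
      unfolding partial_mult3[OF dif] partial_ext[OF g True] ext_Y[OF g True]
      by (intro sum.cong refl) (simp add: algebra_simps)
    also have "\<dots> = g ?r * (\<Sum>i\<in>UNIV. of_real (x $ i) * partial i \<phi> x) + (deriv g ?r / ?r * ?r\<^sup>2 + 3 * g ?r) * \<phi> x"
      unfolding sum.distrib sum_distrib_left[symmetric] sum_distrib_right[symmetric] sum_coord_sq by simp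
    also have "deriv g ?r / ?r * ?r\<^sup>2 + 3 * g ?r = deriv f ?r / ?r\<^sup>2"
      using dg[OF r(2)] r(1) by (simp add: power2_eq_square)
    also have "g ?r * (\<Sum>i\<in>UNIV. of_real (x $ i) * partial i \<phi> x) = f ?r * radial_deriv \<phi> x / of_real ((norm x)\<^sup>2)"
      using r(1) unfolding radial_deriv_eq[OF dif(2)]
      by (simp add: g_def sum_distrib_left sum_divide_distrib divide_simps power2_eq_square power3_eq_cube mult.assoc)
    finally show ?thesis by simp
  next
    case False
    then have z: "x \<notin> closure {x. \<phi> x \<noteq> 0}" using c by (auto simp: csupp_def)
    have "x \<notin> closure {x. ext g x * of_real (x $ i) * \<phi> x \<noteq> 0}" for i
      using cs[of i] False by (auto simp: csupp_def)
    then show ?thesis using z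
      by (simp add: radial_deriv_eq[OF dif(2)] partial_zero_off_support csupp_outside[OF c False])
  qed
  have i1: "integrable lborel (\<lambda>x. \<Sum>i\<in>UNIV. partial i (\<lambda>x. ext g x * of_real (x $ i) * \<phi> x) x)"
    by (intro Bochner_Integration.integrable_sum csupp_integrable[of Y 0] csupp_partial cs)
  have i2: "integrable lborel (\<lambda>x. deriv f (of_real (norm x)) * \<phi> x / of_real ((norm x)\<^sup>2))"
    by (rule ud_integrable[OF holomorphic_deriv[OF f U] c])
  have 1: "ud f (radial_deriv \<phi>) = (LINT x|lborel. (\<Sum>i\<in>UNIV. partial i (\<lambda>x. ext g x * of_real (x $ i) * \<phi> x) x)) - ud (deriv f) \<phi>"
    unfolding ud_def eq by (rule Bochner_Integration.integral_diff[OF i1 i2])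
  have "integrable lborel (\<lambda>x. partial i (\<lambda>x. ext g x * of_real (x $ i) * \<phi> x) x)" for i
    by (rule csupp_integrable[OF csupp_partial[OF cs]])
  then have 2: "(LINT x|lborel. (\<Sum>i\<in>UNIV. partial i (\<lambda>x. ext g x * of_real (x $ i) * \<phi> x) x)) = 0"
    by (simp add: Bochner_Integration.integral_sum csupp_integral_partial[OF cs])
  show ?thesis unfolding 1 2 by simp
qed

end

section \<open>The spherical Laplacian in Cartesian coordinates\<close>

lemma has_derivative_sphere_ext:
  fixes \<psi> :: "real^3 \<Rightarrow> complex"
  assumes "\<psi> differentiable (at (\<rho> *\<^sub>R sgn y))" "y \<noteq> 0"
  shows "((\<lambda>y. \<psi> (\<rho> *\<^sub>R sgn y)) has_derivative
    (\<lambda>h. frechet_derivative \<psi> (at (\<rho> *\<^sub>R sgn y)) (\<rho> *\<^sub>R ((1 / norm y) *\<^sub>R h - ((y \<bullet> h) / norm y ^ 3) *\<^sub>R y)))) (at y)"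
proof -
  have "((\<lambda>y. inverse (norm y)) has_derivative (\<lambda>h. - (inverse (norm y) * ((y \<bullet> h) / norm y) * inverse (norm y)))) (at y)"
    by (rule Deriv.has_derivative_inverse[OF _ of_real_norm_has_derivative]) (use assms in auto)
  from has_derivative_scaleR[OF this has_derivative_ident]
  have "((\<lambda>y. \<rho> *\<^sub>R (inverse (norm y) *\<^sub>R y)) has_derivative (\<lambda>h. \<rho> *\<^sub>R (inverse (norm y) *\<^sub>R h
      + (- (inverse (norm y) * ((y \<bullet> h) / norm y) * inverse (norm y))) *\<^sub>R y))) (at y)"
    by (rule has_derivative_scaleR_right)
  moreover have "inverse (norm y) *\<^sub>R h + (- (inverse (norm y) * ((y \<bullet> h) / norm y) * inverse (norm y))) *\<^sub>R y
      = (1 / norm y) *\<^sub>R h - ((y \<bullet> h) / norm y ^ 3) *\<^sub>R y" for h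
    by (simp add: divide_inverse power3_eq_cube mult_ac)
  ultimately have "((\<lambda>y. \<rho> *\<^sub>R sgn y) has_derivative (\<lambda>h. \<rho> *\<^sub>R ((1 / norm y) *\<^sub>R h - ((y \<bullet> h) / norm y ^ 3) *\<^sub>R y))) (at y)"
    by (simp add: sgn_div_norm)
  then show ?thesis
    by (rule has_derivative_compose) (use assms(1) in \<open>simp add: frechet_derivative_works\<close>)
qed

lemma axis_one_nth: "axis i (1::real) $ k = (if i = k then 1 else 0)"
  by (simp add: axis_def)

text \<open>The entries of the Jacobian matrix of the projection
  \<open>y \<mapsto> \<rho> *\<^sub>R sgn y\<close>. At a unit vector this matrix is
  \<open>\<rho>\<close> times the orthogonal projection onto the tangent plane.\<close>

definition sphere_coeff :: "real \<Rightarrow> 3 \<Rightarrow> 3 \<Rightarrow> real^3 \<Rightarrow> real" where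
  "sphere_coeff \<rho> i k y = \<rho> * ((if i = k then 1 / norm y else 0) - y $ i * y $ k / norm y ^ 3)"

lemma partial_sphere_ext:
  assumes "\<psi> differentiable (at (\<rho> *\<^sub>R sgn y))" "y \<noteq> 0"
  shows "partial i (\<lambda>y. \<psi> (\<rho> *\<^sub>R sgn y)) y = (\<Sum>k\<in>UNIV. of_real (sphere_coeff \<rho> i k y) * partial k \<psi> (\<rho> *\<^sub>R sgn y))"
  unfolding partial_eq[OF has_derivative_sphere_ext[OF assms]] frechet_derivative_expand[OF assms(1)]
  by (intro sum.cong refl) (simp add: sphere_coeff_def inner_axis axis_one_nth mult.commute)

lemma sphere_coeff_unit: "norm y = 1 \<Longrightarrow> sphere_coeff \<rho> i k y = \<rho> * ((if i = k then 1 else 0) - y $ i * y $ k)"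
  by (simp add: sphere_coeff_def)

lemma sphere_coeff_has_derivative:
  assumes y: "norm y = 1"
  shows "((\<lambda>y. complex_of_real (sphere_coeff \<rho> i k y)) has_derivative
    (\<lambda>h. of_real (\<rho> * ((if i = k then - (y \<bullet> h) else 0) - (h $ i * y $ k + y $ i * h $ k - 3 * (y \<bullet> h) * (y $ i * y $ k)))))) (at y)"
proof -
  have y0: "y \<noteq> 0" using y by auto
  have c: "((\<lambda>y. y $ j) has_derivative (\<lambda>h. h $ j)) (at y)" for j
    by (intro bounded_linear_imp_has_derivative bounded_linear_vec_nth)
  have n: "(norm has_derivative (\<lambda>h. y \<bullet> h)) (at y)"
    using of_real_norm_has_derivative[OF y0] y by simp
  have inv: "((\<lambda>y. inverse (norm y)) has_derivative (\<lambda>h. - (y \<bullet> h))) (at y)"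
    using Deriv.has_derivative_inverse[OF _ n] y by simp
  have "((\<lambda>y. \<rho> * ((if i = k then 1 else 0) * inverse (norm y) - y $ i * y $ k * (inverse (norm y) ^ 3))) has_derivative
    (\<lambda>h. \<rho> * ((if i = k then - (y \<bullet> h) else 0) - (h $ i * y $ k + y $ i * h $ k - 3 * (y \<bullet> h) * (y $ i * y $ k))))) (at y)"
    by (rule derivative_eq_intros c inv refl)+ (auto simp: y algebra_simps)
  moreover have "sphere_coeff \<rho> i k = (\<lambda>y. \<rho> * ((if i = k then 1 else 0) * inverse (norm y) - y $ i * y $ k * (inverse (norm y) ^ 3)))"
    by (intro HOL.ext) (simp add: sphere_coeff_def divide_inverse power_inverse)
  ultimately show ?thesis by (intro has_derivative_of_real) simp
qed

lemma partial_sum: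
  assumes "\<And>i. i \<in> I \<Longrightarrow> f i differentiable (at x)" "finite I"
  shows "partial j (\<lambda>x. \<Sum>i\<in>I. f i x) x = (\<Sum>i\<in>I. partial j (f i) x)"
proof -
  have "((\<lambda>x. \<Sum>i\<in>I. f i x) has_derivative (\<lambda>h. \<Sum>i\<in>I. frechet_derivative (f i) (at x) h)) (at x)"
    by (rule has_derivative_sum) (use assms in \<open>auto simp: frechet_derivative_works\<close>)
  then show ?thesis by (simp add: partial_eq) (simp add: partial_def)
qed

lemma sum_swap3: "(\<Sum>i\<in>A. \<Sum>k\<in>B. \<Sum>l\<in>C. F i k l) = (\<Sum>k\<in>B. \<Sum>l\<in>C. \<Sum>i\<in>A. F i k l)"
proof -
  have "(\<Sum>i\<in>A. \<Sum>k\<in>B. \<Sum>l\<in>C. F i k l) = (\<Sum>k\<in>B. \<Sum>i\<in>A. \<Sum>l\<in>C. F i k l)" by (rule sum.swap)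
  also have "\<dots> = (\<Sum>k\<in>B. \<Sum>l\<in>C. \<Sum>i\<in>A. F i k l)" by (intro sum.cong refl) (rule sum.swap)
  finally show ?thesis .
qed

text \<open>This is \<open>r^2\<close> times the Euclidean Laplacian with its radial part removed,
  in coordinates. The chain rule is applied twice through \<open>sphere_coeff\<close>: products of
  Jacobian entries give the second-order terms, derivatives of the entries the first-order
  one.\<close>

lemma sphere_laplacian_fun_eq:
  assumes \<psi>: "C_k (Suc (Suc 0)) \<psi>" and x: "x \<noteq> 0"
  shows "sphere_laplacian_fun \<psi> x =
    (\<Sum>l\<in>UNIV. (of_real (norm x))\<^sup>2 * partial l (partial l \<psi>) x
      - of_real (x $ l) * (\<Sum>k\<in>UNIV. of_real (x $ k) * partial l (partial k \<psi>) x)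
      - 2 * (of_real (x $ l) * partial l \<psi> x))"
proof -
  define e where "e = sgn x"
  define r where "r = norm x"
  have e1: "norm e = 1" using x by (simp add: e_def norm_sgn)
  then have e: "norm e = 1" "e \<noteq> 0" by auto
  have xe: "r *\<^sub>R e = x" "sgn e = e" using x by (auto simp: e_def r_def sgn_div_norm)
  have xc: "x $ j = r * e $ j" for j using x by (simp add: e_def r_def sgn_div_norm)
  have d1: "\<psi> differentiable (at z)" for z using \<psi> by simp
  have d2: "partial k \<psi> differentiable (at z)" for k z using \<psi> by simp
  have sq: "(\<Sum>i\<in>UNIV. e $ i * e $ i) = 1"
    using e(1) by (simp add: norm_eq_1 inner_vec_def)
  define P where "P l k = partial l (partial k \<psi>) x" for l k
  have 1: "partial i (partial i (\<lambda>y. \<psi> (r *\<^sub>R sgn y))) e =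
      (\<Sum>k\<in>UNIV. of_real (sphere_coeff r i k e) * (\<Sum>l\<in>UNIV. of_real (sphere_coeff r i l e) * P l k)
        + of_real (r * ((if i = k then - (e $ i) else 0) - (e $ k + (if i = k then e $ i else 0) - 3 * e $ i * (e $ i * e $ k)))) * partial k \<psi> x)" for i
  proof -
    have "partial i (partial i (\<lambda>y. \<psi> (r *\<^sub>R sgn y))) e =
        partial i (\<lambda>y. \<Sum>k\<in>UNIV. of_real (sphere_coeff r i k y) * partial k \<psi> (r *\<^sub>R sgn y)) e"
      by (rule partial_cong_open[of "- {0}"]) (use e partial_sphere_ext[OF d1] in auto)
    also have "\<dots> = (\<Sum>k\<in>UNIV. of_real (sphere_coeff r i k e) * partial i (\<lambda>y. partial k \<psi> (r *\<^sub>R sgn y)) e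
        + partial i (\<lambda>y. of_real (sphere_coeff r i k y)) e * partial k \<psi> (r *\<^sub>R sgn e))"
    proof -
      have 1: "(\<lambda>y. complex_of_real (sphere_coeff r i k y)) differentiable (at e)" for k
        using sphere_coeff_has_derivative[OF e(1)] unfolding differentiable_def by blast
      have 2: "(\<lambda>y. partial k \<psi> (r *\<^sub>R sgn y)) differentiable (at e)" for k
        using has_derivative_sphere_ext[OF d2 e(2)] unfolding differentiable_def by blast
      show ?thesis
        by (subst partial_sum) (simp_all add: partial_mult[OF 1 2] differentiable_mult[OF 1 2])
    qed
    finally show ?thesis
      by (simp only: partial_sphere_ext[OF d2 e(2)] partial_eq[OF sphere_coeff_has_derivative[OF e(1)]] xe P_def)
        (simp add: inner_axis axis_one_nth if_distrib cong: if_cong)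
  qed
  have sq': "(\<Sum>i\<in>UNIV. (e $ i * e $ i) * c) = c" for c
    by (simp only: sum_distrib_right[symmetric] sq mult_1)
  \<comment> \<open>An orthogonal projection is symmetric and idempotent, so the sum reproduces the
    projection with the factor \<open>r * r\<close>.\<close>
  have projr: "(\<Sum>i\<in>UNIV. sphere_coeff r i k e * sphere_coeff r i l e) = r * r * ((if l = k then 1 else 0) - e $ l * e $ k)" for k l
  proof -
    have "(\<Sum>i\<in>UNIV. sphere_coeff r i k e * sphere_coeff r i l e) =
        (\<Sum>i\<in>UNIV. (if i = k then if k = l then r * r else 0 else 0) - (if i = k then r * r * (e $ k * e $ l) else 0)
          - (if i = l then r * r * (e $ k * e $ l) else 0) + (e $ i * e $ i) * (r * r * (e $ k * e $ l)))"
      by (intro sum.cong refl) (auto simp: sphere_coeff_unit[OF e1] algebra_simps)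
    also have "\<dots> = r * r * ((if l = k then 1 else 0) - e $ l * e $ k)"
      unfolding sum.distrib sum_subtractf sq' by (auto simp: algebra_simps)
    finally show ?thesis .
  qed
  have proj: "(\<Sum>i\<in>UNIV. complex_of_real (sphere_coeff r i k e) * of_real (sphere_coeff r i l e)) =
      of_real (r * r) * ((if l = k then 1 else 0) - of_real (e $ l * e $ k))" for k l
  proof -
    have "complex_of_real (\<Sum>i\<in>UNIV. sphere_coeff r i k e * sphere_coeff r i l e) = of_real (r * r * ((if l = k then 1 else 0) - e $ l * e $ k))"
      by (simp only: projr)
    then show ?thesis by (simp split: if_splits)
  qed
  \<comment> \<open>Up to the factor \<open>r\<close> this says that the coordinate functions are
    eigenfunctions of the Laplacian of the unit sphere with eigenvalue -2.\<close>
  have linr: "(\<Sum>i\<in>UNIV. r * ((if i = k then - (e $ i) else 0) - (e $ k + (if i = k then e $ i else 0) - 3 * e $ i * (e $ i * e $ k)))) = - 2 * r * e $ k" for k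
  proof -
    have "(\<Sum>i\<in>UNIV. r * ((if i = k then - (e $ i) else 0) - (e $ k + (if i = k then e $ i else 0) - 3 * e $ i * (e $ i * e $ k)))) =
      (\<Sum>i\<in>UNIV. (if i = k then - (2 * r * e $ k) else 0) - r * e $ k + (e $ i * e $ i) * (3 * r * e $ k))"
      by (intro sum.cong refl) (auto simp: algebra_simps)
    also have "\<dots> = - 2 * r * e $ k"
      unfolding sum.distrib sum_subtractf sq' by (simp add: algebra_simps)
    finally show ?thesis .
  qed
  have lin: "(\<Sum>i\<in>UNIV. complex_of_real (r * ((if i = k then - (e $ i) else 0) - (e $ k + (if i = k then e $ i else 0) - 3 * e $ i * (e $ i * e $ k)))))
      = of_real (- 2 * r * e $ k)" for k
    by (simp only: of_real_sum[symmetric] linr)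
  have "sphere_laplacian_fun \<psi> x = (\<Sum>i\<in>UNIV. partial i (partial i (\<lambda>y. \<psi> (r *\<^sub>R sgn y))) e)"
    by (simp add: sphere_laplacian_fun_def laplacian_def e_def r_def)
  then have a1: "sphere_laplacian_fun \<psi> x = (\<Sum>i\<in>UNIV. \<Sum>k\<in>UNIV. \<Sum>l\<in>UNIV. (of_real (sphere_coeff r i k e) * of_real (sphere_coeff r i l e)) * P l k)
      + (\<Sum>i\<in>UNIV. \<Sum>k\<in>UNIV. of_real (r * ((if i = k then - (e $ i) else 0) - (e $ k + (if i = k then e $ i else 0) - 3 * e $ i * (e $ i * e $ k)))) * partial k \<psi> x)"
    by (simp only: 1 sum.distrib sum_distrib_left mult.assoc)
  have a2: "(\<Sum>i\<in>UNIV. \<Sum>k\<in>UNIV. \<Sum>l\<in>UNIV. (of_real (sphere_coeff r i k e) * of_real (sphere_coeff r i l e)) * P l k)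
      = (\<Sum>k\<in>UNIV. \<Sum>l\<in>UNIV. (\<Sum>i\<in>UNIV. of_real (sphere_coeff r i k e) * of_real (sphere_coeff r i l e)) * P l k)"
    unfolding sum_distrib_right by (rule sum_swap3)
  have a3: "(\<Sum>i\<in>UNIV. \<Sum>k\<in>UNIV. of_real (r * ((if i = k then - (e $ i) else 0) - (e $ k + (if i = k then e $ i else 0) - 3 * e $ i * (e $ i * e $ k)))) * partial k \<psi> x)
      = (\<Sum>k\<in>UNIV. of_real (- 2 * r * e $ k) * partial k \<psi> x)"
    by (subst sum.swap) (simp only: sum_distrib_right[symmetric] lin)
  have a4: "(\<Sum>k\<in>UNIV. \<Sum>l\<in>UNIV. (\<Sum>i\<in>UNIV. of_real (sphere_coeff r i k e) * of_real (sphere_coeff r i l e)) * P l k)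
      = (\<Sum>k\<in>UNIV. \<Sum>l\<in>UNIV. (if l = k then of_real (r * r) * P l k else 0) - of_real (x $ l) * (of_real (x $ k) * P l k))"
    unfolding proj by (intro sum.cong refl) (auto simp: xc algebra_simps)
  have a5: "(\<Sum>k\<in>UNIV. \<Sum>l\<in>UNIV. (if l = k then of_real (r * r) * P l k else 0) - of_real (x $ l) * (of_real (x $ k) * P l k)) = (\<Sum>k\<in>UNIV. of_real (r * r) * P k k) - (\<Sum>l\<in>UNIV. \<Sum>k\<in>UNIV. of_real (x $ l) * (of_real (x $ k) * P l k))"
    unfolding sum_subtractf by (subst (2) sum.swap) simp
  have a6: "(\<Sum>k\<in>UNIV. of_real (- 2 * r * e $ k) * partial k \<psi> x) = - (\<Sum>l\<in>UNIV. 2 * (of_real (x $ l) * partial l \<psi> x))"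
    unfolding sum_negf[symmetric] by (intro sum.cong refl) (simp add: xc)
  show ?thesis
    unfolding a1 a2 a3 a4 a5 a6 unfolding P_def r_def[symmetric]
    by (simp add: sum_subtractf sum_distrib_left power2_eq_square)
qed

context radial_shell
begin

text \<open>A radial multiple of \<open>sphere_laplacian_fun \<psi>\<close> is a divergence.\<close>

lemma ud_sphere_laplacian:
  assumes f: "f holomorphic_on U" and c: "csupp Y (Suc (Suc 0)) \<psi>"
  shows "ud f (sphere_laplacian_fun \<psi>) = 0"
proof -
  define g where "g z = f z / z\<^sup>2" for z
  have g: "g holomorphic_on U" unfolding g_def[abs_def] using f U_nonzero by (auto intro!: holomorphic_intros)
  have fg: "f z = g z * z\<^sup>2" if "z \<in> U" for z using U_nonzero[OF that] by (simp add: g_def)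
  have df: "deriv f z = deriv g z * z\<^sup>2 + 2 * g z * z" if "z \<in> U" for z
  proof -
    have "((\<lambda>z. g z * z\<^sup>2) has_field_derivative deriv g z * z\<^sup>2 + 2 * g z * z) (at z)"
      by (auto intro!: derivative_eq_intros holomorphic_derivI[OF g U that])
    then have "(f has_field_derivative deriv g z * z\<^sup>2 + 2 * g z * z) (at z)"
      by (rule has_field_derivative_transform_within_open[OF _ U that]) (simp add: fg)
    then show ?thesis by (rule DERIV_imp_deriv)
  qed
  define S where "S x = (\<Sum>k\<in>UNIV. of_real (x $ k) * partial k \<psi> x)" for x
  have cp: "csupp Y (Suc 0) (partial k \<psi>)" for k by (rule csupp_partial[OF c])
  have cS: "csupp Y (Suc 0) S" unfolding S_def[abs_def] by (intro csupp_sum csupp_mult cp C_k_coord finite)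
  have dif: "ext f differentiable (at x)" "ext g differentiable (at x)" "partial k \<psi> differentiable (at x)" "S differentiable (at x)" for k x
    using ext(1)[OF f, of "Suc 0"] ext(1)[OF g, of "Suc 0"] cp[of k] cS by (simp_all add: csupp_def)
  \<comment> \<open>\<open>F\<close> is \<open>f\<close> times the gradient of \<open>\<psi>\<close>
    and \<open>H\<close> is \<open>f\<close> times its radial part, so \<open>F - H\<close> is
    \<open>f\<close> times the tangential gradient.\<close>
  define F where "F l x = ext f x * partial l \<psi> x" for l x
  define H where "H l x = ext g x * of_real (x $ l) * S x" for l x
  have cF: "csupp Y (Suc 0) (F l)" and cH: "csupp Y (Suc 0) (H l)" for l
    unfolding F_def[abs_def] H_def[abs_def] by (intro csupp_mult cp cS C_k_intros ext f g)+
  have pS: "partial l S x = partial l \<psi> x + (\<Sum>k\<in>UNIV. of_real (x $ k) * partial l (partial k \<psi>) x)" for l x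
  proof -
    have co: "(\<lambda>x. complex_of_real (x $ k)) differentiable (at x)" for k
      using C_k_coord[of "Suc 0" k] by (simp only: C_k.simps)
    have "partial l S x = (\<Sum>k\<in>UNIV. partial l (\<lambda>x. of_real (x $ k) * partial k \<psi> x) x)"
      unfolding S_def[abs_def] by (rule partial_sum) (auto intro!: differentiable_mult co dif)
    also have "\<dots> = (\<Sum>k\<in>UNIV. of_real (x $ k) * partial l (partial k \<psi>) x + (if l = k then partial k \<psi> x else 0))"
      by (intro sum.cong refl) (simp add: partial_mult[OF co dif(3)] partial_coord)
    finally show ?thesis by (simp add: sum.distrib)
  qed
  have eq: "f (of_real (norm x)) * sphere_laplacian_fun \<psi> x / of_real ((norm x)\<^sup>2) = (\<Sum>l\<in>UNIV. partial l (F l) x) - (\<Sum>l\<in>UNIV. partial l (H l) x)" for x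
  proof (cases "x \<in> Y")
    case True
    let ?r = "complex_of_real (norm x)"
    have r: "?r \<noteq> 0" "?r \<in> U" and x: "x \<noteq> 0" using Y_norm[OF True] by auto
    have "(\<Sum>l\<in>UNIV. partial l (F l) x) = (\<Sum>l\<in>UNIV. f ?r * partial l (partial l \<psi>) x + deriv f ?r / ?r * (of_real (x $ l) * partial l \<psi> x))"
      unfolding F_def[abs_def] partial_mult[OF dif(1) dif(3)] partial_ext[OF f True] ext_Y[OF f True] by (simp add: mult_ac)
    also have "\<dots> = (\<Sum>l\<in>UNIV. f ?r * partial l (partial l \<psi>) x) + deriv f ?r / ?r * S x"
      by (simp add: sum.distrib S_def sum_distrib_left)
    finally have 1: "(\<Sum>l\<in>UNIV. partial l (F l) x) = (\<Sum>l\<in>UNIV. f ?r * partial l (partial l \<psi>) x) + deriv f ?r / ?r * S x" .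
    have "(\<Sum>l\<in>UNIV. partial l (H l) x) = (\<Sum>l\<in>UNIV. g ?r * (of_real (x $ l) * partial l S x) + (deriv g ?r / ?r * (of_real (x $ l) * of_real (x $ l)) + g ?r) * S x)"
      unfolding H_def[abs_def] partial_mult3[OF dif(2) dif(4)] partial_ext[OF g True] ext_Y[OF g True]
      by (intro sum.cong refl) (simp add: algebra_simps)
    also have "\<dots> = g ?r * (\<Sum>l\<in>UNIV. of_real (x $ l) * partial l S x) + (deriv g ?r / ?r * ?r\<^sup>2 + 3 * g ?r) * S x"
      unfolding sum.distrib sum_distrib_left[symmetric] sum_distrib_right[symmetric] sum_coord_sq by simp
    also have "(\<Sum>l\<in>UNIV. of_real (x $ l) * partial l S x) = S x + (\<Sum>l\<in>UNIV. of_real (x $ l) * (\<Sum>k\<in>UNIV. of_real (x $ k) * partial l (partial k \<psi>) x))"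
      unfolding pS by (simp add: distrib_left sum.distrib S_def)
    finally have 2: "(\<Sum>l\<in>UNIV. partial l (H l) x) = g ?r * (S x + (\<Sum>l\<in>UNIV. of_real (x $ l) * (\<Sum>k\<in>UNIV. of_real (x $ k) * partial l (partial k \<psi>) x)))
        + (deriv g ?r / ?r * ?r\<^sup>2 + 3 * g ?r) * S x" .
    have C2: "C_k (Suc (Suc 0)) \<psi>" using c by (simp only: csupp_def)
    have "f ?r * sphere_laplacian_fun \<psi> x / of_real ((norm x)\<^sup>2) = g ?r * sphere_laplacian_fun \<psi> x"
      by (simp add: g_def)
    also have "\<dots> = (\<Sum>l\<in>UNIV. f ?r * partial l (partial l \<psi>) x)
        - g ?r * (\<Sum>l\<in>UNIV. of_real (x $ l) * (\<Sum>k\<in>UNIV. of_real (x $ k) * partial l (partial k \<psi>) x)) - 2 * g ?r * S x"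
      unfolding sphere_laplacian_fun_eq[OF C2 x] fg[OF r(2)]
      by (simp add: sum_subtractf right_diff_distrib sum_distrib_left S_def mult_ac)
    also have "\<dots> = (\<Sum>l\<in>UNIV. partial l (F l) x) - (\<Sum>l\<in>UNIV. partial l (H l) x)"
      unfolding 1 2 df[OF r(2)] using r(1) by (simp add: divide_simps) (simp add: algebra_simps power2_eq_square)
    finally show ?thesis .
  next
    case False
    have out: "x \<notin> closure {x. F l x \<noteq> 0}" "x \<notin> closure {x. H l x \<noteq> 0}" for l
      using cF[of l] cH[of l] False by (auto simp: csupp_def)
    have "sphere_laplacian_fun \<psi> x = 0"
    proof (cases "x = 0")
      \<comment> \<open>At the origin \<open>norm x = 0\<close>, so the function whose Laplacian is
        taken is the constant \<open>\<psi> 0\<close>.\<close>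
      case True
      have "partial i (\<lambda>y. \<psi> 0) = (\<lambda>_. 0)" for i
        by (rule HOL.ext) (simp add: partial_eq[OF has_derivative_const])
      then show ?thesis by (simp add: sphere_laplacian_fun_def laplacian_def True partial_eq[OF has_derivative_const])
    next
      case nz: False
      have "x \<notin> closure {x. partial k \<psi> x \<noteq> 0}" "x \<notin> closure {x. \<psi> x \<noteq> 0}" for k
        using cp[of k] c False by (auto simp: csupp_def)
      then show ?thesis
        using c by (subst sphere_laplacian_fun_eq[OF _ nz]) (auto simp: csupp_def partial_zero_off_support simp del: C_k.simps)
    qed
    then show ?thesis using out by (simp add: partial_zero_off_support)
  qed
  have iF: "integrable lborel (\<lambda>x. partial l (F l) x)" and iH: "integrable lborel (\<lambda>x. partial l (H l) x)" for l
    by (rule csupp_integrable[OF csupp_partial[OF cF]], rule csupp_integrable[OF csupp_partial[OF cH]])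
  have "ud f (sphere_laplacian_fun \<psi>) = (LINT x|lborel. (\<Sum>l\<in>UNIV. partial l (F l) x)) - (LINT x|lborel. (\<Sum>l\<in>UNIV. partial l (H l) x))"
    unfolding ud_def eq by (rule Bochner_Integration.integral_diff) (intro Bochner_Integration.integrable_sum iF iH)+
  also have "\<dots> = 0"
    by (simp add: Bochner_Integration.integral_sum iF iH csupp_integral_partial[OF cF] csupp_integral_partial[OF cH])
  finally show ?thesis .
qed

end

section \<open>Fourier inversion\<close>

text \<open>Lebesgue measure is the image of the product measure over the basis coordinates, and
  there integrals of products factorise.\<close>

lemma integrable_prod_Basis:
  fixes f :: "'a::euclidean_space \<Rightarrow> real \<Rightarrow> complex"
  assumes "\<And>b. b \<in> Basis \<Longrightarrow> integrable lborel (f b)"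
  shows "integrable lborel (\<lambda>x::'a. \<Prod>b\<in>Basis. f b (x \<bullet> b))"
    and "(LINT x|lborel. (\<Prod>b\<in>Basis. f b (x \<bullet> b))) = (\<Prod>b\<in>Basis. (LINT t|lborel. f b t))"
proof -
  interpret product_sigma_finite "\<lambda>b::'a. lborel :: real measure" ..
  have m: "(\<lambda>g. \<Sum>b\<in>Basis. g b *\<^sub>R b) \<in> measurable (\<Pi>\<^sub>M b\<in>Basis. lborel) (borel :: 'a measure)" by measurable
  have fm: "f b \<in> borel_measurable borel" if "b \<in> Basis" for b
    using borel_measurable_integrable[OF assms[OF that]] by simp
  have pm: "(\<lambda>x::'a. \<Prod>b\<in>Basis. f b (x \<bullet> b)) \<in> borel_measurable borel"
    by (intro borel_measurable_prod measurable_compose[OF _ fm]) auto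
  have eq: "(\<Prod>b\<in>Basis. f b ((\<Sum>c\<in>Basis. g c *\<^sub>R c) \<bullet> b)) = (\<Prod>b\<in>Basis. f b (g b))" for g :: "'a \<Rightarrow> real"
    by (intro prod.cong refl) (simp add: inner_sum_left inner_Basis if_distrib sum.delta cong: if_cong)
  have i: "integrable (\<Pi>\<^sub>M b\<in>Basis. lborel) (\<lambda>g. \<Prod>b\<in>Basis. f b (g b))"
    by (rule product_integrable_prod) (auto intro: assms)
  show "integrable lborel (\<lambda>x::'a. \<Prod>b\<in>Basis. f b (x \<bullet> b))"
    unfolding lborel_eq[where 'a='a] using i by (subst integrable_distr_eq[OF m pm]) (simp only: eq)
  have "(LINT x|lborel. (\<Prod>b\<in>Basis. f b (x \<bullet> b))) = (LINT g|(\<Pi>\<^sub>M b\<in>Basis. lborel). (\<Prod>b\<in>Basis. f b (g b)))"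
    unfolding lborel_eq[where 'a='a] by (subst integral_distr[OF m pm]) (simp only: eq)
  also have "\<dots> = (\<Prod>b\<in>Basis. (LINT t|lborel. f b t))"
    by (rule product_integral_prod) (auto intro: assms)
  finally show "(LINT x|lborel. (\<Prod>b\<in>Basis. f b (x \<bullet> b))) = (\<Prod>b\<in>Basis. (LINT t|lborel. f b t))" .
qed

text \<open>The characteristic function of the standard normal law, rescaled by
  \<open>e\<close>.\<close>

lemma gauss_fourier_1:
  fixes t e :: real
  assumes e: "e > 0"
  shows "integrable lborel (\<lambda>x. iexp (t * x) * of_real (exp (- (e * x)\<^sup>2 / 2)))"
    and "(LINT x|lborel. iexp (t * x) * of_real (exp (- (e * x)\<^sup>2 / 2))) = of_real (sqrt (2 * pi) / e * exp (- (t / e)\<^sup>2 / 2))"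
proof -
  let ?g = "\<lambda>s x. iexp (s * x) * complex_of_real (exp (- x\<^sup>2 / 2))"
  have gd: "?g s = (\<lambda>x. of_real (sqrt (2 * pi)) * (std_normal_density x *\<^sub>R iexp (s * x)))" for s
    by (rule HOL.ext) (simp add: std_normal_density_def scaleR_conv_of_real)
  have int1: "integrable lborel (\<lambda>x. std_normal_density x *\<^sub>R iexp (s * x))" for s
  proof (rule Bochner_Integration.integrable_bound[of _ std_normal_density])
    show "integrable lborel std_normal_density" by simp
  qed auto
  have int2: "integrable lborel (?g s)" for s
    unfolding gd by (intro integrable_mult_right int1)
  have "(LINT x|lborel. std_normal_density x *\<^sub>R iexp (s * x)) = of_real (exp (- s\<^sup>2 / 2))" for s
  proof -
    have "char std_normal_distribution s = (LINT x|lborel. std_normal_density x *\<^sub>R iexp (s * x))"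
      unfolding char_def by (subst integral_density) auto
    then show ?thesis by (simp add: char_std_normal_distribution)
  qed
  then have val: "(LINT x|lborel. ?g s x) = of_real (sqrt (2 * pi)) * of_real (exp (- s\<^sup>2 / 2))" for s
    by (simp only: gd integral_mult_right_zero)
  have sc: "(\<lambda>x. iexp (t * x) * complex_of_real (exp (- (e * x)\<^sup>2 / 2))) = (\<lambda>x. ?g (t / e) (0 + e * x))"
    using e by (intro HOL.ext) simp
  show "integrable lborel (\<lambda>x. iexp (t * x) * of_real (exp (- (e * x)\<^sup>2 / 2)))"
    unfolding sc using e by (intro lborel_integrable_real_affine int2) simp
  have "(LINT x|lborel. ?g (t / e) x) = \<bar>e\<bar> *\<^sub>R (LINT x|lborel. ?g (t / e) (0 + e * x))"
    using e by (intro lborel_integral_real_affine) simp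
  then show "(LINT x|lborel. iexp (t * x) * of_real (exp (- (e * x)\<^sup>2 / 2))) = of_real (sqrt (2 * pi) / e * exp (- (t / e)\<^sup>2 / 2))"
    unfolding sc val using e by (simp add: scaleR_conv_of_real field_simps)
qed

lemma norm_sq_Basis: "(norm x)\<^sup>2 = (\<Sum>b\<in>Basis. (x \<bullet> b)\<^sup>2)" for x :: "'a::euclidean_space"
  unfolding power2_norm_eq_inner by (subst euclidean_inner) (simp add: power2_eq_square)

lemma gauss_fourier:
  fixes v :: "real^3"
  assumes e: "e > 0"
  shows "integrable lborel (\<lambda>x. iexp (x \<bullet> v) * of_real (exp (- (e * norm x)\<^sup>2 / 2)))"
    and "(LINT x|lborel. iexp (x \<bullet> v) * of_real (exp (- (e * norm x)\<^sup>2 / 2))) =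
      of_real ((sqrt (2 * pi) / e) ^ 3 * exp (- (norm v / e)\<^sup>2 / 2))"
proof -
  let ?f = "\<lambda>b t. iexp ((v \<bullet> b) * t) * complex_of_real (exp (- (e * t)\<^sup>2 / 2))"
  have eq: "iexp (x \<bullet> v) * of_real (exp (- (e * norm x)\<^sup>2 / 2)) = (\<Prod>b\<in>Basis. ?f b (x \<bullet> b))" for x
  proof -
    have "x \<bullet> v = (\<Sum>b\<in>Basis. (v \<bullet> b) * (x \<bullet> b))" by (subst euclidean_inner) (simp add: mult.commute)
    then have 1: "iexp (x \<bullet> v) = (\<Prod>b\<in>Basis. iexp ((v \<bullet> b) * (x \<bullet> b)))"
      by (simp add: exp_sum sum_distrib_left)
    have "- (e * norm x)\<^sup>2 / 2 = (\<Sum>b\<in>Basis. - (e * (x \<bullet> b))\<^sup>2 / 2)"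
      unfolding power_mult_distrib norm_sq_Basis by (simp add: sum_distrib_left sum_negf sum_divide_distrib)
    then have 2: "complex_of_real (exp (- (e * norm x)\<^sup>2 / 2)) = (\<Prod>b\<in>Basis. complex_of_real (exp (- (e * (x \<bullet> b))\<^sup>2 / 2)))"
      by (simp add: exp_sum)
    show ?thesis unfolding 1 2 prod.distrib ..
  qed
  show "integrable lborel (\<lambda>x. iexp (x \<bullet> v) * of_real (exp (- (e * norm x)\<^sup>2 / 2)))"
    unfolding eq by (rule integrable_prod_Basis(1)[OF gauss_fourier_1(1)[OF e]])
  have "(LINT x|lborel. iexp (x \<bullet> v) * of_real (exp (- (e * norm x)\<^sup>2 / 2))) =
      (\<Prod>b\<in>Basis. complex_of_real (sqrt (2 * pi) / e * exp (- ((v \<bullet> b) / e)\<^sup>2 / 2)))"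
    unfolding eq integrable_prod_Basis(2)[OF gauss_fourier_1(1)[OF e]] gauss_fourier_1(2)[OF e] ..
  also have "\<dots> = of_real (\<Prod>b\<in>(Basis::(real^3) set). sqrt (2 * pi) / e * exp (- ((v \<bullet> b) / e)\<^sup>2 / 2))" by simp
  also have "(\<Prod>b\<in>(Basis::(real^3) set). sqrt (2 * pi) / e * exp (- ((v \<bullet> b) / e)\<^sup>2 / 2)) =
      (sqrt (2 * pi) / e) ^ 3 * exp (\<Sum>b\<in>Basis. - ((v \<bullet> b) / e)\<^sup>2 / 2)"
    unfolding prod.distrib prod_constant by (simp add: exp_sum)
  also have "(\<Sum>b\<in>Basis. - ((v \<bullet> b) / e)\<^sup>2 / 2) = - (norm v / e)\<^sup>2 / 2"
    unfolding power_divide norm_sq_Basis by (simp add: sum_divide_distrib sum_negf)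
  finally show "(LINT x|lborel. iexp (x \<bullet> v) * of_real (exp (- (e * norm x)\<^sup>2 / 2))) =
      of_real ((sqrt (2 * pi) / e) ^ 3 * exp (- (norm v / e)\<^sup>2 / 2))" .
qed

text \<open>Every \<open>1 + (\<xi> \<bullet> b)^2\<close> is at most \<open>1 + |\<xi>|^2\<close>,
  so the weight is dominated by a product of integrable functions of one coordinate each; the
  exponent 3 is their number.\<close>

lemma integrable_weight: "integrable lborel (\<lambda>\<xi>::real^3. 1 / (1 + (norm \<xi>)\<^sup>2) ^ 3)"
proof -
  have 1: "integrable lborel (\<lambda>x::real. complex_of_real (inverse (1 + x\<^sup>2)))"
    using integrable_inverse_1_plus_square by (intro integrable_of_real) (simp add: set_integrable_def)
  have "integrable lborel (\<lambda>\<xi>::real^3. \<Prod>b\<in>Basis. complex_of_real (inverse (1 + (\<xi> \<bullet> b)\<^sup>2)))"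
    by (rule integrable_prod_Basis(1)[OF 1])
  then have "integrable lborel (\<lambda>\<xi>::real^3. \<Prod>b\<in>Basis. inverse (1 + (\<xi> \<bullet> b)\<^sup>2))"
    by (simp only: of_real_prod[symmetric] complex_of_real_integrable_eq)
  then show ?thesis
  proof (rule Bochner_Integration.integrable_bound)
    have le: "1 / (1 + (norm \<xi>)\<^sup>2) ^ 3 \<le> (\<Prod>b\<in>Basis. inverse (1 + (\<xi> \<bullet> b)\<^sup>2))" for \<xi> :: "real^3"
    proof -
      have "(\<xi> \<bullet> b)\<^sup>2 \<le> (norm \<xi>)\<^sup>2" if "b \<in> Basis" for b
        using Basis_le_norm[OF that, of \<xi>] abs_le_square_iff[of "\<xi> \<bullet> b" "norm \<xi>"] by simp
      then have "(\<Prod>b\<in>(Basis::(real^3) set). inverse (1 + (norm \<xi>)\<^sup>2)) \<le> (\<Prod>b\<in>Basis. inverse (1 + (\<xi> \<bullet> b)\<^sup>2))"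
        by (intro prod_mono) (auto intro!: le_imp_inverse_le add_pos_nonneg)
      then show ?thesis by (simp add: divide_inverse power_inverse)
    qed
    then have "\<bar>1 / (1 + (norm \<xi>)\<^sup>2) ^ 3\<bar> \<le> \<bar>\<Prod>b\<in>Basis. inverse (1 + (\<xi> \<bullet> b)\<^sup>2)\<bar>" for \<xi> :: "real^3"
    proof -
      have "0 \<le> 1 / (1 + (norm \<xi>)\<^sup>2) ^ 3" by (simp add: add_nonneg_nonneg)
      then show ?thesis using le[of \<xi>]
        by linarith
    qed
    then show "AE \<xi>::real^3 in lborel. norm (1 / (1 + (norm \<xi>)\<^sup>2) ^ 3) \<le> norm (\<Prod>b\<in>Basis. inverse (1 + (\<xi> \<bullet> b)\<^sup>2))"
      unfolding real_norm_def by (rule AE_I2)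
  qed auto
qed

text \<open>The phase has modulus 1, so integrability of \<open>p\<close> and \<open>q\<close>
  controls the double integral. The case \<open>c = -1\<close> serves the Gaussian regularisation,
  \<open>c = 1\<close> the Fourier pairing.\<close>

lemma fubini_iexp:
  fixes p q :: "real^3 \<Rightarrow> complex" and c :: real
  assumes p: "integrable lborel p" and q: "integrable lborel q"
  shows "(LINT \<xi>|lborel. (LINT y|lborel. p \<xi> * q y * iexp (c * (\<xi> \<bullet> y)))) = (LINT y|lborel. (LINT \<xi>|lborel. p \<xi> * q y * iexp (c * (\<xi> \<bullet> y))))"
proof -
  have [measurable]: "p \<in> borel_measurable borel" "q \<in> borel_measurable borel"
    using borel_measurable_integrable[OF p] borel_measurable_integrable[OF q] by simp_all
  have m: "(\<lambda>(y, \<xi>). p \<xi> * q y * iexp (c * (\<xi> \<bullet> y))) \<in> borel_measurable (lborel \<Otimes>\<^sub>M lborel)"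
    by measurable
  have "integrable (lborel \<Otimes>\<^sub>M lborel) (\<lambda>(y, \<xi>). p \<xi> * q y * iexp (c * (\<xi> \<bullet> y)))"
  proof (rule lborel_pair.Fubini_integrable[OF m])
    have "(\<lambda>y. LINT \<xi>|lborel. norm (p \<xi> * q y * iexp (c * (\<xi> \<bullet> y)))) = (\<lambda>y. (LINT \<xi>|lborel. norm (p \<xi>)) * norm (q y))"
      by (rule HOL.ext) (simp add: norm_mult)
    then show "integrable lborel (\<lambda>y. LINT \<xi>|lborel. norm (case (y, \<xi>) of (y, \<xi>) \<Rightarrow> p \<xi> * q y * iexp (c * (\<xi> \<bullet> y))))"
      using q by simp
    have "integrable lborel (\<lambda>\<xi>. p \<xi> * q y * iexp (c * (\<xi> \<bullet> y)))" for y
      by (rule Bochner_Integration.integrable_bound[OF integrable_mult_left[OF p, of "q y"]])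
        (auto simp: norm_mult)
    then show "AE y in lborel. integrable lborel (\<lambda>\<xi>. case (y, \<xi>) of (y, \<xi>) \<Rightarrow> p \<xi> * q y * iexp (c * (\<xi> \<bullet> y)))"
      by simp
  qed
  from lborel_pair.Fubini_integral[OF this] show ?thesis by simp
qed

section \<open>Fourier transforms of smooth compactly supported functions\<close>

definition smooth_cs :: "(real^3 \<Rightarrow> complex) \<Rightarrow> bool" where
  "smooth_cs F \<longleftrightarrow> (\<forall>k. C_k k F) \<and> (\<exists>R. \<forall>x. norm x > R \<longrightarrow> F x = 0)"

lemma smooth_cs_integrable: "smooth_cs F \<Longrightarrow> integrable lborel F"
  unfolding smooth_cs_def using integrable_compact_support C_k_continuous by blast

lemma smooth_cs_partial:
  assumes "smooth_cs F" shows "smooth_cs (partial i F)"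
proof -
  obtain R where R: "\<forall>x. norm x > R \<longrightarrow> F x = 0" using assms by (auto simp: smooth_cs_def)
  have "\<forall>x. norm x > R \<longrightarrow> partial i F x = 0"
    by (intro allI impI partial_zero_outside[of R]) (use R in auto)
  moreover have "C_k k (partial i F)" for k
    using assms C_k_partial[of k F i] unfolding smooth_cs_def by (simp del: C_k.simps)
  ultimately show ?thesis unfolding smooth_cs_def by blast
qed

lemma smooth_cs_add:
  assumes "smooth_cs F" "smooth_cs G" shows "smooth_cs (\<lambda>x. F x + G x)"
proof -
  obtain R S where "\<forall>x. norm x > R \<longrightarrow> F x = 0" "\<forall>x. norm x > S \<longrightarrow> G x = 0"
    using assms unfolding smooth_cs_def by blast
  then have "\<forall>x. norm x > max R S \<longrightarrow> F x + G x = 0" by simp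
  then show ?thesis using assms C_k_add unfolding smooth_cs_def by blast
qed

lemma smooth_cs_minus: "smooth_cs F \<Longrightarrow> smooth_cs (\<lambda>x. - F x)"
  unfolding smooth_cs_def using C_k_minus by auto

lemma smooth_cs_sum: "finite I \<Longrightarrow> (\<And>i. i \<in> I \<Longrightarrow> smooth_cs (f i)) \<Longrightarrow> smooth_cs (\<lambda>x. \<Sum>i\<in>I. f i x)"
  by (induction I rule: finite_induct) (auto intro: smooth_cs_add simp: smooth_cs_def[of "\<lambda>x. 0"])

definition wave :: "real^3 \<Rightarrow> real^3 \<Rightarrow> complex" where
  "wave \<xi> x = exp (- \<i> * of_real (\<xi> \<bullet> x))"

lemma fourier_wave: "fourier \<psi> \<xi> = (LINT x|lborel. wave \<xi> x * \<psi> x)"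
  by (simp add: fourier_def wave_def)

lemma norm_wave [simp]: "norm (wave \<xi> x) = 1"
  by (simp add: wave_def norm_exp_eq_Re)

lemma wave_continuous: "continuous_on UNIV (wave \<xi>)"
  unfolding wave_def[abs_def] by (intro continuous_intros)

lemma wave_has_derivative: "(wave \<xi> has_derivative (\<lambda>h. - \<i> * of_real (\<xi> \<bullet> h) * wave \<xi> x)) (at x)"
proof -
  have 1: "((\<lambda>x. - \<i> * complex_of_real (\<xi> \<bullet> x)) has_derivative (\<lambda>h. - \<i> * of_real (\<xi> \<bullet> h))) (at x)"
    by (intro bounded_linear_imp_has_derivative bounded_linear_compose[OF bounded_linear_mult_right]
        bounded_linear_compose[OF bounded_linear_of_real] bounded_linear_inner_right)
  have "(exp has_derivative (*) (exp (- \<i> * complex_of_real (\<xi> \<bullet> x)))) (at (- \<i> * complex_of_real (\<xi> \<bullet> x)))"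
    using DERIV_exp[of "- \<i> * complex_of_real (\<xi> \<bullet> x)"] by (simp add: has_field_derivative_def)
  from has_derivative_compose[OF 1 this] show ?thesis by (simp add: wave_def[abs_def] mult_ac)
qed

lemma wave_C1: "C_k (Suc 0) (wave \<xi>)"
  by (rule C_k_SucI[OF wave_has_derivative]) (auto intro!: continuous_intros wave_continuous)

lemma integrable_wave_mult: "integrable lborel F \<Longrightarrow> integrable lborel (\<lambda>x. wave \<xi> x * F x)"
  using borel_measurable_continuous_onI[OF wave_continuous]
  by (auto intro!: Bochner_Integration.integrable_bound[of lborel F] simp: norm_mult)

lemma fourier_partial:
  assumes F: "smooth_cs F"
  shows "fourier (partial i F) \<xi> = \<i> * of_real (\<xi> $ i) * fourier F \<xi>"
proof -
  obtain R where R: "\<forall>x. norm x > R \<longrightarrow> F x = 0" using F by (auto simp: smooth_cs_def)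
  have C1: "C_k (Suc 0) F" using F unfolding smooth_cs_def by blast
  have iF: "integrable lborel F" "integrable lborel (partial i F)"
    using F smooth_cs_integrable smooth_cs_partial by blast+
  have "(LINT x|lborel. partial i (\<lambda>x. wave \<xi> x * F x) x) = 0"
    by (rule integral_partial_eq_0[of _ R]) (use R C1 wave_C1 in \<open>auto intro!: C_k_mult simp del: C_k.simps\<close>)
  moreover have "partial i (\<lambda>x. wave \<xi> x * F x) x = wave \<xi> x * partial i F x - \<i> * of_real (\<xi> $ i) * (wave \<xi> x * F x)" for x
    using C_k_differentiable[OF C1, of x] C_k_differentiable[OF wave_C1[of \<xi>], of x]
    by (simp add: partial_mult partial_eq[OF wave_has_derivative] inner_axis)
  ultimately have "(LINT x|lborel. wave \<xi> x * partial i F x - \<i> * of_real (\<xi> $ i) * (wave \<xi> x * F x)) = 0"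
    by simp
  then have "(LINT x|lborel. wave \<xi> x * partial i F x) - (LINT x|lborel. \<i> * of_real (\<xi> $ i) * (wave \<xi> x * F x)) = 0"
    by (subst (asm) Bochner_Integration.integral_diff) (intro integrable_wave_mult integrable_mult_right iF)+
  then show ?thesis by (simp add: fourier_wave)
qed

text \<open>Replacing \<open>F\<close> by \<open>F\<close> minus its Laplacian multiplies the
  transform by \<open>1 + |\<xi>|^2\<close>, so each such replacement gains one power; this is why
  \<open>F\<close> is arbitrary in the induction.\<close>

lemma fourier_decay:
  assumes "smooth_cs F"
  shows "\<exists>C. \<forall>\<xi>. (1 + (norm \<xi>)\<^sup>2) ^ k * norm (fourier F \<xi>) \<le> C"
  using assms
proof (induction k arbitrary: F)
  case 0
  have "norm (fourier F \<xi>) \<le> (LINT x|lborel. norm (F x))" for \<xi>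
    using integral_norm_bound[of lborel "\<lambda>x. wave \<xi> x * F x"] by (simp add: fourier_wave norm_mult)
  then show ?case by auto
next
  case (Suc k)
  define G where "G x = F x + - (\<Sum>i\<in>UNIV. partial i (partial i F) x)" for x
  have G: "smooth_cs G" unfolding G_def[abs_def]
    by (intro smooth_cs_add smooth_cs_minus smooth_cs_sum smooth_cs_partial Suc finite)
  have i: "integrable lborel (\<lambda>x. wave \<xi> x * partial i (partial i F) x)" "integrable lborel (\<lambda>x. wave \<xi> x * F x)" for \<xi> i
    by (intro integrable_wave_mult smooth_cs_integrable smooth_cs_partial Suc)+
  have "fourier G \<xi> = of_real (1 + (norm \<xi>)\<^sup>2) * fourier F \<xi>" for \<xi>
  proof -
    have "fourier G \<xi> = (LINT x|lborel. wave \<xi> x * F x - (\<Sum>i\<in>UNIV. wave \<xi> x * partial i (partial i F) x))"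
      unfolding fourier_wave G_def by (simp add: algebra_simps sum_distrib_left)
    also have "\<dots> = fourier F \<xi> - (\<Sum>i\<in>UNIV. fourier (partial i (partial i F)) \<xi>)"
      unfolding fourier_wave by (subst Bochner_Integration.integral_diff) (auto intro!: i Bochner_Integration.integral_sum)
    also have "\<dots> = fourier F \<xi> + (\<Sum>i\<in>UNIV. of_real (\<xi> $ i) * of_real (\<xi> $ i)) * fourier F \<xi>"
      by (simp add: fourier_partial smooth_cs_partial Suc sum_negf[symmetric] sum_distrib_right mult.assoc[symmetric])
        (simp add: sum_negf[symmetric] mult_ac)
    finally show ?thesis unfolding sum_coord_sq by (simp add: algebra_simps)
  qed
  then have "norm (fourier G \<xi>) = (1 + (norm \<xi>)\<^sup>2) * norm (fourier F \<xi>)" for \<xi>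
    by (simp only: norm_mult norm_of_real) (simp add: abs_of_pos add_pos_nonneg)
  then show ?case using Suc.IH[OF G] by (simp add: mult_ac)
qed

lemma fourier_measurable [measurable]: "integrable lborel F \<Longrightarrow> fourier F \<in> borel_measurable borel"
proof -
  assume "integrable lborel F"
  then have [measurable]: "F \<in> borel_measurable borel" using borel_measurable_integrable by auto
  have "(\<lambda>\<xi>. LINT x|lborel. exp (- \<i> * complex_of_real (\<xi> \<bullet> x)) * F x) \<in> borel_measurable borel"
    by measurable
  then show ?thesis by (simp add: fourier_def[abs_def])
qed

lemma fourier_integrable:
  assumes "smooth_cs F" shows "integrable lborel (fourier F)"
proof -
  obtain C where C: "\<And>\<xi>. (1 + (norm \<xi>)\<^sup>2) ^ 3 * norm (fourier F \<xi>) \<le> C" using fourier_decay[OF assms, of 3] by blast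
  show ?thesis
  proof (rule Bochner_Integration.integrable_bound[OF integrable_mult_right[OF integrable_weight, of C]])
    show "AE \<xi> in lborel. norm (fourier F \<xi>) \<le> norm (C * (1 / (1 + (norm \<xi>)\<^sup>2) ^ 3))"
    proof (rule AE_I2)
      fix \<xi> :: "real^3"
      have "(1 + (norm \<xi>)\<^sup>2) ^ 3 > 0" by (simp add: add_pos_nonneg)
      then have "norm (fourier F \<xi>) \<le> C * (1 / (1 + (norm \<xi>)\<^sup>2) ^ 3)"
        using C[of \<xi>] by (simp add: pos_le_divide_eq mult.commute)
      then show "norm (fourier F \<xi>) \<le> norm (C * (1 / (1 + (norm \<xi>)\<^sup>2) ^ 3))" by (metis abs_ge_self order_trans real_norm_def)
    qed
  qed (use smooth_cs_integrable[OF assms] in simp)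
qed

lemma fourier_H_weighted:
  assumes "smooth_cs F" shows "fourier F \<in> H_weighted \<gamma>"
proof -
  \<comment> \<open>With \<open>\<gamma> + 3 \<le> 2 * k\<close> the squared decay of order
    \<open>k\<close> absorbs the weight of order \<open>\<gamma>\<close> and still leaves the
    integrable weight with exponent 3.\<close>
  obtain k :: nat where "(\<gamma> + 3) / 2 \<le> real k" using real_arch_simple by blast
  then have k: "\<gamma> + 3 \<le> 2 * real k" by simp
  obtain C where C: "\<And>\<xi>. (1 + (norm \<xi>)\<^sup>2) ^ k * norm (fourier F \<xi>) \<le> C" using fourier_decay[OF assms, of k] by blast
  have [measurable]: "fourier F \<in> borel_measurable borel" using fourier_measurable smooth_cs_integrable assms by blast
  have "integrable lborel (\<lambda>\<xi>. (1 + (norm \<xi>)\<^sup>2) powr \<gamma> * (norm (fourier F \<xi>))\<^sup>2)"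
  proof (rule Bochner_Integration.integrable_bound[OF integrable_mult_right[OF integrable_weight, of "C\<^sup>2"]])
    show "AE \<xi> in lborel. norm ((1 + (norm \<xi>)\<^sup>2) powr \<gamma> * (norm (fourier F \<xi>))\<^sup>2) \<le> norm (C\<^sup>2 * (1 / (1 + (norm \<xi>)\<^sup>2) ^ 3))"
    proof (rule AE_I2)
      fix \<xi> :: "real^3"
      define w where "w = 1 + (norm \<xi>)\<^sup>2"
      have w: "w \<ge> 1" "w > 0" by (simp_all add: w_def add_pos_nonneg)
      have "w powr \<gamma> * w ^ 3 = w powr (\<gamma> + 3)" using w by (simp add: powr_add powr_numeral)
      also have "\<dots> \<le> w powr (2 * real k)" using k w by (intro powr_mono) auto
      also have "\<dots> = w powr (real (2 * k))" by simp
      also have "\<dots> = w ^ (2 * k)" by (rule powr_realpow[OF w(2)])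
      also have "\<dots> = (w ^ k)\<^sup>2" by (rule power_even_eq)
      finally have "w powr \<gamma> * w ^ 3 * (norm (fourier F \<xi>))\<^sup>2 \<le> (w ^ k)\<^sup>2 * (norm (fourier F \<xi>))\<^sup>2"
        by (rule mult_right_mono) simp
      also have "\<dots> = (w ^ k * norm (fourier F \<xi>))\<^sup>2" by (simp add: power_mult_distrib)
      also have "\<dots> \<le> C\<^sup>2" using C[of \<xi>] w by (intro power_mono) (auto simp: w_def)
      finally have "w powr \<gamma> * (norm (fourier F \<xi>))\<^sup>2 \<le> C\<^sup>2 * (1 / w ^ 3)"
        using w by (simp add: pos_le_divide_eq mult_ac)
      then show "norm ((1 + (norm \<xi>)\<^sup>2) powr \<gamma> * (norm (fourier F \<xi>))\<^sup>2) \<le> norm (C\<^sup>2 * (1 / (1 + (norm \<xi>)\<^sup>2) ^ 3))"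
        unfolding w_def[symmetric] using w by (simp add: abs_of_nonneg)
    qed
  qed measurable
  then show ?thesis by (simp add: H_weighted_def)
qed

section \<open>Gaussian regularisation and the inversion formula\<close>

lemma integral_affine:
  fixes g :: "real^3 \<Rightarrow> complex"
  assumes g: "g \<in> borel_measurable borel" and e: "e > 0"
  shows "(LINT y|lborel. g y) = of_real (e ^ 3) * (LINT z|lborel. g (x + e *\<^sub>R z))"
proof -
  have m: "(\<lambda>z. x + e *\<^sub>R z) \<in> borel_measurable borel" for x :: "real^3" by measurable
  have "(LINT y|lborel. g y) = (LINT y|density (distr lborel borel (\<lambda>z. x + e *\<^sub>R z)) (\<lambda>_. \<bar>e\<bar> ^ DIM(real^3)). g y)"
    using lborel_affine[of e x] e by simp
  also have "\<dots> = (LINT y|distr lborel borel (\<lambda>z. x + e *\<^sub>R z). (e ^ 3) *\<^sub>R g y)"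
    using e g by (subst integral_density[where f = g and g = "\<lambda>_. e ^ 3", symmetric]) (auto simp: ennreal_power)
  also have "\<dots> = (LINT z|lborel. (e ^ 3) *\<^sub>R g (x + e *\<^sub>R z))"
    using g m by (subst integral_distr) auto
  finally show ?thesis by (simp add: scaleR_conv_of_real)
qed

lemma gauss_average_tendsto:
  fixes F :: "real^3 \<Rightarrow> complex"
  assumes Fc: "continuous_on UNIV F" and B: "\<And>y. norm (F y) \<le> B" and e0: "e \<longlonglongrightarrow> 0"
  shows "(\<lambda>n. LINT z|lborel. F (x + e n *\<^sub>R z) * of_real (exp (- (norm z)\<^sup>2 / 2))) \<longlonglongrightarrow>
    (LINT z::real^3|lborel. F x * complex_of_real (exp (- (norm z)\<^sup>2 / 2)))"
proof -
  let ?g = "\<lambda>z::real^3. complex_of_real (exp (- (norm z)\<^sup>2 / 2))"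
  have gi: "integrable lborel ?g" using gauss_fourier(1)[of 1 0] by simp
  have gm: "?g \<in> borel_measurable borel" using borel_measurable_integrable[OF gi] by simp
  have Fm: "(\<lambda>z. F (x + c *\<^sub>R z)) \<in> borel_measurable borel" for c
    by (intro borel_measurable_continuous_onI continuous_on_compose2[OF Fc]) (auto intro!: continuous_intros)
  have m1: "(\<lambda>z. F (x + e n *\<^sub>R z) * ?g z) \<in> borel_measurable lborel" for n
    using borel_measurable_times[OF Fm gm] by simp
  have m2: "(\<lambda>z. F x * ?g z) \<in> borel_measurable lborel"
    using borel_measurable_times[OF borel_measurable_const gm] by simp
  have w: "integrable lborel (\<lambda>z::real^3. B * exp (- (norm z)\<^sup>2 / 2))"
    using gi unfolding complex_of_real_integrable_eq by (rule integrable_mult_right)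
  have l: "(\<lambda>n. F (x + e n *\<^sub>R z) * ?g z) \<longlonglongrightarrow> F x * ?g z" for z
  proof (rule tendsto_mult_right)
    have "(\<lambda>n. x + e n *\<^sub>R z) \<longlonglongrightarrow> x + 0 *\<^sub>R z" by (intro tendsto_intros e0)
    then have l: "(\<lambda>n. x + e n *\<^sub>R z) \<longlonglongrightarrow> x" by simp
    have "isCont F x" using Fc by (simp add: continuous_on_eq_continuous_at)
    from isCont_tendsto_compose[OF this l] show "(\<lambda>n. F (x + e n *\<^sub>R z)) \<longlonglongrightarrow> F x" .
  qed
  have b: "norm (F (x + e n *\<^sub>R z) * ?g z) \<le> B * exp (- (norm z)\<^sup>2 / 2)" for n z
    by (simp add: norm_mult B)
  show ?thesis
    by (rule integral_dominated_convergence[OF m2 m1 w AE_I2[OF l] AE_I2[OF b]])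
qed

text \<open>The Gaussian damping permits exchanging the integrals. What appears inside is the
  explicit transform of a Gaussian, and the substitution \<open>y = x + e * z\<close> turns the
  result into a Gaussian average of \<open>F\<close> around \<open>x\<close>.\<close>

lemma gauss_regularised:
  assumes F: "integrable lborel F" and e: "e > 0"
  shows "(LINT \<xi>|lborel. fourier F \<xi> * iexp (\<xi> \<bullet> x) * complex_of_real (exp (- (e * norm \<xi>)\<^sup>2 / 2))) =
    of_real (sqrt (2 * pi) ^ 3) * (LINT z|lborel. F (x + e *\<^sub>R z) * of_real (exp (- (norm z)\<^sup>2 / 2)))"
proof -
  define p where "p \<xi> = iexp (\<xi> \<bullet> x) * complex_of_real (exp (- (e * norm \<xi>)\<^sup>2 / 2))" for \<xi>
  have p: "integrable lborel p" unfolding p_def[abs_def] by (rule gauss_fourier(1)[OF e])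
  have Fm: "F \<in> borel_measurable borel" using borel_measurable_integrable[OF F] by simp
  define g where "g y = F y * complex_of_real ((sqrt (2 * pi) / e) ^ 3 * exp (- (norm (x - y) / e)\<^sup>2 / 2))" for y
  have "(\<lambda>y. complex_of_real ((sqrt (2 * pi) / e) ^ 3 * exp (- (norm (x - y) / e)\<^sup>2 / 2))) \<in> borel_measurable borel"
    using e by (intro borel_measurable_continuous_onI continuous_intros) auto
  then have gm: "g \<in> borel_measurable borel" unfolding g_def[abs_def] by (rule borel_measurable_times[OF Fm])
  have phase: "iexp (\<xi> \<bullet> x) * iexp (- 1 * (\<xi> \<bullet> y)) = iexp (\<xi> \<bullet> (x - y))" for \<xi> y
    by (simp add: exp_add[symmetric] inner_diff_right right_diff_distrib)
  have k: "p \<xi> * F y * iexp (- 1 * (\<xi> \<bullet> y)) = F y * (iexp (\<xi> \<bullet> (x - y)) * complex_of_real (exp (- (e * norm \<xi>)\<^sup>2 / 2)))" for \<xi> y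
    unfolding phase[symmetric] p_def by (simp only: mult_ac)
  have inner: "(LINT \<xi>|lborel. p \<xi> * F y * iexp (- 1 * (\<xi> \<bullet> y))) = g y" for y
    unfolding k integral_mult_right_zero g_def by (subst gauss_fourier(2)[OF e]) (rule refl)
  have outer: "(LINT y|lborel. p \<xi> * F y * iexp (- 1 * (\<xi> \<bullet> y))) = fourier F \<xi> * iexp (\<xi> \<bullet> x) * complex_of_real (exp (- (e * norm \<xi>)\<^sup>2 / 2))" for \<xi>
  proof -
    have "p \<xi> * F y * iexp (- 1 * (\<xi> \<bullet> y)) = p \<xi> * (exp (- \<i> * complex_of_real (\<xi> \<bullet> y)) * F y)" for y
      by (simp add: mult_ac)
    then have "(LINT y|lborel. p \<xi> * F y * iexp (- 1 * (\<xi> \<bullet> y))) = p \<xi> * fourier F \<xi>"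
      by (simp only: fourier_def integral_mult_right_zero)
    then show ?thesis by (simp only: p_def mult_ac)
  qed
  have s: "of_real (e ^ 3) * g (x + e *\<^sub>R z) = of_real (sqrt (2 * pi) ^ 3) * (F (x + e *\<^sub>R z) * of_real (exp (- (norm z)\<^sup>2 / 2)))" for z
    using e by (simp add: g_def power_divide)
  have "(LINT y|lborel. g y) = of_real (e ^ 3) * (LINT z|lborel. g (x + e *\<^sub>R z))"
    by (rule integral_affine[OF gm e])
  also have "\<dots> = (LINT z|lborel. of_real (e ^ 3) * g (x + e *\<^sub>R z))" by (rule integral_mult_right_zero[symmetric])
  also have "\<dots> = of_real (sqrt (2 * pi) ^ 3) * (LINT z|lborel. F (x + e *\<^sub>R z) * of_real (exp (- (norm z)\<^sup>2 / 2)))"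
    unfolding s by (rule integral_mult_right_zero)
  finally have "(LINT y|lborel. g y) = of_real (sqrt (2 * pi) ^ 3) * (LINT z|lborel. F (x + e *\<^sub>R z) * of_real (exp (- (norm z)\<^sup>2 / 2)))" .
  then show ?thesis using fubini_iexp[OF p F, of "- 1"] unfolding inner outer by (rule trans[rotated])
qed

text \<open>The damped integrals are followed to their limit in two ways: dominated convergence
  removes the damping, and the averages concentrate at \<open>x\<close>. One factor
  \<open>sqrt (2 * pi) ^ 3\<close> comes from the transform of the Gaussian, the other from its
  total mass.\<close>

lemma fourier_inversion:
  assumes F: "smooth_cs F"
  shows "(LINT \<xi>|lborel. fourier F \<xi> * iexp (\<xi> \<bullet> x)) = of_real ((2 * pi) ^ 3) * F x"
proof -
  define e where "e n = 1 / (real n + 1)" for n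
  have e: "e n > 0" "e n \<le> 1" for n by (auto simp: e_def)
  have e0: "e \<longlonglongrightarrow> 0" unfolding e_def by real_asymp
  let ?G = "\<lambda>n \<xi>. complex_of_real (exp (- (e n * norm \<xi>)\<^sup>2 / 2))"
  define I where "I n = (LINT \<xi>|lborel. fourier F \<xi> * iexp (\<xi> \<bullet> x) * ?G n \<xi>)" for n
  have fi: "integrable lborel (fourier F)" by (rule fourier_integrable[OF F])
  have Fi: "integrable lborel F" by (rule smooth_cs_integrable[OF F])
  have Fm [measurable]: "fourier F \<in> borel_measurable borel" "F \<in> borel_measurable borel"
    using borel_measurable_integrable[OF fi] borel_measurable_integrable[OF Fi] by simp_all
  obtain R where R: "\<forall>x. norm x > R \<longrightarrow> F x = 0" using F by (auto simp: smooth_cs_def)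
  have Fc: "continuous_on UNIV F" using F C_k_continuous by (auto simp: smooth_cs_def)
  have "bounded (F ` cball 0 R)"
    by (intro compact_imp_bounded compact_continuous_image continuous_on_subset[OF Fc] compact_cball) auto
  then obtain B0 where B0: "\<forall>y\<in>F ` cball 0 R. norm y \<le> B0" unfolding bounded_iff by blast
  define B where "B = max 0 B0"
  have B: "norm (F y) \<le> B" for y
  proof (cases "norm y \<le> R")
    case True
    then have "norm (F y) \<le> B0" using B0 by simp
    then show ?thesis by (simp add: B_def)
  next
    case False
    then show ?thesis using R by (simp add: B_def)
  qed
  have "I \<longlonglongrightarrow> (LINT \<xi>|lborel. fourier F \<xi> * iexp (\<xi> \<bullet> x))"
    unfolding I_def
  proof (rule integral_dominated_convergence[where w = "\<lambda>\<xi>. norm (fourier F \<xi>)"])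
    show "AE \<xi> in lborel. (\<lambda>n. fourier F \<xi> * iexp (\<xi> \<bullet> x) * ?G n \<xi>) \<longlonglongrightarrow> fourier F \<xi> * iexp (\<xi> \<bullet> x)"
    proof (rule AE_I2)
      fix \<xi> :: "real^3"
      have "(\<lambda>n. exp (- (e n * norm \<xi>)\<^sup>2 / 2)) \<longlonglongrightarrow> exp (- (0 * norm \<xi>)\<^sup>2 / 2)" by (intro tendsto_intros e0) simp
      then have "(\<lambda>n. ?G n \<xi>) \<longlonglongrightarrow> of_real 1" by (intro tendsto_of_real) simp
      then have "(\<lambda>n. fourier F \<xi> * iexp (\<xi> \<bullet> x) * ?G n \<xi>) \<longlonglongrightarrow> fourier F \<xi> * iexp (\<xi> \<bullet> x) * of_real 1"
        by (rule tendsto_mult_left)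
      then show "(\<lambda>n. fourier F \<xi> * iexp (\<xi> \<bullet> x) * ?G n \<xi>) \<longlonglongrightarrow> fourier F \<xi> * iexp (\<xi> \<bullet> x)" by simp
    qed
    show "AE \<xi> in lborel. norm (fourier F \<xi> * iexp (\<xi> \<bullet> x) * ?G n \<xi>) \<le> norm (fourier F \<xi>)" for n
      by (rule AE_I2) (simp add: norm_mult mult_left_le)
  qed (use fi in simp_all)
  moreover have "I \<longlonglongrightarrow> of_real ((2 * pi) ^ 3) * F x"
  proof -
    have In: "I n = of_real (sqrt (2 * pi) ^ 3) * (LINT z|lborel. F (x + e n *\<^sub>R z) * of_real (exp (- (norm z)\<^sup>2 / 2)))" for n
      unfolding I_def by (rule gauss_regularised[OF Fi e(1)])
    have gi: "integrable lborel (\<lambda>z::real^3. complex_of_real (exp (- (norm z)\<^sup>2 / 2)))"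
      and gv: "(LINT z::real^3|lborel. complex_of_real (exp (- (norm z)\<^sup>2 / 2))) = of_real (sqrt (2 * pi) ^ 3)"
      using gauss_fourier[of 1 0] by simp_all
    have lim: "(\<lambda>n. LINT z|lborel. F (x + e n *\<^sub>R z) * of_real (exp (- (norm z)\<^sup>2 / 2))) \<longlonglongrightarrow> (LINT z::real^3|lborel. F x * complex_of_real (exp (- (norm z)\<^sup>2 / 2)))"
      by (rule gauss_average_tendsto[OF Fc B e0])
    have L: "(LINT z::real^3|lborel. F x * complex_of_real (exp (- (norm z)\<^sup>2 / 2))) = F x * of_real (sqrt (2 * pi) ^ 3)"
      by (simp only: integral_mult_right_zero gv)
    have "I = (\<lambda>n. of_real (sqrt (2 * pi) ^ 3) * (LINT z|lborel. F (x + e n *\<^sub>R z) * of_real (exp (- (norm z)\<^sup>2 / 2))))"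
      by (rule HOL.ext) (rule In)
    then have "I \<longlonglongrightarrow> of_real (sqrt (2 * pi) ^ 3) * (F x * of_real (sqrt (2 * pi) ^ 3))"
      using tendsto_mult_left[OF lim, of "of_real (sqrt (2 * pi) ^ 3)"] by (simp only: L)
    moreover have "of_real (sqrt (2 * pi) ^ 3) * (F x * of_real (sqrt (2 * pi) ^ 3)) = of_real ((2 * pi) ^ 3) * F x"
    proof -
      have s: "sqrt (2 * pi) ^ 3 * sqrt (2 * pi) ^ 3 = (2 * pi) ^ 3"
        by (simp only: power_mult_distrib[symmetric]) simp
      have "of_real c * (F x * of_real c) = of_real (c * c) * F x" for c by (simp add: mult_ac)
      then show ?thesis by (simp only: s)
    qed
    ultimately show ?thesis by (simp only:)
  qed
  ultimately show ?thesis by (rule LIMSEQ_unique)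
qed

text \<open>The reflection in \<open>fourier \<psi> (- \<xi>)\<close> makes the phase positive, so
  that exchanging the integrals produces the inversion formula for \<open>F\<close>.\<close>

lemma inverse_fourier_distr_fourier:
  assumes F: "smooth_cs F" and \<psi>: "integrable lborel \<psi>"
  shows "inverse_fourier_distr (fourier F) \<psi> = (LINT x|lborel. F x * \<psi> x)"
proof -
  have "(LINT \<xi>|lborel. fourier F \<xi> * fourier \<psi> (- \<xi>)) = (LINT \<xi>|lborel. (LINT y|lborel. fourier F \<xi> * \<psi> y * iexp (1 * (\<xi> \<bullet> y))))"
  proof (intro Bochner_Integration.integral_cong refl)
    fix \<xi> :: "real^3"
    have "(LINT y|lborel. fourier F \<xi> * \<psi> y * iexp (1 * (\<xi> \<bullet> y))) = (LINT y|lborel. fourier F \<xi> * (exp (- \<i> * complex_of_real ((- \<xi>) \<bullet> y)) * \<psi> y))"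
      by (simp add: mult_ac)
    also have "\<dots> = fourier F \<xi> * fourier \<psi> (- \<xi>)" unfolding fourier_def[of \<psi>] by (rule integral_mult_right_zero)
    finally show "fourier F \<xi> * fourier \<psi> (- \<xi>) = (LINT y|lborel. fourier F \<xi> * \<psi> y * iexp (1 * (\<xi> \<bullet> y)))" by simp
  qed
  also have "\<dots> = (LINT y|lborel. (LINT \<xi>|lborel. fourier F \<xi> * \<psi> y * iexp (1 * (\<xi> \<bullet> y))))"
    by (rule fubini_iexp[OF fourier_integrable[OF F] \<psi>])
  also have "\<dots> = (LINT y|lborel. of_real ((2 * pi) ^ 3) * (F y * \<psi> y))"
  proof (intro Bochner_Integration.integral_cong refl)
    fix y
    have "(LINT \<xi>|lborel. fourier F \<xi> * \<psi> y * iexp (1 * (\<xi> \<bullet> y))) = (LINT \<xi>|lborel. \<psi> y * (fourier F \<xi> * iexp (\<xi> \<bullet> y)))"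
      by (simp add: mult_ac)
    also have "\<dots> = \<psi> y * (of_real ((2 * pi) ^ 3) * F y)"
      unfolding integral_mult_right_zero fourier_inversion[OF F] ..
    finally show "(LINT \<xi>|lborel. fourier F \<xi> * \<psi> y * iexp (1 * (\<xi> \<bullet> y))) = of_real ((2 * pi) ^ 3) * (F y * \<psi> y)"
      by (simp add: mult_ac)
  qed
  also have "\<dots> = of_real ((2 * pi) ^ 3) * (LINT y|lborel. F y * \<psi> y)" by (rule integral_mult_right_zero)
  finally have "inverse_fourier_distr (fourier F) \<psi> = of_real (1 / (2 * pi) ^ 3 * (2 * pi) ^ 3) * (LINT y|lborel. F y * \<psi> y)"
    unfolding inverse_fourier_distr_def by (simp only: of_real_mult mult.assoc)
  then show ?thesis by simp
qed

text \<open>A holomorphic radial profile extends to a smooth compactly supported function, whose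
  transform lies in \<open>H_weighted\<close> for every order; hence \<open>\<gamma>\<close> is
  arbitrary here.\<close>

lemma (in radial_shell) H_bar_ud:
  assumes f: "f holomorphic_on U" and u: "\<And>\<phi>. \<phi> \<in> test_functions Y \<Longrightarrow> u \<phi> = ud f \<phi>"
  shows "u \<in> H_bar \<gamma> Y"
proof -
  have F: "smooth_cs (ext f)" unfolding smooth_cs_def using ext(1,2)[OF f] by blast
  have "u \<phi> = inverse_fourier_distr (fourier (ext f)) (\<lambda>x. \<phi> x / complex_of_real ((norm x)\<^sup>2))" if \<phi>: "\<phi> \<in> test_functions Y" for \<phi>
  proof -
    have c: "csupp Y 0 \<phi>" using \<phi> unfolding test_functions_csupp by blast
    have i: "integrable lborel (\<lambda>x. \<phi> x / complex_of_real ((norm x)\<^sup>2))"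
      using ud_integrable[OF holomorphic_on_const[of 1] c] by simp
    have "f (of_real (norm x)) * \<phi> x / of_real ((norm x)\<^sup>2) = ext f x * (\<phi> x / of_real ((norm x)\<^sup>2))" for x
      using csupp_outside[OF c, of x] ext_Y[OF f, of x] by (cases "x \<in> Y") simp_all
    then have "ud f \<phi> = (LINT x|lborel. ext f x * (\<phi> x / complex_of_real ((norm x)\<^sup>2)))" unfolding ud_def by (simp only:)
    then show ?thesis unfolding u[OF \<phi>] inverse_fourier_distr_fourier[OF F i] .
  qed
  then show ?thesis unfolding H_bar_def using fourier_H_weighted[OF F] by blast
qed

section \<open>The radial equation near the horizons\<close>

text \<open>Numerator and denominator are both divided by \<open>z - a\<close> first; the divided
  differences are holomorphic and the one of \<open>A\<close> has no zeros.\<close>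

lemma holomorphic_quotient_simple_zero:
  assumes F: "F holomorphic_on S" and A: "A holomorphic_on S" and S: "open S" "a \<in> S"
    and "F a = 0" "A a = 0" "deriv A a \<noteq> 0" and nz: "\<And>z. z \<in> S - {a} \<Longrightarrow> A z \<noteq> (0::complex)"
  shows "(\<lambda>z. if z = a then deriv F a / deriv A a else F z / A z) holomorphic_on S"
proof -
  let ?D = "\<lambda>f z. if z = a then deriv f a else (f z - f a) / (z - a)"
  have a: "a \<in> interior S" using S by (simp add: interior_open)
  have "(\<lambda>z. ?D F z / ?D A z) holomorphic_on S"
    by (intro holomorphic_on_divide pole_lemma F A a) (use assms in auto)
  then show ?thesis
    by (rule holomorphic_transform) (use assms in auto)
qed

text \<open>The M-test for the telescoping series. Iterates are compared only on \<open>S\<close>,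
  which suits functions whose values off the domain are arbitrary.\<close>

lemma geometric_uniform_limit:
  fixes x :: "nat \<Rightarrow> 'a \<Rightarrow> complex"
  assumes "\<And>k z. z \<in> S \<Longrightarrow> norm (x (Suc k) z - x k z) \<le> C * (1/2) ^ k"
  obtains l where "uniform_limit S x l sequentially"
proof -
  have "uniform_limit S (\<lambda>n z. \<Sum>i<n. x (Suc i) z - x i z) (\<lambda>z. \<Sum>i. x (Suc i) z - x i z) sequentially"
    by (rule Weierstrass_m_test[where M = "\<lambda>k. C * (1/2) ^ k"])
      (use assms in \<open>auto intro!: summable_mult summable_geometric\<close>)
  moreover have "(\<Sum>i<n. x (Suc i) z - x i z) = x n z - x 0 z" for n z
    using sum_lessThan_telescope[of "\<lambda>i. x i z" n] .
  ultimately have "uniform_limit S (\<lambda>n z. x n z - x 0 z) (\<lambda>z. \<Sum>i. x (Suc i) z - x i z) sequentially"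
    by simp
  then have "uniform_limit S (\<lambda>n z. (x n z - x 0 z) + x 0 z) (\<lambda>z. (\<Sum>i. x (Suc i) z - x i z) + x 0 z) sequentially"
    by (intro uniform_limit_add uniform_limit_const)
  then show thesis using that by simp
qed

text \<open>A calculus of constants: \<open>B\<close> bounds both points and \<open>L * D\<close>
  their difference, with \<open>D\<close> a shared scale. The rules for sums and products then give
  Lipschitz constants of polynomials mechanically.\<close>

definition lipschitz_bounded :: "real \<Rightarrow> real \<Rightarrow> real \<Rightarrow> complex \<Rightarrow> complex \<Rightarrow> bool" where
  "lipschitz_bounded D B L x x' \<longleftrightarrow> norm x \<le> B \<and> norm x' \<le> B \<and> norm (x - x') \<le> L * D"

lemma lipschitz_bounded_const: "norm x \<le> B \<Longrightarrow> lipschitz_bounded D B 0 x x"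
  by (simp add: lipschitz_bounded_def)

lemma lipschitz_bounded_add: "lipschitz_bounded D B L x x' \<Longrightarrow> lipschitz_bounded D B' L' y y' \<Longrightarrow> lipschitz_bounded D (B + B') (L + L') (x + y) (x' + y')"
  using norm_triangle_ineq[of x y] norm_triangle_ineq[of x' y'] norm_triangle_ineq[of "x - x'" "y - y'"]
  by (simp add: lipschitz_bounded_def algebra_simps)

lemma lipschitz_bounded_minus: "lipschitz_bounded D B L x x' \<Longrightarrow> lipschitz_bounded D B L (- x) (- x')"
  by (auto simp: lipschitz_bounded_def norm_minus_commute)

lemma lipschitz_bounded_diff: "lipschitz_bounded D B L x x' \<Longrightarrow> lipschitz_bounded D B' L' y y' \<Longrightarrow> lipschitz_bounded D (B + B') (L + L') (x - y) (x' - y')"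
  using lipschitz_bounded_add[of D B L x x' B' L' "-y" "-y'"] lipschitz_bounded_minus by simp

lemma lipschitz_bounded_mult:
  assumes "lipschitz_bounded D B L x x'" "lipschitz_bounded D B' L' y y'"
  shows "lipschitz_bounded D (B * B') (B * L' + L * B') (x * y) (x' * y')"
proof -
  have B: "0 \<le> B" "0 \<le> B'" and D: "0 \<le> L * D" "0 \<le> L' * D"
    using assms order_trans[OF norm_ge_zero] by (force simp: lipschitz_bounded_def)+
  have "x * y - x' * y' = x * (y - y') + (x - x') * y'" by (simp add: algebra_simps)
  also have "norm \<dots> \<le> B * (L' * D) + (L * D) * B'"
    by (intro order_trans[OF norm_triangle_ineq] add_mono order_trans[OF norm_mult_ineq] mult_mono)
      (use assms B D in \<open>auto simp: lipschitz_bounded_def\<close>)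
  finally show ?thesis using assms B unfolding lipschitz_bounded_def
    by (auto simp: norm_mult algebra_simps intro!: mult_mono)
qed

lemma lipschitz_bounded_power2:
  assumes "lipschitz_bounded D B L x x'" shows "lipschitz_bounded D (B * B) (B * L + L * B) (x\<^sup>2) (x'\<^sup>2)"
  using lipschitz_bounded_mult[OF assms assms] by (simp add: power2_eq_square)

lemmas lipschitz_bounded_intros = lipschitz_bounded_add lipschitz_bounded_diff lipschitz_bounded_mult lipschitz_bounded_power2

text \<open>\<open>A\<close> stands for \<open>r^2 \<mu>\<close>, \<open>n\<close> for the
  continuation of \<open>\<nu>\<close>, \<open>m0\<close> for the bound on \<open>m^2 / q^2\<close>.
  The inequality with \<open>k\<close> makes \<open>a\<close> and \<open>b\<close> the only zeros of
  \<open>A\<close> in \<open>U\<close>, both simple, and does so uniformly on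
  \<open>U\<close>.\<close>

locale horizon_ode =
  fixes U :: "complex set" and A n :: "complex \<Rightarrow> complex" and a b Q c2 N k Z m0 :: real
  assumes U: "open U" "convex U" and Z: "\<And>z. z \<in> U \<Longrightarrow> norm z \<le> Z"
    and ab: "0 < a" "a < b" "of_real a \<in> U" "of_real b \<in> U"
    and A: "A holomorphic_on U" "A a = 0" "A b = 0"
    and k: "k > 0" "\<And>z. z \<in> U \<Longrightarrow> k * min (norm (z - a)) (norm (z - b)) \<le> norm (A z)"
    and n: "n holomorphic_on U" "n a = 1" "n b = -1"
    and N: "\<And>z. z \<in> U \<Longrightarrow> norm (n z) \<le> N" "\<And>z. z \<in> U \<Longrightarrow> norm (deriv n z) \<le> N"
    and m0: "m0 \<ge> 0"
begin

definition prim :: "(complex \<Rightarrow> complex) \<Rightarrow> complex \<Rightarrow> complex" where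
  "prim g z = contour_integral (linepath (of_real a) z) g"

lemma segment_subset: "x \<in> U \<Longrightarrow> y \<in> U \<Longrightarrow> closed_segment x y \<subseteq> U"
  using U(2) by (simp add: closed_segment_subset)

lemma integrable_seg:
  assumes "g holomorphic_on U" "x \<in> U" "y \<in> U"
  shows "g contour_integrable_on (linepath x y)"
  using continuous_on_subset[OF holomorphic_on_imp_continuous_on[OF assms(1)] segment_subset[OF assms(2,3)]]
  by (rule contour_integrable_continuous_linepath)

lemma primitive:
  assumes g: "g holomorphic_on U" and "z \<in> U" "x0 \<in> U"
  shows "((\<lambda>z. contour_integral (linepath x0 z) g) has_field_derivative g z) (at z)"
proof -
  obtain f where f: "\<And>x. x \<in> U \<Longrightarrow> (f has_field_derivative g x) (at x within U)"
    using holomorphic_convex_primitive'[OF U(2,1) g] by blast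
  have eq: "contour_integral (linepath x0 x) g = f x - f x0" if "x \<in> U" for x
  proof -
    have "(g has_contour_integral (f (pathfinish (linepath x0 x)) - f (pathstart (linepath x0 x)))) (linepath x0 x)"
      using f by (rule contour_integral_primitive) (simp_all add: segment_subset that \<open>x0 \<in> U\<close>)
    then show ?thesis by (simp add: contour_integral_unique)
  qed
  have "(f has_field_derivative g z) (at z)" using f[OF \<open>z \<in> U\<close>] by (simp only: at_within_open[OF \<open>z \<in> U\<close> U(1)])
  then have "((\<lambda>z. f z - f x0) has_field_derivative g z) (at z)"
    by (auto intro!: derivative_eq_intros)
  then show ?thesis
    by (rule has_field_derivative_transform_within_open) (use U \<open>z \<in> U\<close> eq in auto)
qed

lemma prim_deriv: "g holomorphic_on U \<Longrightarrow> z \<in> U \<Longrightarrow> (prim g has_field_derivative g z) (at z)"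
  using primitive[of g z "of_real a"] ab by (simp add: prim_def[abs_def])

lemma prim_holomorphic: "g holomorphic_on U \<Longrightarrow> prim g holomorphic_on U"
  using U(1) prim_deriv by (subst holomorphic_on_open) blast+

lemma prim_a [simp]: "prim g (of_real a) = 0"
  by (simp add: prim_def)

lemma prim_bound:
  assumes g: "g holomorphic_on U" "\<And>z. z \<in> U \<Longrightarrow> norm (g z) \<le> B" and z: "z \<in> U"
  shows "norm (prim g z) \<le> B * norm (z - of_real a)"
proof -
  have "0 \<le> B" using g(2)[OF z] norm_ge_zero order_trans by blast
  then show ?thesis unfolding prim_def
    using contour_integral_bound_linepath[OF integrable_seg[OF g(1) ab(3) z], of B] segment_subset[OF ab(3) z] g(2)
    by (simp add: subset_eq)
qed

lemma prim_bound_uniform: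
  assumes g: "g holomorphic_on U" "\<And>z. z \<in> U \<Longrightarrow> norm (g z) \<le> B" and z: "z \<in> U"
  shows "norm (prim g z) \<le> B * (2 * Z)"
proof -
  have "0 \<le> B" using g(2)[OF z] norm_ge_zero order_trans by blast
  moreover have "norm (z - of_real a) \<le> 2 * Z"
    using Z[OF z] Z[OF ab(3)] norm_triangle_ineq4[of z "of_real a"] by linarith
  ultimately show ?thesis using prim_bound[OF assms] mult_left_mono[of _ _ B] order_trans by blast
qed

lemma prim_unique:
  assumes "\<And>z. z \<in> U \<Longrightarrow> (f has_field_derivative g z) (at z)" and z: "z \<in> U"
  shows "prim g z = f z - f (of_real a)"
proof -
  have f: "(f has_field_derivative g x) (at x within U)" if "x \<in> U" for x
    using assms(1)[OF that] by (rule has_field_derivative_at_within)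
  then have "(g has_contour_integral (f (pathfinish (linepath a z)) - f (pathstart (linepath a z)))) (linepath a z)"
    by (rule contour_integral_primitive) (simp_all add: segment_subset z ab)
  then show ?thesis by (simp add: contour_integral_unique prim_def)
qed

lemma prim_diff:
  assumes "g holomorphic_on U" "g' holomorphic_on U" "z \<in> U"
  shows "prim (\<lambda>z. g z - g' z) z = prim g z - prim g' z"
  unfolding prim_def by (intro contour_integral_diff integrable_seg assms ab)

text \<open>Division of \<open>prim g\<close> by \<open>A\<close>, with the values prescribed by
  l'Hopital's rule at the two horizons.\<close>

definition quot :: "(complex \<Rightarrow> complex) \<Rightarrow> complex \<Rightarrow> complex" where
  "quot g z = (if z = a \<or> z = b then g z / deriv A z else prim g z / A z)"

lemma A_nz: "z \<in> U \<Longrightarrow> z \<noteq> a \<Longrightarrow> z \<noteq> b \<Longrightarrow> A z \<noteq> 0"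
  using k(2)[of z] k(1) by (auto simp: mult_le_0_iff min_le_iff_disj)

lemma deriv_A_ge:
  assumes "z \<in> U" "z = of_real a \<or> z = of_real b"
  shows "k \<le> norm (deriv A z)"
proof -
  have "A z = 0" using A assms by auto
  have "(A has_field_derivative deriv A z) (at z)"
    using A(1) U assms holomorphic_derivI by blast
  then have lim: "((\<lambda>w. norm ((A w - A z) / (w - z))) \<longlongrightarrow> norm (deriv A z)) (at z)"
    by (intro tendsto_norm) (simp add: has_field_derivative_iff)
  \<comment> \<open>Closer than \<open>(b - a) / 2\<close> to one horizon, the minimum in the lower
    bound for \<open>A\<close> is the distance to that horizon.\<close>
  have ev: "\<forall>\<^sub>F w in at z. w \<in> U \<and> dist w z < (b - a) / 2"
    using U(1) assms(1) ab by (intro eventually_conj eventually_at_in_open')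
      (auto simp: eventually_at intro!: exI[of _ "(b-a)/2"])
  have "\<forall>\<^sub>F w in at z. k \<le> norm ((A w - A z) / (w - z))"
    using ev eventually_neq_at_within[of z z UNIV]
  proof eventually_elim
    case (elim w)
    have d: "norm (complex_of_real a - complex_of_real b) = b - a"
      using ab by (metis abs_minus_commute abs_of_pos diff_gt_0_iff_gt norm_of_real of_real_diff)
    have "norm (w - z) \<le> min (norm (w - a)) (norm (w - b))"
      using elim assms(2) d norm_triangle_ineq4[of "w - complex_of_real b" "w - complex_of_real a"]
      by (auto simp: dist_norm norm_minus_commute)
    then have "k * norm (w - z) \<le> norm (A w)"
      using k(2)[of w] elim k(1) by (meson less_imp_le mult_left_mono order_trans)
    then show ?case using \<open>A z = 0\<close> elim by (simp add: norm_divide field_simps)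
  qed
  then show ?thesis
    by (rule tendsto_lowerbound[OF lim]) auto
qed

text \<open>The condition at \<open>b\<close> allows the primitive to be based at either horizon, so
  \<open>prim g z\<close> is at most \<open>B\<close> times the smaller of the two distances, which
  is exactly what the lower bound on \<open>A\<close> cancels. The division shrinks no domain and
  needs no derivative of \<open>g\<close>, so the iteration closes in sup norm.\<close>

lemma quot_props:
  assumes g: "g holomorphic_on U" "\<And>z. z \<in> U \<Longrightarrow> norm (g z) \<le> B" and mean: "prim g b = 0"
  shows "quot g holomorphic_on U" "\<And>z. z \<in> U \<Longrightarrow> norm (quot g z) \<le> B / k"
    "\<And>z. z \<in> U \<Longrightarrow> A z * quot g z = prim g z"
proof -
  have dp: "deriv (prim g) z = g z" if "z \<in> U" for z
    using prim_deriv[OF g(1) that] by (rule DERIV_imp_deriv)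
  have dAnz: "deriv A (of_real a) \<noteq> 0" "deriv A (of_real b) \<noteq> 0"
    using deriv_A_ge[OF ab(3)] deriv_A_ge[OF ab(4)] k(1) by auto
  have abne: "complex_of_real a \<noteq> of_real b" using ab by simp
  note hp = prim_holomorphic[OF g(1)]
  have eq: "quot g z = (if z = c then deriv (prim g) c / deriv A c else prim g z / A z)"
    if "c = of_real a \<or> c = of_real b" "d = of_real a \<or> d = of_real b" "c \<noteq> d" "z \<in> U - {d}" for c d z
    using that dp[of z] by (auto simp: quot_def)
  \<comment> \<open>One removable singularity is treated at a time: deleting the other horizon keeps
    the domain open, and the two punctured domains cover \<open>U\<close>.\<close>
  have hol: "quot g holomorphic_on (U - {d})"
    if cd: "c = of_real a \<or> c = of_real b" "d = of_real a \<or> d = of_real b" "c \<noteq> d" for c d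
  proof (rule holomorphic_transform)
    show "(\<lambda>z. if z = c then deriv (prim g) c / deriv A c else prim g z / A z) holomorphic_on U - {d}"
    proof (rule holomorphic_quotient_simple_zero)
      show "prim g holomorphic_on U - {d}" "A holomorphic_on U - {d}"
        using hp A(1) by (auto intro: holomorphic_on_subset)
      show "open (U - {d})" "c \<in> U - {d}" using U cd ab by auto
      show "prim g c = 0" "A c = 0" "deriv A c \<noteq> 0" using cd mean A dAnz by auto
      show "A z \<noteq> 0" if "z \<in> U - {d} - {c}" for z using A_nz[of z] that cd by blast
    qed
    show "(if z = c then deriv (prim g) c / deriv A c else prim g z / A z) = quot g z" if "z \<in> U - {d}" for z
      using eq[OF cd that] by simp
  qed
  have "quot g holomorphic_on (U - {of_real b})" "quot g holomorphic_on (U - {of_real a})"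
    using hol[of "of_real a" "of_real b"] hol[of "of_real b" "of_real a"] abne by simp_all
  then have "quot g holomorphic_on ((U - {of_real b}) \<union> (U - {of_real a}))"
    using U(1) by (intro holomorphic_on_Un) auto
  moreover have "(U - {of_real b}) \<union> (U - {of_real a}) = U" using abne by auto
  ultimately show "quot g holomorphic_on U" by simp
  show "A z * quot g z = prim g z" if "z \<in> U" for z
  proof -
    consider "z = of_real a" | "z = of_real b" | "z \<noteq> of_real a" "z \<noteq> of_real b" by blast
    then show ?thesis using A_nz[OF that] A mean by cases (simp_all add: quot_def)
  qed
  have B: "0 \<le> B" using g(2)[OF ab(3)] norm_ge_zero order_trans by blast
  fix z assume z: "z \<in> U"
  show "norm (quot g z) \<le> B / k"
  proof (cases "z = a \<or> z = b")
    case True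
    then show ?thesis using deriv_A_ge[OF z True] g(2)[OF z] k(1) B
      by (auto simp: quot_def norm_divide intro!: frac_le)
  next
    case False
    have 1: "norm (prim g z) \<le> B * norm (z - of_real a)" by (rule prim_bound[OF g z])
    \<comment> \<open>The base point is moved to \<open>b\<close>, at the cost of an integral that
      vanishes by \<open>mean\<close>.\<close>
    have "prim g z = contour_integral (linepath (of_real b) z) g - contour_integral (linepath (of_real b) (of_real a)) g"
      using primitive[OF g(1) _ ab(4)] z by (intro prim_unique)
    moreover have "contour_integral (linepath (of_real b) (of_real a)) g = 0"
    proof -
      have "continuous_on (closed_segment (of_real a) (of_real b)) g"
        using segment_subset[OF ab(3,4)] g(1) holomorphic_on_imp_continuous_on continuous_on_subset by blast
      from contour_integral_reverse_linepath[OF this] show ?thesis using mean by (simp add: prim_def)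
    qed
    ultimately have "norm (prim g z) \<le> B * norm (z - of_real b)"
      using contour_integral_bound_linepath[OF integrable_seg[OF g(1) ab(4) z], of B] B segment_subset[OF ab(4) z] g(2)
      by (simp add: subset_eq)
    with 1 have "norm (prim g z) \<le> B * min (norm (z - of_real a)) (norm (z - of_real b))"
      by (simp add: min_def)
    then have "k * norm (prim g z) \<le> B * (k * min (norm (z - of_real a)) (norm (z - of_real b)))"
      using k(1) by (simp add: mult.left_commute)
    also have "\<dots> \<le> B * norm (A z)" using k(2)[OF z] B by (rule mult_left_mono)
    finally show ?thesis using False A_nz[OF z] k(1)
      by (simp add: quot_def norm_divide field_simps)
  qed
qed

lemma prim_linear:
  assumes "g holomorphic_on U" "g' holomorphic_on U" "z \<in> U"
  shows "prim (\<lambda>z. c * g z + c' * g' z) z = c * prim g z + c' * prim g' z"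
proof -
  have "((\<lambda>z. c * prim g z + c' * prim g' z) has_field_derivative (c * g z + c' * g' z)) (at z)" if "z \<in> U" for z
    using prim_deriv[OF assms(1) that] prim_deriv[OF assms(2) that] by (auto intro!: derivative_eq_intros)
  then have "prim (\<lambda>z. c * g z + c' * g' z) z = (c * prim g z + c' * prim g' z) - (c * prim g a + c' * prim g' a)"
    by (rule prim_unique) (use assms in auto)
  then show ?thesis by simp
qed

lemma quot_diff:
  assumes "g holomorphic_on U" "g' holomorphic_on U" "z \<in> U"
  shows "quot g z - quot g' z = quot (\<lambda>z. g z - g' z) z"
  using prim_diff[OF assms] by (simp add: quot_def diff_divide_distrib)

text \<open>Put \<open>\<sigma> = q sg\<close> and \<open>w = 1 + q prim y\<close>. Dividing the radial equation by \<open>q\<close> and integrating from \<open>a\<close> turns it into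
  \<open>A y = prim (src q M2 sg y)\<close> with \<open>M2 = m\<^sup>2 / q\<^sup>2\<close>. As \<open>A b = 0\<close>, the right-hand side has to vanish at \<open>b\<close>;
  this determines \<open>sg\<close>, and \<open>nsg\<close> is the resulting value.\<close>

definition e :: "complex \<Rightarrow> complex \<Rightarrow> complex" where
  "e sg z = sg * (z * z) + of_real Q * z"

definition dne :: "complex \<Rightarrow> complex \<Rightarrow> complex" where
  "dne sg z = deriv n z * e sg z + n z * (2 * sg * z + of_real Q)"

text \<open>What remains of the right-hand side after \<open>\<i> * dne sg\<close> has been split
  off and a factor \<open>q\<close> taken out; \<open>1 + q * prim y\<close> is \<open>w\<close>. No
  derivative of \<open>y\<close> occurs, since differentiating \<open>n * e * w\<close> produces
  only \<open>w' = q * y\<close>.\<close>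

definition h :: "real \<Rightarrow> real \<Rightarrow> complex \<Rightarrow> (complex \<Rightarrow> complex) \<Rightarrow> complex \<Rightarrow> complex" where
  "h q M2 sg y z = \<i> * dne sg z * prim y z + 2 * \<i> * n z * e sg z * y z
     + (of_real M2 * (z * z) - of_real c2 * (sg * z + of_real Q)\<^sup>2) * (1 + of_real q * prim y z)"

definition nsg :: "real \<Rightarrow> real \<Rightarrow> complex \<Rightarrow> (complex \<Rightarrow> complex) \<Rightarrow> complex" where
  "nsg q M2 sg y = (- of_real (Q * (a + b)) - \<i> * of_real q * prim (h q M2 sg y) b) / of_real (a\<^sup>2 + b\<^sup>2)"

definition src :: "real \<Rightarrow> real \<Rightarrow> complex \<Rightarrow> (complex \<Rightarrow> complex) \<Rightarrow> complex \<Rightarrow> complex" where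
  "src q M2 sg y z = \<i> * dne (nsg q M2 sg y) z + of_real q * h q M2 sg y z"

lemma R_pos: "a\<^sup>2 + b\<^sup>2 > 0" using ab by (simp add: sum_power2_gt_zero_iff)

lemma Z_pos: "Z > 0" using Z[OF ab(3)] ab by simp

lemma N_nonneg: "N \<ge> 0" using N(1)[OF ab(3)] norm_ge_zero order_trans by blast

lemma dne_holomorphic: "dne sg holomorphic_on U"
  unfolding dne_def[abs_def] e_def
  by (intro holomorphic_intros holomorphic_deriv n U)

lemma h_holomorphic: "y holomorphic_on U \<Longrightarrow> h q M2 sg y holomorphic_on U"
  unfolding h_def[abs_def] e_def
  by (intro holomorphic_intros dne_holomorphic prim_holomorphic n)

lemma src_holomorphic: "y holomorphic_on U \<Longrightarrow> src q M2 sg y holomorphic_on U"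
  unfolding src_def[abs_def] by (intro holomorphic_intros dne_holomorphic h_holomorphic)

lemma ne_deriv: "z \<in> U \<Longrightarrow> ((\<lambda>z. n z * e sg z) has_field_derivative dne sg z) (at z)"
  unfolding dne_def e_def
  by (rule derivative_eq_intros refl holomorphic_derivI[OF n(1) U(1)] | assumption)+ (simp add: algebra_simps)

lemma prim_dne: "z \<in> U \<Longrightarrow> prim (dne sg) z = n z * e sg z - e sg a"
  using prim_unique[OF ne_deriv] n(2) by simp

lemma prim_src:
  assumes "y holomorphic_on U" "z \<in> U"
  shows "prim (src q M2 sg y) z = \<i> * (n z * e (nsg q M2 sg y) z - e (nsg q M2 sg y) a) + of_real q * prim (h q M2 sg y) z"
  unfolding src_def[abs_def]
  by (subst prim_linear[OF dne_holomorphic h_holomorphic[OF assms(1)] assms(2)])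
    (simp add: prim_dne assms(2))

text \<open>As \<open>n\<close> is 1 at \<open>a\<close> and -1 at \<open>b\<close>, the boundary
  terms of \<open>n * e\<close> add up to \<open>- (s * (a^2 + b^2) + Q * (a + b))\<close>, an
  affine function of the frequency \<open>s\<close> with nonzero slope. \<open>nsg\<close> is the
  value of \<open>s\<close> that balances \<open>q * prim h b\<close>.\<close>

lemma prim_src_b:
  assumes "y holomorphic_on U"
  shows "prim (src q M2 sg y) b = 0"
proof -
  have R: "complex_of_real (a\<^sup>2 + b\<^sup>2) \<noteq> 0" using R_pos by (simp only: of_real_eq_0_iff)
  have *: "- of_real (Q * (a + b)) - \<i> * of_real q * prim (h q M2 sg y) b = nsg q M2 sg y * of_real (a\<^sup>2 + b\<^sup>2)"
    by (rule nonzero_divide_eq_eq[OF R, THEN iffD1, OF nsg_def[symmetric]])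
  have "\<i> * - (nsg q M2 sg y * of_real (a\<^sup>2 + b\<^sup>2) + of_real (Q * (a + b))) + of_real q * prim (h q M2 sg y) b = 0"
    unfolding *[symmetric] by (simp add: mult.assoc[symmetric])
  moreover have "n b * e s b - e s a = - (s * of_real (a\<^sup>2 + b\<^sup>2) + of_real (Q * (a + b)))" for s
    using n(3) by (simp add: e_def power2_eq_square algebra_simps)
  ultimately show ?thesis
    using prim_src[OF assms ab(4)] by presburger
qed

section \<open>The contraction on pairs of a frequency and a profile\<close>

definition dom :: "real \<Rightarrow> complex \<Rightarrow> (complex \<Rightarrow> complex) \<Rightarrow> bool" where
  "dom C sg y \<longleftrightarrow> norm sg \<le> C \<and> y holomorphic_on U \<and> (\<forall>z\<in>U. norm (y z) \<le> C)"

definition near :: "real \<Rightarrow> complex \<Rightarrow> (complex \<Rightarrow> complex) \<Rightarrow> complex \<Rightarrow> (complex \<Rightarrow> complex) \<Rightarrow> bool" where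
  "near D sg y sg' y' \<longleftrightarrow> norm (sg - sg') \<le> D \<and> (\<forall>z\<in>U. norm (y z - y' z) \<le> D)"

lemma lipschitz_bounded_prim:
  assumes "dom C sg y" "dom C sg' y'" "near D sg y sg' y'" "z \<in> U"
  shows "lipschitz_bounded D (C * (2 * Z)) (2 * Z) (prim y z) (prim y' z)"
proof -
  have "norm (prim (\<lambda>z. y z - y' z) z) \<le> D * (2 * Z)"
    using assms by (intro prim_bound_uniform holomorphic_intros) (auto simp: dom_def near_def)
  moreover have "norm (prim y z) \<le> C * (2 * Z)" "norm (prim y' z) \<le> C * (2 * Z)"
    using assms by (auto intro!: prim_bound_uniform simp: dom_def)
  ultimately show ?thesis using prim_diff[of y y' z] assms by (simp add: lipschitz_bounded_def dom_def mult.commute)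
qed

text \<open>The polynomial \<open>h\<close> is abstracted over all its ingredients so that \<open>lipschitz_bounded_intros\<close> computes
  the witnesses \<open>B\<close> and \<open>L\<close> by unification.\<close>

lemma h_lip:
  obtains B L where "B \<ge> 0" "L \<ge> 0"
    "\<And>q q' M2 sg sg' y y' D z. \<lbrakk>\<bar>q\<bar> \<le> 1; \<bar>q'\<bar> \<le> 1; \<bar>q - q'\<bar> \<le> D; 0 \<le> M2; M2 \<le> m0; dom C sg y; dom C sg' y';
        near D sg y sg' y'; z \<in> U\<rbrakk> \<Longrightarrow> lipschitz_bounded D B L (h q M2 sg y z) (h q' M2 sg' y' z)"
proof -
  have "\<exists>B L. \<forall>D z (q::complex) q' sg sg' y y' p p' M2 nz dn Q' c' two one j.
     lipschitz_bounded D Z 0 z z \<longrightarrow> lipschitz_bounded D 1 1 q q' \<longrightarrow> lipschitz_bounded D C 1 sg sg' \<longrightarrow> lipschitz_bounded D C 1 y y' \<longrightarrow>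
     lipschitz_bounded D (C * (2 * Z)) (2 * Z) p p' \<longrightarrow> lipschitz_bounded D m0 0 M2 M2 \<longrightarrow> lipschitz_bounded D N 0 nz nz \<longrightarrow> lipschitz_bounded D N 0 dn dn \<longrightarrow>
     lipschitz_bounded D \<bar>Q\<bar> 0 Q' Q' \<longrightarrow> lipschitz_bounded D \<bar>c2\<bar> 0 c' c' \<longrightarrow> lipschitz_bounded D 2 0 two two \<longrightarrow> lipschitz_bounded D 1 0 one one \<longrightarrow> lipschitz_bounded D 1 0 j j \<longrightarrow>
     lipschitz_bounded D B L (j * (dn * (sg * (z * z) + Q' * z) + nz * (two * sg * z + Q')) * p + two * j * nz * (sg * (z * z) + Q' * z) * y
        + (M2 * (z * z) - c' * (sg * z + Q')\<^sup>2) * (one + q * p))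
      (j * (dn * (sg' * (z * z) + Q' * z) + nz * (two * sg' * z + Q')) * p' + two * j * nz * (sg' * (z * z) + Q' * z) * y'
        + (M2 * (z * z) - c' * (sg' * z + Q')\<^sup>2) * (one + q' * p'))"
    by (intro exI allI impI) (assumption | rule lipschitz_bounded_intros)+
  then obtain B L where BL: "lipschitz_bounded D Z 0 z z \<longrightarrow> lipschitz_bounded D 1 1 q q' \<longrightarrow> lipschitz_bounded D C 1 sg sg' \<longrightarrow> lipschitz_bounded D C 1 y y' \<longrightarrow>
     lipschitz_bounded D (C * (2 * Z)) (2 * Z) p p' \<longrightarrow> lipschitz_bounded D m0 0 M2 M2 \<longrightarrow> lipschitz_bounded D N 0 nz nz \<longrightarrow> lipschitz_bounded D N 0 dn dn \<longrightarrow>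
     lipschitz_bounded D \<bar>Q\<bar> 0 Q' Q' \<longrightarrow> lipschitz_bounded D \<bar>c2\<bar> 0 c' c' \<longrightarrow> lipschitz_bounded D 2 0 two two \<longrightarrow> lipschitz_bounded D 1 0 one one \<longrightarrow> lipschitz_bounded D 1 0 j j \<longrightarrow>
     lipschitz_bounded D B L (j * (dn * (sg * (z * z) + Q' * z) + nz * (two * sg * z + Q')) * p + two * j * nz * (sg * (z * z) + Q' * z) * y
        + (M2 * (z * z) - c' * (sg * z + Q')\<^sup>2) * (one + q * p))
      (j * (dn * (sg' * (z * z) + Q' * z) + nz * (two * sg' * z + Q')) * p' + two * j * nz * (sg' * (z * z) + Q' * z) * y'
        + (M2 * (z * z) - c' * (sg' * z + Q')\<^sup>2) * (one + q' * p'))"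
     for D z q q' sg sg' y y' p p' M2 nz dn Q' c' two one j by blast
  show thesis
  proof (rule that[of "\<bar>B\<bar>" "\<bar>L\<bar>"])
    fix q q' M2 :: real and sg sg' y y' D z
    assume q: "\<bar>q\<bar> \<le> 1" "\<bar>q'\<bar> \<le> 1" "\<bar>q - q'\<bar> \<le> D" and M2: "0 \<le> M2" "M2 \<le> m0"
      and d: "dom C sg y" "dom C sg' y'" "near D sg y sg' y'" "z \<in> U"
    have D: "D \<ge> 0" using q(3) by linarith
    have "norm (of_real q - of_real q' :: complex) \<le> D" using q(3) by (metis norm_of_real of_real_diff)
    with q have lq: "lipschitz_bounded D 1 1 (of_real q) (of_real q')" by (simp add: lipschitz_bounded_def)
    have "lipschitz_bounded D C 1 sg sg'" "lipschitz_bounded D C 1 (y z) (y' z)" using d by (auto simp: lipschitz_bounded_def dom_def near_def)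
    then have "lipschitz_bounded D B L (h q M2 sg y z) (h q' M2 sg' y' z)"
      unfolding h_def dne_def e_def using BL lipschitz_bounded_prim[OF d] lq Z[OF d(4)] N[OF d(4)] M2
      by (simp add: lipschitz_bounded_const)
    then show "lipschitz_bounded D \<bar>B\<bar> \<bar>L\<bar> (h q M2 sg y z) (h q' M2 sg' y' z)"
      using D abs_ge_self[of B] mult_right_mono[OF abs_ge_self[of L] D] by (auto simp: lipschitz_bounded_def intro: order_trans)
  qed auto
qed

lemma dne_diff:
  assumes "z \<in> U"
  shows "norm (dne s z - dne s' z) \<le> norm (s - s') * (N * (Z * Z) + N * (2 * Z))"
proof -
  have "dne s z - dne s' z = (s - s') * (deriv n z * (z * z) + n z * (2 * z))"
    by (simp add: dne_def e_def algebra_simps)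
  moreover have "norm (deriv n z * (z * z) + n z * (2 * z)) \<le> N * (Z * Z) + N * (2 * Z)"
    by (intro norm_triangle_mono; subst norm_mult; intro mult_mono)
      (use assms N Z N_nonneg Z_pos in \<open>auto simp: norm_mult intro!: mult_mono\<close>)
  ultimately show ?thesis by (simp add: norm_mult mult_left_mono)
qed

lemma dne_bound:
  assumes "z \<in> U" "norm s \<le> S"
  shows "norm (dne s z) \<le> N * (\<bar>Q\<bar> * Z) + N * \<bar>Q\<bar> + S * (N * (Z * Z) + N * (2 * Z))"
proof -
  have "norm (dne 0 z) \<le> N * (\<bar>Q\<bar> * Z) + N * \<bar>Q\<bar>" unfolding dne_def e_def
    by (intro norm_triangle_mono; subst norm_mult; intro mult_mono)
      (use assms N Z N_nonneg Z_pos in \<open>auto simp: norm_mult intro!: mult_mono\<close>)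
  moreover have "norm (s - 0) * (N * (Z * Z) + N * (2 * Z)) \<le> S * (N * (Z * Z) + N * (2 * Z))"
    using assms(2) N_nonneg Z_pos by (intro mult_right_mono) auto
  ultimately show ?thesis
    using dne_diff[OF assms(1), of s 0] norm_triangle_ineq2[of "dne s z" "dne 0 z"] by linarith
qed

text \<open>The prefactor \<open>\<bar>q\<bar>\<close> is the source of the contraction: the old
  pair enters the new frequency only through \<open>q * h\<close>.\<close>

lemma nsg_diff:
  assumes "y holomorphic_on U" "y' holomorphic_on U"
    and "\<And>z. z \<in> U \<Longrightarrow> norm (h q M2 sg y z - h q M2 sg' y' z) \<le> E"
  shows "norm (nsg q M2 sg y - nsg q M2 sg' y') \<le> \<bar>q\<bar> * (E * (2 * Z) / (a\<^sup>2 + b\<^sup>2))"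
proof -
  have "nsg q M2 sg y - nsg q M2 sg' y' =
      - \<i> * of_real q * (prim (h q M2 sg y) b - prim (h q M2 sg' y') b) / of_real (a\<^sup>2 + b\<^sup>2)"
    by (simp add: nsg_def diff_divide_distrib algebra_simps del: of_real_add of_real_power)
  also have "prim (h q M2 sg y) b - prim (h q M2 sg' y') b = prim (\<lambda>z. h q M2 sg y z - h q M2 sg' y' z) b"
    by (rule prim_diff[symmetric]) (intro h_holomorphic assms ab)+
  finally have "norm (nsg q M2 sg y - nsg q M2 sg' y') =
      \<bar>q\<bar> * norm (prim (\<lambda>z. h q M2 sg y z - h q M2 sg' y' z) b) / (a\<^sup>2 + b\<^sup>2)"
    using R_pos by (simp add: norm_mult norm_divide del: of_real_add of_real_power)
  moreover have "norm (prim (\<lambda>z. h q M2 sg y z - h q M2 sg' y' z) b) \<le> E * (2 * Z)"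
    by (rule prim_bound_uniform) (use assms ab in \<open>auto intro!: holomorphic_intros h_holomorphic\<close>)
  ultimately show ?thesis using R_pos by (simp add: mult_left_mono divide_right_mono)
qed

lemma nsg_bound:
  assumes "y holomorphic_on U" "\<And>z. z \<in> U \<Longrightarrow> norm (h q M2 sg y z) \<le> E"
  shows "norm (nsg q M2 sg y - nsg 0 0 0 (\<lambda>_. 0)) \<le> \<bar>q\<bar> * (E * (2 * Z) / (a\<^sup>2 + b\<^sup>2))"
proof -
  have "nsg q M2 sg y - nsg 0 0 0 (\<lambda>_. 0) = - \<i> * of_real q * prim (h q M2 sg y) b / of_real (a\<^sup>2 + b\<^sup>2)"
    by (simp add: nsg_def diff_divide_distrib algebra_simps del: of_real_add of_real_power)
  then have "norm (nsg q M2 sg y - nsg 0 0 0 (\<lambda>_. 0)) = \<bar>q\<bar> * norm (prim (h q M2 sg y) b) / (a\<^sup>2 + b\<^sup>2)"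
    using R_pos by (simp add: norm_mult norm_divide del: of_real_add of_real_power)
  moreover have "norm (prim (h q M2 sg y) b) \<le> E * (2 * Z)"
    by (rule prim_bound_uniform) (use assms ab in \<open>auto intro!: holomorphic_intros h_holomorphic\<close>)
  ultimately show ?thesis using R_pos by (simp add: mult_left_mono divide_right_mono)
qed

text \<open>A Lipschitz constant of \<open>dne\<close> in the frequency, by
  \<open>dne_diff\<close>.\<close>

definition dq :: real where "dq = N * (Z * Z) + N * (2 * Z)"

lemma dq_nonneg: "dq \<ge> 0" using N_nonneg Z_pos by (simp add: dq_def)

text \<open>At \<open>q = 0\<close> one step of the iteration returns \<open>sg1\<close> and
  \<open>y1\<close> from any starting pair; they are the leading-order solution.\<close>

definition sg1 :: complex where "sg1 = nsg 0 0 0 (\<lambda>_. 0)"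

definition y1 :: "complex \<Rightarrow> complex" where "y1 = quot (\<lambda>z. \<i> * dne sg1 z)"

lemma sg1_eq: "sg1 = - of_real (Q * (a + b) / (a\<^sup>2 + b\<^sup>2))"
  by (simp add: sg1_def nsg_def)

lemma nsg_0: "nsg 0 M2 sg y = sg1" by (simp add: sg1_def nsg_def)

lemma src_0: "src 0 M2 sg y = (\<lambda>z. \<i> * dne sg1 z)" by (rule ext) (simp add: src_def nsg_0)

lemma src_bound:
  assumes "norm (nsg q M2 sg y) \<le> S" "z \<in> U" "norm (h q M2 sg y z) \<le> E"
  shows "norm (src q M2 sg y z) \<le> N * (\<bar>Q\<bar> * Z) + N * \<bar>Q\<bar> + S * dq + \<bar>q\<bar> * E"
  unfolding src_def dq_def
  by (rule norm_triangle_mono) (use dne_bound[OF assms(2,1)] assms(3) in \<open>simp_all add: norm_mult mult_left_mono\<close>)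

text \<open>For small \<open>q\<close> the map sends the ball \<open>dom C\<close> into itself and
  halves distances. The last clause serves the imaginary part of the frequency:
  \<open>prim h b\<close> enters \<open>nsg\<close> with a further factor \<open>q\<close>, so its
  value at \<open>q = 0\<close> decides the sign as soon as the error is linear in
  \<open>q\<close>.\<close>

theorem fixed_point:
  "\<exists>C q0 K. q0 > 0 \<and> q0 \<le> 1 \<and> (\<forall>q M2. \<bar>q\<bar> < q0 \<and> 0 \<le> M2 \<and> M2 \<le> m0 \<longrightarrow>
     (\<exists>sg y. dom C sg y \<and> nsg q M2 sg y = sg \<and> (\<forall>z\<in>U. quot (src q M2 sg y) z = y z) \<and>
       norm (prim (h q M2 sg y) b - prim (h 0 M2 sg1 y1) b) \<le> K * \<bar>q\<bar>))"
proof -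
  \<comment> \<open>\<open>S\<close> lets the frequency move by 1 from \<open>sg1\<close>,
    \<open>G\<close> lets the term \<open>q * h\<close> contribute 1, and \<open>G / k\<close> is
    the resulting bound on the new profile. The constants of \<open>h_lip\<close> depend on
    \<open>C\<close>, so \<open>C\<close> is fixed before \<open>q\<close> is restricted.\<close>
  define S where "S = norm sg1 + 1"
  define G where "G = N * (\<bar>Q\<bar> * Z) + N * \<bar>Q\<bar> + S * dq + 1"
  define C where "C = max S (G / k)"
  have S: "S \<ge> 0" "norm sg1 \<le> S" by (simp_all add: S_def)
  have G: "G \<ge> 0" using N_nonneg Z_pos S dq_nonneg by (simp add: G_def)
  have C: "C \<ge> 0" "S \<le> C" "G / k \<le> C" using S(1) by (auto simp: C_def)
  obtain B L where BL: "B \<ge> 0" "L \<ge> 0"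
    and lip: "\<And>q q' M2 sg sg' y y' D z. \<lbrakk>\<bar>q\<bar> \<le> 1; \<bar>q'\<bar> \<le> 1; \<bar>q - q'\<bar> \<le> D; 0 \<le> M2; M2 \<le> m0; dom C sg y; dom C sg' y';
        near D sg y sg' y'; z \<in> U\<rbrakk> \<Longrightarrow> lipschitz_bounded D B L (h q M2 sg y z) (h q' M2 sg' y' z)"
    using h_lip[of C] by metis
  define B' where "B' = B * (2 * Z) / (a\<^sup>2 + b\<^sup>2)"
  define L' where "L' = L * (2 * Z) / (a\<^sup>2 + b\<^sup>2)"
  \<comment> \<open>\<open>kap\<close> is the Lipschitz constant of one step divided by
    \<open>\<bar>q\<bar>\<close>, with \<open>L'\<close> from the frequency and the quotient from
    the profile. In the same way \<open>K1 - 1\<close> measures the distance of the result from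
    \<open>sg1\<close>, \<open>y1\<close>; the extra 1 in \<open>K1\<close> ensures
    \<open>\<bar>q\<bar> \<le> \<bar>q\<bar> * K1\<close>, needed when \<open>lip\<close> compares
    \<open>q\<close> with 0.\<close>
  define kap where "kap = L' + (L' * dq + L) / k"
  define K1 where "K1 = 1 + B' + (B' * dq + B) / k"
  \<comment> \<open>This makes \<open>\<bar>q\<bar> * B\<close> and
    \<open>\<bar>q\<bar> * B'\<close> at most 1 and \<open>\<bar>q\<bar> * kap\<close> at most
    1/2.\<close>
  define q0 where "q0 = 1 / (2 * (1 + B + B' + kap))"
  have nn: "B' \<ge> 0" "L' \<ge> 0" using BL Z_pos R_pos by (simp_all add: B'_def L'_def)
  then have kap: "kap \<ge> 0" using BL dq_nonneg k(1) by (simp add: kap_def)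
  have q0: "q0 > 0" "q0 \<le> 1" using BL nn kap by (auto simp: q0_def field_simps)
  have hb: "norm (h q M2 sg y z) \<le> B" if "\<bar>q\<bar> < q0" "0 \<le> M2" "M2 \<le> m0" "dom C sg y" "z \<in> U" for q M2 sg y z
    using lip[of q q 0 M2 sg y sg y z] that q0 by (auto simp: lipschitz_bounded_def near_def)
  have srcb: "norm (src q M2 sg y z) \<le> G"
    if "\<bar>q\<bar> * B \<le> 1" "norm (nsg q M2 sg y) \<le> S" "z \<in> U" "norm (h q M2 sg y z) \<le> B" for q M2 sg y z
    using src_bound[OF that(2-4)] that(1) by (simp add: G_def)
  have dom1: "dom C sg1 y1"
  proof -
    have "norm (src 0 0 0 (\<lambda>_. 0) z) \<le> N * (\<bar>Q\<bar> * Z) + N * \<bar>Q\<bar> + S * dq + \<bar>0\<bar> * norm (h 0 0 0 (\<lambda>_. 0) z)" if "z \<in> U" for z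
      using that S by (intro src_bound) (auto simp: nsg_0)
    then have "norm (src 0 0 0 (\<lambda>_. 0) z) \<le> G" if "z \<in> U" for z
      using that by (simp add: G_def) (smt (verit))
    then have b: "norm (\<i> * dne sg1 z) \<le> G" if "z \<in> U" for z using that by (simp add: src_0)
    have hol: "(\<lambda>z. \<i> * dne sg1 z) holomorphic_on U" by (intro holomorphic_intros dne_holomorphic)
    have mean: "prim (\<lambda>z. \<i> * dne sg1 z) b = 0" using prim_src_b[of "\<lambda>_. 0" 0 0 0] by (simp add: src_0)
    note * = quot_props[OF hol b mean]
    show ?thesis unfolding dom_def y1_def
      using *(1,2) C S by (auto intro: order_trans)
  qed
  show ?thesis
  proof (rule exI[of _ C], rule exI[of _ q0], rule exI[of _ "L * K1 * (2 * Z)"], intro conjI allI impI q0)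
    fix q M2 :: real assume "\<bar>q\<bar> < q0 \<and> 0 \<le> M2 \<and> M2 \<le> m0"
    then have q: "\<bar>q\<bar> < q0" and M2: "0 \<le> M2" "M2 \<le> m0" by simp_all
    have q1: "\<bar>q\<bar> \<le> 1" using q q0 by linarith
    have "\<bar>q\<bar> * (2 * (1 + B + B' + kap)) \<le> q0 * (2 * (1 + B + B' + kap))"
      using q BL nn kap by (intro mult_right_mono) auto
    also have "\<dots> = 1" using BL nn kap by (simp add: q0_def add_pos_nonneg field_simps)
    finally have "\<bar>q\<bar> + \<bar>q\<bar> * B + \<bar>q\<bar> * B' + \<bar>q\<bar> * kap \<le> 1 / 2" by (simp add: algebra_simps)
    moreover have "\<bar>q\<bar> * B \<ge> 0" "\<bar>q\<bar> * B' \<ge> 0" "\<bar>q\<bar> * kap \<ge> 0" using BL nn kap by simp_all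
    ultimately have qs: "\<bar>q\<bar> * B \<le> 1" "\<bar>q\<bar> * B' \<le> 1" "\<bar>q\<bar> * kap \<le> 1 / 2" using abs_ge_zero[of q] by linarith+
    let ?Y = "\<lambda>sg y. quot (src q M2 sg y)"
    have step_dom: "dom C (nsg q M2 sg y) (?Y sg y)" "near (\<bar>q\<bar> * (K1 - 1)) (nsg q M2 sg y) (?Y sg y) sg1 y1"
      if d: "dom C sg y" for sg y
    proof -
      have hol: "y holomorphic_on U" using d by (simp add: dom_def)
      have hb': "\<And>z. z \<in> U \<Longrightarrow> norm (h q M2 sg y z) \<le> B" using hb[OF q M2 d] .
      have n1: "norm (nsg q M2 sg y - sg1) \<le> \<bar>q\<bar> * B'"
        unfolding sg1_def B'_def by (rule nsg_bound[OF hol hb'])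
      then have nS: "norm (nsg q M2 sg y) \<le> S"
        using norm_triangle_ineq2[of "nsg q M2 sg y" sg1] qs(2) by (simp add: S_def)
      have sG: "norm (src q M2 sg y z) \<le> G" if "z \<in> U" for z
        using srcb[OF qs(1) nS that hb'[OF that]] .
      note * = quot_props[OF src_holomorphic[OF hol] sG prim_src_b[OF hol]]
      show "dom C (nsg q M2 sg y) (?Y sg y)"
        using *(1,2) C nS by (auto simp: dom_def intro: order_trans)
      have hol1: "(\<lambda>z. \<i> * dne sg1 z) holomorphic_on U" by (intro holomorphic_intros dne_holomorphic)
      have mean1: "prim (\<lambda>z. \<i> * dne sg1 z) b = 0" using prim_src_b[of "\<lambda>_. 0" 0 0 0] by (simp add: src_0)
      have "norm (?Y sg y z - y1 z) \<le> (\<bar>q\<bar> * (B' * dq + B)) / k" if "z \<in> U" for z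
        unfolding y1_def quot_diff[OF src_holomorphic[OF hol] hol1 that]
      proof (rule quot_props(2)[OF _ _ _ that])
        show "prim (\<lambda>z. src q M2 sg y z - \<i> * dne sg1 z) b = 0"
          using prim_diff[OF src_holomorphic[OF hol] hol1 ab(4)] prim_src_b[OF hol] mean1 by simp
        show "(\<lambda>z. src q M2 sg y z - \<i> * dne sg1 z) holomorphic_on U"
          by (intro holomorphic_intros src_holomorphic hol dne_holomorphic)
        fix z assume z: "z \<in> U"
        have "src q M2 sg y z - \<i> * dne sg1 z = \<i> * (dne (nsg q M2 sg y) z - dne sg1 z) + of_real q * h q M2 sg y z"
          by (simp add: src_def algebra_simps)
        also have "norm \<dots> \<le> (\<bar>q\<bar> * B') * dq + \<bar>q\<bar> * B"
          using dne_diff[OF z, of "nsg q M2 sg y" sg1] mult_right_mono[OF n1 dq_nonneg] hb'[OF z]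
          by (intro norm_triangle_mono) (auto simp: norm_mult dq_def intro!: mult_left_mono)
        finally show "norm (src q M2 sg y z - \<i> * dne sg1 z) \<le> \<bar>q\<bar> * (B' * dq + B)" by (simp add: algebra_simps)
      qed
      moreover have "\<bar>q\<bar> * B' \<le> \<bar>q\<bar> * (K1 - 1)" "(\<bar>q\<bar> * (B' * dq + B)) / k \<le> \<bar>q\<bar> * (K1 - 1)"
        using BL nn dq_nonneg k(1) by (auto simp: K1_def algebra_simps)
      ultimately show "near (\<bar>q\<bar> * (K1 - 1)) (nsg q M2 sg y) (?Y sg y) sg1 y1"
        using n1 unfolding near_def by (meson order_trans)
    qed
    have step_near: "near (D / 2) (nsg q M2 sg y) (?Y sg y) (nsg q M2 sg' y') (?Y sg' y')"
      if d: "dom C sg y" "dom C sg' y'" and nr: "near D sg y sg' y'" for sg y sg' y' D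
    proof -
      have hol: "y holomorphic_on U" "y' holomorphic_on U" using d by (simp_all add: dom_def)
      have D: "D \<ge> 0" using nr norm_ge_zero order_trans unfolding near_def by blast
      have hd: "norm (h q M2 sg y z - h q M2 sg' y' z) \<le> L * D" if "z \<in> U" for z
        using lip[OF q1 q1 _ M2 d nr that] D by (simp add: lipschitz_bounded_def)
      have n1: "norm (nsg q M2 sg y - nsg q M2 sg' y') \<le> \<bar>q\<bar> * (L' * D)"
        using nsg_diff[OF hol hd] by (simp add: L'_def mult_ac)
      have Yd: "norm (?Y sg y z - ?Y sg' y' z) \<le> (\<bar>q\<bar> * ((L' * dq + L) * D)) / k" if "z \<in> U" for z
        unfolding quot_diff[OF src_holomorphic[OF hol(1)] src_holomorphic[OF hol(2)] that]
      proof (rule quot_props(2)[OF _ _ _ that])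
        show "prim (\<lambda>z. src q M2 sg y z - src q M2 sg' y' z) b = 0"
          using prim_diff[OF src_holomorphic[OF hol(1)] src_holomorphic[OF hol(2)] ab(4)]
            prim_src_b[OF hol(1)] prim_src_b[OF hol(2)] by simp
        show "(\<lambda>z. src q M2 sg y z - src q M2 sg' y' z) holomorphic_on U"
          by (intro holomorphic_intros src_holomorphic hol)
        fix z assume z: "z \<in> U"
        have "src q M2 sg y z - src q M2 sg' y' z = \<i> * (dne (nsg q M2 sg y) z - dne (nsg q M2 sg' y') z)
            + of_real q * (h q M2 sg y z - h q M2 sg' y' z)"
          by (simp add: src_def algebra_simps)
        also have "norm \<dots> \<le> (\<bar>q\<bar> * (L' * D)) * dq + \<bar>q\<bar> * (L * D)"
          using dne_diff[OF z, of "nsg q M2 sg y" "nsg q M2 sg' y'"] mult_right_mono[OF n1 dq_nonneg] hd[OF z]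
          by (intro norm_triangle_mono) (auto simp: norm_mult dq_def intro!: mult_left_mono)
        finally show "norm (src q M2 sg y z - src q M2 sg' y' z) \<le> \<bar>q\<bar> * ((L' * dq + L) * D)"
          by (simp add: algebra_simps)
      qed
      have "(\<bar>q\<bar> * kap) * D \<le> 1 / 2 * D" using qs(3) D by (rule mult_right_mono)
      moreover have "(\<bar>q\<bar> * kap) * D = \<bar>q\<bar> * (L' * D) + (\<bar>q\<bar> * ((L' * dq + L) * D)) / k"
        by (simp add: kap_def algebra_simps)
      moreover have "0 \<le> \<bar>q\<bar> * (L' * D)" "0 \<le> (\<bar>q\<bar> * ((L' * dq + L) * D)) / k"
        using BL nn dq_nonneg k(1) D by simp_all
      ultimately have "\<bar>q\<bar> * (L' * D) \<le> D / 2" "(\<bar>q\<bar> * ((L' * dq + L) * D)) / k \<le> D / 2"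
        by linarith+
      with Yd n1 show ?thesis
        unfolding near_def by (meson order_trans)
    qed
    define X where "X = rec_nat (0, \<lambda>_. 0) (\<lambda>_ (sg, y). (nsg q M2 sg y, ?Y sg y))"
    have X0: "X 0 = (0, \<lambda>_. 0)" and XS: "X (Suc j) = (nsg q M2 (fst (X j)) (snd (X j)), ?Y (fst (X j)) (snd (X j)))" for j
      by (simp_all add: X_def case_prod_beta)
    have Xd: "dom C (fst (X j)) (snd (X j))" for j
      by (induction j) (use C step_dom(1) in \<open>auto simp: X0 XS dom_def\<close>)
    have Xn: "near (C * (1/2) ^ j) (fst (X (Suc j))) (snd (X (Suc j))) (fst (X j)) (snd (X j))" for j
    proof (induction j)
      case 0 show ?case using Xd[of 1] by (simp add: near_def dom_def X0)
    next
      case (Suc j)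
      show ?case using step_near[OF Xd Xd Suc] by (simp add: XS)
    qed
    obtain y where y: "uniform_limit U (\<lambda>j. snd (X j)) y sequentially"
      using geometric_uniform_limit[of U "\<lambda>j. snd (X j)" C] Xn unfolding near_def by metis
    \<comment> \<open>The sequence of frequencies is read as functions on a one-point set, so that
      the same limit lemma applies.\<close>
    obtain l where l: "uniform_limit (UNIV :: unit set) (\<lambda>j _. fst (X j)) l sequentially"
      using geometric_uniform_limit[of UNIV "\<lambda>j _. fst (X j)" C] Xn unfolding near_def by metis
    define sg where "sg = l ()"
    have ev: "\<forall>\<^sub>F j in sequentially. near \<epsilon> (fst (X j)) (snd (X j)) sg y" if "\<epsilon> > 0" for \<epsilon>
      using uniform_limitD[OF y that] uniform_limitD[OF l that]
    proof eventually_elim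
      case (elim j)
      then show ?case by (auto simp: near_def sg_def dist_norm intro: less_imp_le)
    qed
    have "y holomorphic_on U"
    proof (rule holomorphic_uniform_sequence[OF U(1)])
      show "snd (X j) holomorphic_on U" for j using Xd[of j] by (simp add: dom_def)
      show "\<exists>d>0. cball x d \<subseteq> U \<and> uniform_limit (cball x d) (\<lambda>j. snd (X j)) y sequentially" if "x \<in> U" for x
        using U(1) that uniform_limit_on_subset[OF y] by (meson open_contains_cball)
    qed
    moreover have "norm sg \<le> C \<and> (\<forall>z\<in>U. norm (y z) \<le> C)"
    proof -
      have "norm sg \<le> C + \<epsilon> \<and> (\<forall>z\<in>U. norm (y z) \<le> C + \<epsilon>)" if eps: "\<epsilon> > 0" for \<epsilon>
      proof -
        obtain j where "near \<epsilon> (fst (X j)) (snd (X j)) sg y"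
          using eventually_happens'[OF sequentially_bot ev[OF eps]] by blast
        then have j: "norm (fst (X j) - sg) \<le> \<epsilon>" "\<And>z. z \<in> U \<Longrightarrow> norm (snd (X j) z - y z) \<le> \<epsilon>"
          by (auto simp: near_def)
        have X: "norm (fst (X j)) \<le> C" "\<And>z. z \<in> U \<Longrightarrow> norm (snd (X j) z) \<le> C" using Xd[of j] by (auto simp: dom_def)
        have "norm v \<le> C + \<epsilon>" if "norm x \<le> C" "norm (x - v) \<le> \<epsilon>" for x v :: complex
          using that norm_triangle_sub[of v x] by (simp add: norm_minus_commute)
        then show ?thesis using j X by blast
      qed
      then show ?thesis by (meson field_le_epsilon)
    qed
    ultimately have d: "dom C sg y" by (simp add: dom_def)
    \<comment> \<open>An iterate close to the limit has its image close to the image of the limit;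
      that image is the next iterate, itself close to the limit.\<close>
    have near2: "near (2 * \<epsilon>) sg y (nsg q M2 sg y) (?Y sg y)" if eps: "\<epsilon> > 0" for \<epsilon>
    proof -
      have "\<forall>\<^sub>F j in sequentially. near \<epsilon> (fst (X (Suc j))) (snd (X (Suc j))) sg y"
        using ev[OF eps] by (subst eventually_sequentially_Suc)
      then obtain j where j: "near \<epsilon> (fst (X j)) (snd (X j)) sg y" "near \<epsilon> (fst (X (Suc j))) (snd (X (Suc j))) sg y"
        using eventually_happens'[OF sequentially_bot eventually_conj[OF ev[OF eps]]] by blast
      have *: "norm (u - w) \<le> 2 * \<epsilon>" if "norm (v - u) \<le> \<epsilon>" "norm (v - w) \<le> \<epsilon> / 2" for u v w :: complex
        using norm_triangle_ineq4[of "v - w" "v - u"] that \<open>\<epsilon> > 0\<close> by simp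
      show ?thesis using step_near[OF Xd d j(1)] j(2) unfolding near_def XS fst_conv snd_conv
        using * by blast
    qed
    have zero: "u = w" if "\<And>\<epsilon>. \<epsilon> > 0 \<Longrightarrow> norm (u - w) \<le> 2 * \<epsilon>" for u w :: complex
      using that[of "norm (u - w) / 4"] by (cases "u = w") auto
    have fix1: "nsg q M2 sg y = sg" using zero[of sg "nsg q M2 sg y"] near2 by (auto simp: near_def)
    have fix2: "?Y sg y z = y z" if "z \<in> U" for z
      using zero[of "y z" "?Y sg y z"] near2 that unfolding near_def by metis
    have "near (\<bar>q\<bar> * K1) sg y sg1 y1"
      using step_dom(2)[OF d] fix1 fix2 by (auto simp: near_def algebra_simps intro: order_trans)
    moreover have "\<bar>q - 0\<bar> \<le> \<bar>q\<bar> * K1"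
      using BL nn dq_nonneg k(1) by (simp add: K1_def algebra_simps)
    ultimately have "norm (h q M2 sg y z - h 0 M2 sg1 y1 z) \<le> L * (\<bar>q\<bar> * K1)" if "z \<in> U" for z
      using lip[OF q1 _ _ M2 d dom1 _ that] by (simp add: lipschitz_bounded_def)
    then have "norm (prim (\<lambda>z. h q M2 sg y z - h 0 M2 sg1 y1 z) b) \<le> L * (\<bar>q\<bar> * K1) * (2 * Z)"
      using d dom1 ab by (intro prim_bound_uniform) (auto simp: dom_def intro!: holomorphic_intros h_holomorphic)
    then have "norm (prim (h q M2 sg y) b - prim (h 0 M2 sg1 y1) b) \<le> (L * K1 * (2 * Z)) * \<bar>q\<bar>"
      using d dom1 ab by (subst prim_diff[symmetric]) (auto simp: dom_def mult_ac intro!: h_holomorphic)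
    then show "\<exists>sg y. dom C sg y \<and> nsg q M2 sg y = sg \<and> (\<forall>z\<in>U. quot (src q M2 sg y) z = y z) \<and>
       norm (prim (h q M2 sg y) b - prim (h 0 M2 sg1 y1) b) \<le> (L * K1 * (2 * Z)) * \<bar>q\<bar>"
      using d fix1 fix2 by blast
  qed
qed

section \<open>The coefficient of second order\<close>

lemma y1_props: "y1 holomorphic_on U" "\<And>z. z \<in> U \<Longrightarrow> A z * y1 z = \<i> * (n z * e sg1 z - e sg1 a)"
proof -
  have hol: "(\<lambda>z. \<i> * dne sg1 z) holomorphic_on U" by (intro holomorphic_intros dne_holomorphic)
  have mean: "prim (\<lambda>z. \<i> * dne sg1 z) b = 0" using prim_src_b[of "\<lambda>_. 0" 0 0 0] by (simp add: src_0)
  have bd: "norm (\<i> * dne sg1 z) \<le> N * (\<bar>Q\<bar> * Z) + N * \<bar>Q\<bar> + norm sg1 * (N * (Z * Z) + N * (2 * Z))" if "z \<in> U" for z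
    using dne_bound[OF that order_refl] by (simp add: norm_mult)
  note * = quot_props[OF hol bd mean, folded y1_def]
  show "y1 holomorphic_on U" by (rule *(1))
  show "A z * y1 z = \<i> * (n z * e sg1 z - e sg1 a)" if "z \<in> U" for z
    using *(3)[of z] that prim_linear[OF dne_holomorphic dne_holomorphic that, of \<i> sg1 0 sg1] prim_dne[OF that]
    by simp
qed

text \<open>The solvability condition at leading order: \<open>n * e sg1\<close> takes the same
  value at both horizons.\<close>

lemma e_sg1_b: "e sg1 b = - e sg1 a"
proof -
  have "sg1 * of_real (a\<^sup>2 + b\<^sup>2) = - of_real (Q * (a + b))"
    unfolding sg1_eq mult_minus_left of_real_mult[symmetric] using R_pos by simp
  then show ?thesis by (simp add: e_def power2_eq_square algebra_simps add_eq_0_iff)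
qed

text \<open>The terms of \<open>h\<close> with \<open>prim y1\<close> are removed by an integration by parts; then \<open>n\<^sup>2 z\<^sup>2 = z\<^sup>2 - c2 A\<close> cancels
  the contribution of \<open>c2\<close>.\<close>

lemma prim_h1:
  assumes nA: "\<And>z. z \<in> U \<Longrightarrow> (n z)\<^sup>2 * z\<^sup>2 = z\<^sup>2 - of_real c2 * A z"
    and rho: "\<And>x. a < x \<Longrightarrow> x < b \<Longrightarrow> of_real (rho x) * A x = (e sg1 x)\<^sup>2 - (e sg1 a)\<^sup>2"
    and J: "(rho has_integral J) {a..b}"
  shows "prim (h 0 M2 sg1 y1) b = of_real (M2 * ((b^3 - a^3) / 3) - J)"
proof -
  define kap where "kap = e sg1 a"
  define g2 where "g2 z = \<i> * (n z * e sg1 z + kap) * y1 z + of_real M2 * (z * z) - of_real c2 * (sg1 * z + of_real Q)\<^sup>2" for z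
  \<comment> \<open>Subtracting the constant \<open>kap\<close> makes \<open>Phi\<close> vanish at
    \<open>b\<close> as well, because \<open>n b * e sg1 b = kap\<close>. The correction reappears
    in \<open>g2\<close> as the sum \<open>n * e + kap\<close>.\<close>
  define Phi where "Phi z = \<i> * (n z * e sg1 z) * prim y1 z - \<i> * kap * prim y1 z" for z
  note hol = y1_props(1)
  have e_hol: "e sg1 holomorphic_on U" unfolding e_def[abs_def] by (intro holomorphic_intros)
  have g2_hol: "g2 holomorphic_on U" unfolding g2_def[abs_def]
    by (intro holomorphic_intros n hol e_hol)
  have "((\<lambda>z. Phi z + prim g2 z) has_field_derivative h 0 M2 sg1 y1 z) (at z)" if "z \<in> U" for z
    unfolding Phi_def
    by (rule derivative_eq_intros refl ne_deriv that prim_deriv hol g2_hol)+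
      (simp add: h_def g2_def algebra_simps)
  then have "prim (h 0 M2 sg1 y1) b = Phi b + prim g2 b - (Phi a + prim g2 a)"
    by (rule prim_unique) (simp_all add: ab)
  also have "\<dots> = prim g2 b" using e_sg1_b n(3) by (simp add: Phi_def kap_def)
  finally have 1: "prim (h 0 M2 sg1 y1) b = prim g2 b" .
  have "(g2 has_contour_integral prim g2 b) (linepath (of_real a) (of_real b))"
    unfolding prim_def by (rule has_contour_integral_integral) (rule integrable_seg[OF g2_hol ab(3,4)])
  then have i1: "((\<lambda>x. g2 (of_real x)) has_integral prim g2 b) {a..b}"
    using ab by (subst (asm) has_contour_integral_linepath_Reals_iff) auto
  have "((\<lambda>x. M2 * x\<^sup>2) has_integral (M2 * b^3 / 3 - M2 * a^3 / 3)) {a..b}"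
    using ab by (intro fundamental_theorem_of_calculus)
      (auto intro!: derivative_eq_intros simp: has_real_derivative_iff_has_vector_derivative[symmetric] power2_eq_square)
  from has_integral_diff[OF this J]
  have "((\<lambda>x. M2 * x\<^sup>2 - rho x) has_integral (M2 * ((b^3 - a^3) / 3) - J)) {a..b}"
    by (simp add: diff_divide_distrib right_diff_distrib)
  then have i2: "((\<lambda>x. complex_of_real (M2 * x\<^sup>2 - rho x)) has_integral of_real (M2 * ((b^3 - a^3) / 3) - J)) {a..b}"
    by (rule has_integral_of_real)
  have eq: "g2 (of_real x) = complex_of_real (M2 * x\<^sup>2 - rho x)" if x: "a < x" "x < b" for x
  proof -
    let ?x = "complex_of_real x"
    have xU: "?x \<in> U"
      using segment_subset[OF ab(3,4)] x by (auto simp: closed_segment_of_real closed_segment_eq_real_ivl)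
    have Anz: "A ?x \<noteq> 0" using A_nz[OF xU] x by simp
    have x0: "?x \<noteq> 0" using x ab by simp
    have ex: "e sg1 ?x = ?x * (sg1 * ?x + of_real Q)" by (simp add: e_def algebra_simps)
    have ex2: "(e sg1 ?x)\<^sup>2 = ?x\<^sup>2 * (sg1 * ?x + of_real Q)\<^sup>2" by (simp only: ex power_mult_distrib)
    \<comment> \<open>As \<open>A * y1\<close> is \<open>\<i> * (n * e - kap)\<close>, multiplying
      by \<open>A\<close> produces a difference of squares, to which \<open>nA\<close>
      applies.\<close>
    have "A ?x * (\<i> * (n ?x * e sg1 ?x + kap) * y1 ?x) = \<i> * (n ?x * e sg1 ?x + kap) * (A ?x * y1 ?x)" by (simp only: mult_ac)
    also have "\<dots> = - ((n ?x)\<^sup>2 * (e sg1 ?x)\<^sup>2 - kap\<^sup>2)"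
      unfolding y1_props(2)[OF xU] kap_def[symmetric] by (simp add: power2_eq_square algebra_simps)
    also have "(n ?x)\<^sup>2 * (e sg1 ?x)\<^sup>2 = ((n ?x)\<^sup>2 * ?x\<^sup>2) * (sg1 * ?x + of_real Q)\<^sup>2"
      by (simp add: ex2)
    also have "\<dots> = (e sg1 ?x)\<^sup>2 - of_real c2 * A ?x * (sg1 * ?x + of_real Q)\<^sup>2"
      unfolding nA[OF xU] by (simp add: ex2 left_diff_distrib)
    also have "- ((e sg1 ?x)\<^sup>2 - of_real c2 * A ?x * (sg1 * ?x + of_real Q)\<^sup>2 - kap\<^sup>2) =
        of_real c2 * A ?x * (sg1 * ?x + of_real Q)\<^sup>2 - ((e sg1 ?x)\<^sup>2 - kap\<^sup>2)" by simp
    also have "(e sg1 ?x)\<^sup>2 - kap\<^sup>2 = of_real (rho x) * A ?x" using rho[OF x] by (simp add: kap_def)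
    finally have "A ?x * (\<i> * (n ?x * e sg1 ?x + kap) * y1 ?x) =
        A ?x * (of_real c2 * (sg1 * ?x + of_real Q)\<^sup>2 - of_real (rho x))"
      by (simp only: algebra_simps)
    then have "\<i> * (n ?x * e sg1 ?x + kap) * y1 ?x = of_real c2 * (sg1 * ?x + of_real Q)\<^sup>2 - of_real (rho x)"
      using Anz by (metis mult_left_cancel)
    then show ?thesis by (simp add: g2_def power2_eq_square)
  qed
  have "((\<lambda>x. complex_of_real (M2 * x\<^sup>2 - rho x)) has_integral prim g2 b) {a..b}"
    by (rule has_integral_spike_finite[OF _ _ i1, of "{a, b}"]) (use eq in \<open>auto simp: less_le\<close>)
  with i2 show ?thesis using 1 has_integral_unique by metis
qed

text \<open>By the formula for \<open>nsg\<close>, \<open>Im sig\<close> is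
  \<open>- q^2 / (a^2 + b^2)\<close> times the real part of \<open>prim h b\<close>. The value of
  that real part at \<open>q = 0\<close> is at most \<open>- J / 2\<close> by the bound on
  \<open>m0\<close>, and the error linear in \<open>q\<close> may use up half of this
  margin.\<close>

theorem growing_solution:
  assumes nA: "\<And>z. z \<in> U \<Longrightarrow> (n z)\<^sup>2 * z\<^sup>2 = z\<^sup>2 - of_real c2 * A z"
    and rho: "\<And>x. a < x \<Longrightarrow> x < b \<Longrightarrow> of_real (rho x) * A x = (e sg1 x)\<^sup>2 - (e sg1 a)\<^sup>2"
    and J: "(rho has_integral J) {a..b}" "J > 0" "m0 * ((b^3 - a^3) / 3) \<le> J / 2"
  shows "\<exists>q0>0. \<exists>c1>0. \<forall>q m. 0 < \<bar>q\<bar> \<and> \<bar>q\<bar> < q0 \<and> m\<^sup>2 \<le> m0 * q\<^sup>2 \<longrightarrow>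
     (\<exists>sig w. Im sig \<ge> c1 * q\<^sup>2 \<and> w holomorphic_on U \<and>
       (\<forall>z\<in>U. Re (w z) \<ge> 1 / 2) \<and>
       (\<forall>z\<in>U. deriv (\<lambda>z. A z * deriv w z) z =
          \<i> * deriv (\<lambda>z. n z * (sig * z\<^sup>2 + of_real (q * Q) * z) * w z) z
          + \<i> * (n z * (sig * z\<^sup>2 + of_real (q * Q) * z)) * deriv w z
          + (of_real (m\<^sup>2) * z\<^sup>2 - of_real c2 * (sig * z + of_real (q * Q))\<^sup>2) * w z))"
proof -
  obtain C q0 K where q0: "q0 > 0" "q0 \<le> 1" and *: "\<forall>q M2. \<bar>q\<bar> < q0 \<and> 0 \<le> M2 \<and> M2 \<le> m0 \<longrightarrow>
     (\<exists>sg y. dom C sg y \<and> nsg q M2 sg y = sg \<and> (\<forall>z\<in>U. quot (src q M2 sg y) z = y z) \<and>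
       norm (prim (h q M2 sg y) b - prim (h 0 M2 sg1 y1) b) \<le> K * \<bar>q\<bar>)"
    using fixed_point by (elim exE conjE)
  \<comment> \<open>The second bound keeps \<open>q * prim y\<close> below 1/2 in norm, so that
    \<open>w\<close> has real part at least 1/2; the third makes the error
    \<open>K * \<bar>q\<bar>\<close> at most \<open>J / 4\<close>. The added 1 keeps the
    denominators positive.\<close>
  define q1 where "q1 = min q0 (min (1 / (4 * \<bar>C\<bar> * Z + 1)) (J / (4 * \<bar>K\<bar> + 1)))"
  define c1 where "c1 = J / (4 * (a\<^sup>2 + b\<^sup>2))"
  have c1: "c1 > 0" using R_pos J by (simp add: c1_def)
  have Cp: "4 * \<bar>C\<bar> * Z + 1 > 0" using Z_pos by (simp add: add_nonneg_pos)
  have Kp: "4 * \<bar>K\<bar> + 1 > 0" by simp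
  have q1: "q1 > 0" using q0 Cp Kp J by (simp add: q1_def)
  show ?thesis
  proof (rule exI[of _ q1], rule conjI[OF q1], rule exI[of _ c1], rule conjI[OF c1], intro allI impI)
    fix q m :: real assume "0 < \<bar>q\<bar> \<and> \<bar>q\<bar> < q1 \<and> m\<^sup>2 \<le> m0 * q\<^sup>2"
    then have q: "0 < \<bar>q\<bar>" "\<bar>q\<bar> < q1" and m: "m\<^sup>2 \<le> m0 * q\<^sup>2" by simp_all
    define M2 where "M2 = m\<^sup>2 / q\<^sup>2"
    have M2: "0 \<le> M2" "M2 \<le> m0" "m\<^sup>2 = q\<^sup>2 * M2" using q m by (simp_all add: M2_def field_simps)
    have qq: "\<bar>q\<bar> < q0" "\<bar>q\<bar> * (4 * \<bar>C\<bar> * Z + 1) \<le> 1" "\<bar>q\<bar> * (4 * \<bar>K\<bar> + 1) \<le> J"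
      using q(2) Cp Kp by (simp_all add: q1_def pos_le_divide_eq[symmetric])
    obtain sg y where d: "dom C sg y" and sg: "nsg q M2 sg y = sg" and y: "\<And>z. z \<in> U \<Longrightarrow> quot (src q M2 sg y) z = y z"
      and K: "norm (prim (h q M2 sg y) b - prim (h 0 M2 sg1 y1) b) \<le> K * \<bar>q\<bar>"
      using *[rule_format, of q M2] qq(1) M2(1,2) by blast
    define sig where "sig = of_real q * sg"
    define w where "w z = 1 + of_real q * prim y z" for z
    have hol: "y holomorphic_on U" using d by (simp add: dom_def)
    have w_hol: "w holomorphic_on U" unfolding w_def[abs_def] by (intro holomorphic_intros prim_holomorphic hol)
    have w': "(w has_field_derivative of_real q * y z) (at z)" if "z \<in> U" for z
      unfolding w_def[abs_def] by (auto intro!: derivative_eq_intros prim_deriv hol that)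
    have Re_w: "Re (w z) \<ge> 1 / 2" if z: "z \<in> U" for z
    proof -
      have "norm (prim y z) \<le> C * (2 * Z)" by (rule prim_bound_uniform[OF hol _ z]) (use d in \<open>simp add: dom_def\<close>)
      also have "\<dots> \<le> \<bar>C\<bar> * (2 * Z)" using Z_pos by (intro mult_right_mono) auto
      finally have "\<bar>q\<bar> * norm (prim y z) \<le> \<bar>q\<bar> * (\<bar>C\<bar> * (2 * Z))" by (rule mult_left_mono) simp
      also have "\<dots> \<le> 1 / 2" using qq(2) by (simp add: algebra_simps)
      finally have "norm (of_real q * prim y z) \<le> 1 / 2" by (simp add: norm_mult)
      then show ?thesis using abs_Re_le_cmod[of "of_real q * prim y z"] by (simp add: w_def)
    qed
    have bdd: "\<exists>B. \<forall>z\<in>U. norm (src q M2 sg y z) \<le> B"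
    proof -
      obtain B L where lip: "\<And>q q' M2 sg sg' y y' D z. \<lbrakk>\<bar>q\<bar> \<le> 1; \<bar>q'\<bar> \<le> 1; \<bar>q - q'\<bar> \<le> D; 0 \<le> M2; M2 \<le> m0; dom C sg y; dom C sg' y';
        near D sg y sg' y'; z \<in> U\<rbrakk> \<Longrightarrow> lipschitz_bounded D B L (h q M2 sg y z) (h q' M2 sg' y' z)"
        using h_lip[of C] by metis
      have "norm (h q M2 sg y z) \<le> B" if "z \<in> U" for z
        using lip[of q q 0 M2 sg y sg y z] qq(1) q0 d M2 that by (simp add: lipschitz_bounded_def near_def)
      then show ?thesis using src_bound[OF order_refl] by blast
    qed
    then obtain B where B: "\<And>z. z \<in> U \<Longrightarrow> norm (src q M2 sg y z) \<le> B" by blast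
    have Ay: "A z * y z = prim (src q M2 sg y) z" if "z \<in> U" for z
      using quot_props(3)[OF src_holomorphic[OF hol] B prim_src_b[OF hol], of z] that y[OF that] by simp
    have ode: "deriv (\<lambda>z. A z * deriv w z) z =
          \<i> * deriv (\<lambda>z. n z * (sig * z\<^sup>2 + of_real (q * Q) * z) * w z) z
          + \<i> * (n z * (sig * z\<^sup>2 + of_real (q * Q) * z)) * deriv w z
          + (of_real (m\<^sup>2) * z\<^sup>2 - of_real c2 * (sig * z + of_real (q * Q))\<^sup>2) * w z" if z: "z \<in> U" for z
    proof -
      have "((\<lambda>z. of_real q * prim (src q M2 sg y) z) has_field_derivative of_real q * src q M2 sg y z) (at z)"
        by (intro derivative_intros DERIV_cmult prim_deriv src_holomorphic hol z)
      then have "((\<lambda>z. A z * deriv w z) has_field_derivative of_real q * src q M2 sg y z) (at z)"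
        by (rule has_field_derivative_transform_within_open[OF _ U(1) z])
          (use Ay DERIV_imp_deriv[OF w'] in \<open>simp add: mult_ac\<close>)
      then have l: "deriv (\<lambda>z. A z * deriv w z) z = of_real q * src q M2 sg y z" by (rule DERIV_imp_deriv)
      have E: "sig * z\<^sup>2 + of_real (q * Q) * z = of_real q * e sg z" for z
        by (simp add: sig_def e_def power2_eq_square algebra_simps)
      have "((\<lambda>z. of_real q * (n z * e sg z) * w z) has_field_derivative
          of_real q * dne sg z * w z + of_real q * y z * (of_real q * (n z * e sg z))) (at z)"
        by (intro DERIV_mult DERIV_cmult ne_deriv w' z)
      then have r: "deriv (\<lambda>z. n z * (sig * z\<^sup>2 + of_real (q * Q) * z) * w z) z =
          of_real q * dne sg z * w z + of_real q * y z * (of_real q * (n z * e sg z))"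
        unfolding E by (intro DERIV_imp_deriv) (simp add: mult_ac)
      have s2: "sig * z + of_real (q * Q) = of_real q * (sg * z + of_real Q)"
        by (simp add: sig_def algebra_simps)
      have m2: "of_real (m\<^sup>2) = (of_real q)\<^sup>2 * complex_of_real M2" unfolding M2(3) by simp
      have ww: "w z = 1 + of_real q * prim y z" by (rule w_def)
      show ?thesis
        unfolding l r unfolding E s2 m2 DERIV_imp_deriv[OF w'[OF z]] src_def sg h_def ww
        by (simp add: power2_eq_square algebra_simps)
    qed
    have "Im sig \<ge> c1 * q\<^sup>2"
    proof -
      let ?R = "a\<^sup>2 + b\<^sup>2" let ?H = "prim (h q M2 sg y) b"
      have "Im (nsg q M2 sg y) = - q * Re ?H / ?R"
        by (simp add: nsg_def Im_divide_of_real del: of_real_add of_real_power)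
      then have "Im sg = - q * Re ?H / ?R" by (simp only: sg)
      then have Im: "Im sig = q\<^sup>2 * (- Re ?H / ?R)" by (simp add: sig_def power2_eq_square)
      have "\<bar>Re ?H - (M2 * ((b^3 - a^3) / 3) - J)\<bar> \<le> K * \<bar>q\<bar>"
      proof -
        have "prim (h 0 M2 sg1 y1) b = of_real (M2 * ((b^3 - a^3) / 3) - J)"
          using nA rho J(1) by (rule prim_h1)
        then have "Re (?H - prim (h 0 M2 sg1 y1) b) = Re ?H - (M2 * ((b^3 - a^3) / 3) - J)"
          by (simp only: minus_complex.simps Re_complex_of_real)
        then show ?thesis
          using K abs_Re_le_cmod[of "?H - prim (h 0 M2 sg1 y1) b"] by linarith
      qed
      moreover have "K * \<bar>q\<bar> \<le> J / 4"
      proof -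
        have "K * \<bar>q\<bar> \<le> \<bar>K\<bar> * \<bar>q\<bar>" by (rule mult_right_mono) auto
        moreover have "4 * (\<bar>K\<bar> * \<bar>q\<bar>) + \<bar>q\<bar> \<le> J" using qq(3) by (simp add: algebra_simps)
        ultimately show ?thesis using q(1) by linarith
      qed
      moreover have "M2 * ((b^3 - a^3) / 3) \<le> m0 * ((b^3 - a^3) / 3)"
        using M2 ab by (intro mult_right_mono) (auto intro!: power_mono)
      ultimately have "J / 4 \<le> - Re ?H" using J(3) by linarith
      then have "c1 \<le> - Re ?H / ?R" using R_pos unfolding c1_def
        by (metis divide_divide_eq_left divide_right_mono less_imp_le)
      then show ?thesis unfolding Im by (metis mult.commute mult_right_mono zero_le_power2)
    qed
    with w_hol Re_w ode show "\<exists>sig w. Im sig \<ge> c1 * q\<^sup>2 \<and> w holomorphic_on U \<and>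
       (\<forall>z\<in>U. Re (w z) \<ge> 1 / 2) \<and>
       (\<forall>z\<in>U. deriv (\<lambda>z. A z * deriv w z) z =
          \<i> * deriv (\<lambda>z. n z * (sig * z\<^sup>2 + of_real (q * Q) * z) * w z) z
          + \<i> * (n z * (sig * z\<^sup>2 + of_real (q * Q) * z)) * deriv w z
          + (of_real (m\<^sup>2) * z\<^sup>2 - of_real c2 * (sig * z + of_real (q * Q))\<^sup>2) * w z)"
      by blast
  qed
qed

end

section \<open>Reduction of \<open>P_hat\<close> to the radial equation\<close>

context radial_shell
begin

lemma radial_mult_cong:
  assumes "\<And>r. a < r \<Longrightarrow> r < b \<Longrightarrow> f r = g (of_real r)" "csupp Y k \<phi>"
  shows "(\<lambda>x. f (norm x) * \<phi> x) = (\<lambda>x. g (of_real (norm x)) * \<phi> x)"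
proof
  fix x show "f (norm x) * \<phi> x = g (of_real (norm x)) * \<phi> x"
    using assms(1)[of "norm x"] csupp_outside[OF assms(2), of x] by (cases "x \<in> Y") (auto simp: shell_def)
qed

text \<open>The factor \<open>z\<close> of \<open>z * w\<close> cancels the \<open>1 / r\<close>,
  and one integration by parts moves the derivative to \<open>w\<close>. This is the gain from
  writing the mode as \<open>r\<close> times a function: it undoes the conjugation by
  \<open>r\<close>.\<close>

lemma ud_weighted_deriv:
  assumes w: "w holomorphic_on U" and g: "g holomorphic_on U" and c: "csupp Y (Suc 0) \<phi>"
  shows "ud (\<lambda>z. z * w z) (\<lambda>x. 1 / of_real (norm x) * radial_deriv (\<lambda>x. g (of_real (norm x)) * \<phi> x) x) = - ud (\<lambda>z. deriv w z * g z) \<phi>"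
proof -
  have cs: "csupp Y (Suc 0) (\<lambda>x. g (of_real (norm x)) * \<phi> x)" by (rule csupp_radial_mult[OF g c])
  have "ud (\<lambda>z. z * w z) (\<lambda>x. 1 / of_real (norm x) * radial_deriv (\<lambda>x. g (of_real (norm x)) * \<phi> x) x) =
      ud (\<lambda>z. z * w z * (1 / z)) (radial_deriv (\<lambda>x. g (of_real (norm x)) * \<phi> x))"
    by (rule ud_mult)
  also have "\<dots> = ud w (radial_deriv (\<lambda>x. g (of_real (norm x)) * \<phi> x))"
    by (rule ud_cong[OF csupp_radial_deriv[OF cs]]) (use U_nonzero in simp)
  also have "\<dots> = - ud (deriv w) (\<lambda>x. g (of_real (norm x)) * \<phi> x)" by (rule ud_ibp[OF w cs])
  finally show ?thesis by (simp only: ud_mult)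
qed

lemma ud_weighted_deriv2:
  assumes w: "w holomorphic_on U" and g: "g holomorphic_on U" and h: "h holomorphic_on U" and c: "csupp Y (Suc 0) \<phi>"
  shows "ud (\<lambda>z. z * w z) (\<lambda>x. 1 / of_real (norm x) * (g (of_real (norm x)) * radial_deriv (\<lambda>x. h (of_real (norm x)) * \<phi> x) x)) =
    - ud (\<lambda>z. deriv (\<lambda>z. w z * g z) z * h z) \<phi>"
proof -
  have cs: "csupp Y (Suc 0) (\<lambda>x. h (of_real (norm x)) * \<phi> x)" by (rule csupp_radial_mult[OF h c])
  have wg: "(\<lambda>z. w z * g z) holomorphic_on U" by (intro holomorphic_intros w g)
  have "ud (\<lambda>z. z * w z) (\<lambda>x. 1 / of_real (norm x) * (g (of_real (norm x)) * radial_deriv (\<lambda>x. h (of_real (norm x)) * \<phi> x) x)) =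
      ud (\<lambda>z. z * w z * (1 / z) * g z) (radial_deriv (\<lambda>x. h (of_real (norm x)) * \<phi> x))"
    unfolding ud_mult[of "\<lambda>z. z * w z" "\<lambda>z. 1 / z"] ud_mult ..
  also have "\<dots> = ud (\<lambda>z. w z * g z) (radial_deriv (\<lambda>x. h (of_real (norm x)) * \<phi> x))"
    by (rule ud_cong[OF csupp_radial_deriv[OF cs]]) (use U_nonzero in simp)
  also have "\<dots> = - ud (deriv (\<lambda>z. w z * g z)) (\<lambda>x. h (of_real (norm x)) * \<phi> x)" by (rule ud_ibp[OF wg cs])
  finally show ?thesis by (simp only: ud_mult)
qed

text \<open>Every term of the operator is moved from the test function to the radial profile; the
  spherical part vanishes and the rest is the radial equation divided by \<open>z\<close>. The
  parameters are left free because the formula serves both the kernel equation and membership in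
  \<open>X_space\<close>.\<close>

lemma P_hat_ud:
  fixes \<sigma> :: complex and s m :: real
  assumes w: "w holomorphic_on U" and n: "n holomorphic_on U" and A: "A holomorphic_on U"
    and nu: "\<And>r. a < r \<Longrightarrow> r < b \<Longrightarrow> complex_of_real (nu M Q \<Lambda> r0 r) = n (of_real r)"
    and mu: "\<And>r. a < r \<Longrightarrow> r < b \<Longrightarrow> complex_of_real (mu M Q \<Lambda> r) * (of_real r)\<^sup>2 = A (of_real r)"
    and \<phi>: "\<phi> \<in> test_functions Y"
  shows "P_hat M Q \<Lambda> r0 \<sigma> s m (ud (\<lambda>z. z * w z)) \<phi> =
    ud (\<lambda>z. (\<i> * deriv (\<lambda>z. n z * (\<sigma> * z\<^sup>2 + of_real s * z) * w z) z
          + \<i> * (n z * (\<sigma> * z\<^sup>2 + of_real s * z)) * deriv w z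
          + (of_real (m\<^sup>2) * z\<^sup>2 - (of_real (c_const M Q \<Lambda> r0))\<^sup>2 * (\<sigma> * z + of_real s)\<^sup>2) * w z
          - deriv (\<lambda>z. A z * deriv w z) z) / z) \<phi>"
proof -
  define c where "c = complex_of_real (c_const M Q \<Lambda> r0)"
  define u where "u = ud (\<lambda>z. z * w z)"
  define E where "E z = n z * (\<sigma> * z\<^sup>2 + of_real s * z)" for z
  define S where "S z = \<sigma> + of_real s * (1 / z)" for z :: complex
  have cs: "csupp Y k \<phi>" for k using \<phi> by (simp add: test_functions_csupp)
  have inv: "(\<lambda>z. 1 / z) holomorphic_on U" "(\<lambda>z. \<i> / z) holomorphic_on U" "(\<lambda>z. 1 / z\<^sup>2) holomorphic_on U"
    by (intro holomorphic_intros; use U_nonzero in simp)+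
  have E: "E holomorphic_on U" unfolding E_def[abs_def] by (intro holomorphic_intros n)
  have S: "S holomorphic_on U" unfolding S_def[abs_def] by (intro holomorphic_intros) (use U_nonzero in simp)
  have dw: "deriv w holomorphic_on U" by (rule holomorphic_deriv[OF w U])
  have wE: "(\<lambda>z. w z * E z) holomorphic_on U" and Aw: "(\<lambda>z. deriv w z * A z) holomorphic_on U"
    by (intro holomorphic_intros w E dw A)+
  have zU: "of_real r \<in> U" "complex_of_real r \<noteq> 0" if "a < r" "r < b" for r
    using sub that U_nonzero[of "of_real r"] by (auto simp: image_subset_iff)
  let ?S = "\<lambda>r. \<sigma> + of_real s * (1 / complex_of_real r)"
  let ?nu = "\<lambda>r. complex_of_real (nu M Q \<Lambda> r0 r)" and ?mu = "\<lambda>r. complex_of_real (mu M Q \<Lambda> r)"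
  \<comment> \<open>Unfolded, the multiplications and transposed derivatives act on the test
    function in reverse order, each \<open>d_r\<close> contributing a sign.\<close>
  have P: "P_hat M Q \<Lambda> r0 \<sigma> s m u \<phi> =
      u (\<lambda>x. (- c\<^sup>2 * (?S (norm x))\<^sup>2) * \<phi> x)
      + - u (\<lambda>x. 1 / of_real (norm x) * radial_deriv (\<lambda>x. (?S (norm x) * (of_real (norm x))\<^sup>2 * ?nu (norm x)) * ((\<i> / of_real (norm x)) * \<phi> x)) x)
      + - u (\<lambda>x. 1 / of_real (norm x) * (((of_real (norm x))\<^sup>2 * ?nu (norm x) * ?S (norm x)) * radial_deriv (\<lambda>x. (\<i> / of_real (norm x)) * \<phi> x) x))
      - u (\<lambda>x. 1 / of_real (norm x) * radial_deriv (\<lambda>x. (?mu (norm x) * (of_real (norm x))\<^sup>2) * radial_deriv (\<lambda>x. 1 / of_real (norm x) * \<phi> x) x) x)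
      - u (sphere_laplacian_fun (\<lambda>x. 1 / (of_real (norm x))\<^sup>2 * \<phi> x))
      + of_real (m\<^sup>2) * u \<phi>"
    unfolding P_hat_def Let_def c_def[symmetric] mult_op_def d_r_def sphere_laplacian_def o_def by simp
  have t1: "u (\<lambda>x. (- c\<^sup>2 * (?S (norm x))\<^sup>2) * \<phi> x) = ud (\<lambda>z. z * w z * (- c\<^sup>2 * (S z)\<^sup>2)) \<phi>"
    unfolding u_def using ud_mult[of "\<lambda>z. z * w z" "\<lambda>z. - c\<^sup>2 * (S z)\<^sup>2" \<phi>] by (simp only: S_def)
  have t2: "u (\<lambda>x. 1 / of_real (norm x) * radial_deriv (\<lambda>x. (?S (norm x) * (of_real (norm x))\<^sup>2 * ?nu (norm x)) * ((\<i> / of_real (norm x)) * \<phi> x)) x)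
      = - ud (\<lambda>z. deriv w z * (E z * (\<i> / z))) \<phi>"
  proof -
    have "(\<lambda>x. (?S (norm x) * (of_real (norm x))\<^sup>2 * ?nu (norm x)) * ((\<i> / of_real (norm x)) * \<phi> x)) =
        (\<lambda>x. (\<lambda>r. ?S r * (of_real r)\<^sup>2 * ?nu r * (\<i> / of_real r)) (norm x) * \<phi> x)"
      by (simp only: mult.assoc)
    also have "\<dots> = (\<lambda>x. (\<lambda>z. E z * (\<i> / z)) (of_real (norm x)) * \<phi> x)"
      by (rule radial_mult_cong[OF _ cs[of 0]]) (use nu zU in \<open>auto simp: E_def field_simps power2_eq_square\<close>)
    finally have eq: "(\<lambda>x. (?S (norm x) * (of_real (norm x))\<^sup>2 * ?nu (norm x)) * ((\<i> / of_real (norm x)) * \<phi> x)) =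
        (\<lambda>x. (\<lambda>z. E z * (\<i> / z)) (of_real (norm x)) * \<phi> x)" .
    have hol: "(\<lambda>z. E z * (\<i> / z)) holomorphic_on U" by (intro holomorphic_on_mult E inv)
    show ?thesis unfolding u_def eq by (rule ud_weighted_deriv[OF w hol cs])
  qed
  have t3: "u (\<lambda>x. 1 / of_real (norm x) * (((of_real (norm x))\<^sup>2 * ?nu (norm x) * ?S (norm x)) * radial_deriv (\<lambda>x. (\<i> / of_real (norm x)) * \<phi> x) x))
      = - ud (\<lambda>z. deriv (\<lambda>z. w z * E z) z * (\<i> / z)) \<phi>"
  proof -
    have cr: "csupp Y 0 (radial_deriv (\<lambda>x. (\<i> / of_real (norm x)) * \<phi> x))"
      by (rule csupp_radial_deriv[OF csupp_radial_mult[OF inv(2) cs]])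
    have e: "(\<lambda>x. (\<lambda>r. (of_real r)\<^sup>2 * ?nu r * ?S r) (norm x) * radial_deriv (\<lambda>x. (\<i> / of_real (norm x)) * \<phi> x) x) =
        (\<lambda>x. E (of_real (norm x)) * radial_deriv (\<lambda>x. (\<i> / of_real (norm x)) * \<phi> x) x)"
      by (rule radial_mult_cong[OF _ cr]) (use nu zU in \<open>auto simp: E_def field_simps power2_eq_square\<close>)
    have eq: "(\<lambda>x. 1 / of_real (norm x) * (((of_real (norm x))\<^sup>2 * ?nu (norm x) * ?S (norm x)) * radial_deriv (\<lambda>x. (\<i> / of_real (norm x)) * \<phi> x) x)) =
        (\<lambda>x. 1 / of_real (norm x) * (E (of_real (norm x)) * radial_deriv (\<lambda>x. (\<i> / of_real (norm x)) * \<phi> x) x))"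
      using fun_cong[OF e] by (simp only:)
    show ?thesis unfolding u_def eq by (rule ud_weighted_deriv2[OF w E inv(2) cs])
  qed
  have t4: "u (\<lambda>x. 1 / of_real (norm x) * radial_deriv (\<lambda>x. (?mu (norm x) * (of_real (norm x))\<^sup>2) * radial_deriv (\<lambda>x. 1 / of_real (norm x) * \<phi> x) x) x)
      = ud (\<lambda>z. deriv (\<lambda>z. deriv w z * A z) z * (1 / z)) \<phi>"
  proof -
    have c1: "csupp Y (Suc (Suc 0)) (\<lambda>x. 1 / of_real (norm x) * \<phi> x)" by (rule csupp_radial_mult[OF inv(1) cs])
    have cr: "csupp Y (Suc 0) (radial_deriv (\<lambda>x. 1 / of_real (norm x) * \<phi> x))" by (rule csupp_radial_deriv[OF c1])
    have eq: "(\<lambda>x. (?mu (norm x) * (of_real (norm x))\<^sup>2) * radial_deriv (\<lambda>x. 1 / of_real (norm x) * \<phi> x) x) =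
        (\<lambda>x. A (of_real (norm x)) * radial_deriv (\<lambda>x. 1 / of_real (norm x) * \<phi> x) x)"
      by (rule radial_mult_cong[OF _ cr, of "\<lambda>r. ?mu r * (of_real r)\<^sup>2"]) (rule mu)
    have "u (\<lambda>x. 1 / of_real (norm x) * radial_deriv (\<lambda>x. A (of_real (norm x)) * radial_deriv (\<lambda>x. 1 / of_real (norm x) * \<phi> x) x) x) =
        - ud (\<lambda>z. deriv w z * A z) (radial_deriv (\<lambda>x. 1 / of_real (norm x) * \<phi> x))"
      unfolding u_def by (rule ud_weighted_deriv[OF w A cr])
    also have "\<dots> = ud (deriv (\<lambda>z. deriv w z * A z)) (\<lambda>x. 1 / of_real (norm x) * \<phi> x)"
      using ud_ibp[OF Aw csupp_mono[OF c1, of "Suc 0"]] by simp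
    also have "\<dots> = ud (\<lambda>z. deriv (\<lambda>z. deriv w z * A z) z * (1 / z)) \<phi>" by (rule ud_mult)
    finally show ?thesis unfolding eq .
  qed
  have t5: "u (sphere_laplacian_fun (\<lambda>x. 1 / (of_real (norm x))\<^sup>2 * \<phi> x)) = 0"
    unfolding u_def by (rule ud_sphere_laplacian[OF _ csupp_radial_mult[OF inv(3) cs]]) (intro holomorphic_intros w)
  have t6: "of_real (m\<^sup>2) * u \<phi> = ud (\<lambda>z. of_real (m\<^sup>2) * (z * w z)) \<phi>"
    unfolding u_def ud_def by (simp add: mult.assoc flip: integral_mult_right_zero)
  let ?f1 = "\<lambda>z. z * w z * (- c\<^sup>2 * (S z)\<^sup>2)" and ?f2 = "\<lambda>z. deriv w z * (E z * (\<i> / z))"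
    and ?f3 = "\<lambda>z. deriv (\<lambda>z. w z * E z) z * (\<i> / z)" and ?f4 = "\<lambda>z. - (deriv (\<lambda>z. deriv w z * A z) z * (1 / z))"
    and ?f6 = "\<lambda>z. of_real (m\<^sup>2) * (z * w z)"
  have h1: "?f1 holomorphic_on U" by (intro holomorphic_intros w S)
  have h2: "?f2 holomorphic_on U" by (intro holomorphic_on_mult dw E inv)
  have h3: "?f3 holomorphic_on U" by (intro holomorphic_on_mult holomorphic_deriv[OF wE U] inv)
  have h4: "?f4 holomorphic_on U" by (intro holomorphic_on_minus holomorphic_on_mult holomorphic_deriv[OF Aw U] inv)
  have h6: "?f6 holomorphic_on U" by (intro holomorphic_intros w)
  have "P_hat M Q \<Lambda> r0 \<sigma> s m u \<phi> = ud ?f1 \<phi> + ud ?f2 \<phi> + ud ?f3 \<phi> + ud ?f4 \<phi> + ud ?f6 \<phi>"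
    unfolding P t1 t2 t3 t4 t5 t6 ud_uminus by simp
  also have "\<dots> = ud (\<lambda>z. ?f1 z + ?f2 z + ?f3 z + ?f4 z + ?f6 z) \<phi>"
    by (subst ud_add[OF h1 h2 cs[of 0]], subst ud_add[OF _ h3 cs[of 0]], (intro holomorphic_on_add h1 h2)+,
        subst ud_add[OF _ h4 cs[of 0]], (intro holomorphic_on_add h1 h2 h3)+,
        subst ud_add[OF _ h6 cs[of 0]], (intro holomorphic_on_add h1 h2 h3 h4)+) (rule refl)
  also have "\<dots> = ud (\<lambda>z. (\<i> * deriv (\<lambda>z. E z * w z) z + \<i> * E z * deriv w z
      + (of_real (m\<^sup>2) * z\<^sup>2 - c\<^sup>2 * (\<sigma> * z + of_real s)\<^sup>2) * w z - deriv (\<lambda>z. A z * deriv w z) z) / z) \<phi>"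
  proof (rule ud_cong[OF cs[of 0]])
    fix z assume "z \<in> U"
    then have z: "z \<noteq> 0" by (rule U_nonzero)
    have S: "z * S z = \<sigma> * z + of_real s" using z by (simp add: S_def field_simps)
    have 1: "?f1 z = - (c\<^sup>2 * (z * S z)\<^sup>2 * w z) / z" using z by (simp add: field_simps power2_eq_square)
    have 6: "?f6 z = of_real (m\<^sup>2) * z\<^sup>2 * w z / z" using z by (simp add: power2_eq_square)
    have c3: "(\<lambda>z. w z * E z) = (\<lambda>z. E z * w z)" and c4: "(\<lambda>z. deriv w z * A z) = (\<lambda>z. A z * deriv w z)"
      by (simp_all add: mult.commute)
    have key: "- x1 / z + d * (e * (\<i> / z)) + D * (\<i> / z) + - (D' * (1 / z)) + x6 / z = (\<i> * D + \<i> * e * d + (x6 - x1) - D') / z" for x1 d e D D' x6 :: complex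
      by (simp add: add_divide_distrib diff_divide_distrib mult_ac)
    show "?f1 z + ?f2 z + ?f3 z + ?f4 z + ?f6 z = (\<i> * deriv (\<lambda>z. E z * w z) z + \<i> * E z * deriv w z
      + (of_real (m\<^sup>2) * z\<^sup>2 - c\<^sup>2 * (\<sigma> * z + of_real s)\<^sup>2) * w z - deriv (\<lambda>z. A z * deriv w z) z) / z"
      unfolding 1 6 S c3 c4 left_diff_distrib by (rule key)
  qed
  finally show ?thesis unfolding u_def E_def c_def .
qed

text \<open>Against a nonnegative radial bump the real part of the integrand is nonnegative, and it
  is positive wherever the bump is nonzero, which is a nonempty open set.\<close>

lemma ud_not_vanishing:
  assumes w: "w holomorphic_on U" and Re_w: "\<And>z. z \<in> U \<Longrightarrow> Re (w z) > 0"
  shows "\<not> vanishes_on Y (ud (\<lambda>z. z * w z))"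
proof
  assume van: "vanishes_on Y (ud (\<lambda>z. z * w z))"
  define p where "p = a + (b - a) / 3"
  define q where "q = a + (b - a) / 2"
  have pq: "0 < p" "p < q" "a < p" "q < b" using ab by (auto simp: p_def q_def field_simps)
  obtain F x0 where F: "\<forall>k. C_k k F" "\<forall>x. F x \<in> \<real> \<and> 0 \<le> Re (F x)" "\<forall>x. norm x \<notin> {p..q} \<longrightarrow> F x = 0" "F x0 = 1"
    using radial_bump[OF pq(1,2)] by (elim exE conjE)
  define T :: "(real^3) set" where "T = {x. p \<le> norm x} \<inter> cball 0 q"
  have T: "compact T" unfolding T_def
    by (intro closed_Int_compact closed_Collect_le continuous_intros compact_cball)
  have "{x. F x \<noteq> 0} \<subseteq> T"
  proof
    fix x assume "x \<in> {x. F x \<noteq> 0}"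
    then have "norm x \<in> {p..q}" using F(3) by blast
    then show "x \<in> T" by (simp add: T_def)
  qed
  then have cl: "closure {x. F x \<noteq> 0} \<subseteq> T" using T by (intro closure_minimal compact_imp_closed)
  have TY: "T \<subseteq> Y" using pq by (auto simp: T_def shell_def)
  have "compact (closure {x. F x \<noteq> 0})" using compact_Int_closed[OF T closed_closure[of "{x. F x \<noteq> 0}"]] cl by (simp add: Int_absorb1)
  then have cs: "csupp Y k F" for k using F(1) cl TY unfolding csupp_def by blast
  then have "F \<in> test_functions Y" by (simp add: test_functions_csupp)
  then have zero: "ud (\<lambda>z. z * w z) F = 0" using van by (simp add: vanishes_on_def)
  define G where "G x = of_real (norm x) * w (of_real (norm x)) * F x / of_real ((norm x)\<^sup>2)" for x
  have iG: "integrable lborel G" unfolding G_def[abs_def]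
    by (rule ud_integrable[OF _ cs[of 0]]) (intro holomorphic_intros w)
  have ReG: "Re (G x) = Re (w (of_real (norm x))) * Re (F x) / norm x" if "x \<in> Y" for x
  proof -
    have "F x = of_real (Re (F x))" using F(2) by (simp add: of_real_Re)
    then have "G x = of_real (norm x) * w (of_real (norm x)) * of_real (Re (F x)) / of_real ((norm x)\<^sup>2)" by (simp add: G_def)
    then have "G x = of_real (Re (F x) / norm x) * w (of_real (norm x))" using Y_norm[OF that] by (simp add: power2_eq_square)
    then show ?thesis by simp
  qed
  have G0: "G x = 0" if "x \<notin> Y" for x using csupp_outside[OF cs[of 0] that] by (simp add: G_def)
  have nn: "0 \<le> Re (G x)" for x
  proof (cases "x \<in> Y")
    case True
    then have "0 < Re (w (of_real (norm x)))" using Re_w Y_norm by blast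
    then show ?thesis unfolding ReG[OF True] using F(2) by simp
  qed (simp add: G0)
  have iR: "integrable lborel (\<lambda>x. Re (G x))" using iG by (rule integrable_Re)
  have "(LINT x|lborel. Re (G x)) = Re (LINT x|lborel. G x)" using iG by (rule integral_Re)
  also have "\<dots> = 0" using zero by (simp add: ud_def G_def[abs_def])
  finally have "AE x in lborel. Re (G x) = 0"
    using integral_nonneg_eq_0_iff_AE[OF iR] nn by simp
  moreover have "F x = 0" if "Re (G x) = 0" for x
  proof (cases "x \<in> Y")
    case True
    then have "0 < Re (w (of_real (norm x)))" "0 < norm x" using Re_w Y_norm by auto
    then have "Re (F x) = 0" using that unfolding ReG[OF True] by simp
    then show ?thesis using F(2) by (metis of_real_Re of_real_0)
  qed (rule csupp_outside[OF cs[of 0]])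
  ultimately have ae: "AE x in lborel. x \<notin> {x. F x \<noteq> 0}" by (auto elim: eventually_mono)
  have "continuous_on UNIV F" using F(1) C_k_continuous by blast
  then have op: "open {x. F x \<noteq> 0}" by (intro open_Collect_neq continuous_on_const)
  have "{x. F x \<noteq> 0} \<in> null_sets lborel"
    using op ae by (subst AE_iff_null_sets) auto
  then have "negligible {x. F x \<noteq> 0}" unfolding negligible_iff_null_sets by (rule null_sets_completionI)
  moreover have "x0 \<in> {x. F x \<noteq> 0}" using F(4) by simp
  ultimately show False using open_not_negligible[OF op] by blast
qed

end

section \<open>The growing mode\<close>

text \<open>Adding \<open>L\<close> times the product of the linear factors cancels the fourth
  power. The sum has degree at most 3 and four distinct roots, so all its coefficients
  vanish.\<close>

lemma vieta_four_roots:
  fixes L M Q2 r1 r2 r3 r4 :: real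
  assumes L: "L \<noteq> 0" and dist: "distinct [r1, r2, r3, r4]"
    and roots: "\<And>r. r \<in> {r1, r2, r3, r4} \<Longrightarrow> r\<^sup>2 - 2 * M * r + Q2 - L * r ^ 4 = 0"
  shows "r1 + r2 + r3 + r4 = 0"
    "L * (r1 * r2 + r1 * r3 + r1 * r4 + r2 * r3 + r2 * r4 + r3 * r4) = - 1"
    "L * (r1 * r2 * r3 + r1 * r2 * r4 + r1 * r3 * r4 + r2 * r3 * r4) = - 2 * M"
    "L * (r1 * r2 * r3 * r4) = - Q2"
proof -
  define d where "d = [:Q2 + L * (r1 * r2 * r3 * r4), - 2 * M - L * (r1 * r2 * r3 + r1 * r2 * r4 + r1 * r3 * r4 + r2 * r3 * r4),
     1 + L * (r1 * r2 + r1 * r3 + r1 * r4 + r2 * r3 + r2 * r4 + r3 * r4), - L * (r1 + r2 + r3 + r4):]"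
  have pd: "poly d r = (r\<^sup>2 - 2 * M * r + Q2 - L * r ^ 4) + L * ((r - r1) * (r - r2) * (r - r3) * (r - r4))" for r
    by (simp add: d_def algebra_simps power2_eq_square power4_eq_xxxx)
  have z: "poly d r = 0" if "r \<in> {r1, r2, r3, r4}" for r
    using roots[OF that] that by (auto simp: pd)
  have "d = 0"
  proof (rule ccontr)
    assume d: "d \<noteq> 0"
    have "card {r1, r2, r3, r4} \<le> card {x. poly d x = 0}"
      using z by (intro card_mono poly_roots_finite d) auto
    also have "\<dots> \<le> degree d" by (rule card_poly_roots_bound[OF d])
    also have "\<dots> \<le> 3" by (simp add: d_def)
    finally show False using dist by simp
  qed
  then show "r1 + r2 + r3 + r4 = 0"
    "L * (r1 * r2 + r1 * r3 + r1 * r4 + r2 * r3 + r2 * r4 + r3 * r4) = - 1"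
    "L * (r1 * r2 * r3 + r1 * r2 * r4 + r1 * r3 * r4 + r2 * r3 * r4) = - 2 * M"
    "L * (r1 * r2 * r3 * r4) = - Q2"
    using L by (auto simp: d_def)
qed

locale dsrn =
  fixes M Q \<Lambda> rn rc a b r0 :: real
  assumes M: "M > 0" and Q: "Q \<noteq> 0" and \<Lambda>: "\<Lambda> > 0"
    and order: "rn < 0" "0 < rc" "rc < a" "a < b"
    and roots: "{r. r \<noteq> 0 \<and> mu M Q \<Lambda> r = 0} = {rn, rc, a, b}"
    and pos: "\<And>r. a < r \<Longrightarrow> r < b \<Longrightarrow> mu M Q \<Lambda> r > 0"
    and r0: "a < r0" "r0 < b" "\<And>y. a < y \<Longrightarrow> y < b \<Longrightarrow> mu M Q \<Lambda> y \<le> mu M Q \<Lambda> r0"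
begin

text \<open>The polynomial \<open>r^2 \<mu>\<close> in factored form; writing
  \<open>of_real b - z\<close> absorbs the sign of the leading coefficient
  \<open>- \<Lambda> / 3\<close>.\<close>

definition A :: "complex \<Rightarrow> complex" where
  "A z = of_real (\<Lambda> / 3) * ((z - of_real rn) * (z - of_real rc) * (z - of_real a) * (of_real b - z))"

lemma mu_zero: "r \<in> {rn, rc, a, b} \<Longrightarrow> mu M Q \<Lambda> r = 0"
  using roots by blast

lemma vieta: "rn + rc + a + b = 0"
    "\<Lambda> / 3 * (rn * rc + rn * a + rn * b + rc * a + rc * b + a * b) = - 1"
    "\<Lambda> / 3 * (rn * rc * a + rn * rc * b + rn * a * b + rc * a * b) = - 2 * M"
    "\<Lambda> / 3 * (rn * rc * a * b) = - Q\<^sup>2"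
proof -
  have p: "r\<^sup>2 - 2 * M * r + Q\<^sup>2 - \<Lambda> / 3 * r ^ 4 = 0" if r: "r \<in> {rn, rc, a, b}" for r
  proof -
    have "r \<noteq> 0" using r order by auto
    then have "r\<^sup>2 - 2 * M * r + Q\<^sup>2 - \<Lambda> / 3 * r ^ 4 = r\<^sup>2 * mu M Q \<Lambda> r"
      by (simp add: mu_def field_simps power2_eq_square power4_eq_xxxx)
    then show ?thesis using mu_zero[OF r] by simp
  qed
  have "\<Lambda> / 3 \<noteq> 0" "distinct [rn, rc, a, b]" using \<Lambda> order by auto
  from vieta_four_roots[OF this p]
  show "rn + rc + a + b = 0"
    "\<Lambda> / 3 * (rn * rc + rn * a + rn * b + rc * a + rc * b + a * b) = - 1"
    "\<Lambda> / 3 * (rn * rc * a + rn * rc * b + rn * a * b + rc * a * b) = - 2 * M"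
    "\<Lambda> / 3 * (rn * rc * a * b) = - Q\<^sup>2" by simp_all
qed

lemma A_expand: "A z = z\<^sup>2 - 2 * of_real M * z + of_real (Q\<^sup>2) - of_real (\<Lambda> / 3) * z ^ 4"
proof -
  let ?c = complex_of_real
  have "A z = - (?c (\<Lambda> / 3) * z ^ 4) + ?c (\<Lambda> / 3) * ?c (rn + rc + a + b) * z ^ 3
      - ?c (\<Lambda> / 3 * (rn * rc + rn * a + rn * b + rc * a + rc * b + a * b)) * z\<^sup>2
      + ?c (\<Lambda> / 3 * (rn * rc * a + rn * rc * b + rn * a * b + rc * a * b)) * z
      - ?c (\<Lambda> / 3 * (rn * rc * a * b))"
    unfolding A_def of_real_mult of_real_add
    by (simp add: algebra_simps power2_eq_square power3_eq_cube power4_eq_xxxx)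
  then show ?thesis unfolding vieta by simp
qed

lemma A_mu: "r \<noteq> 0 \<Longrightarrow> complex_of_real (mu M Q \<Lambda> r) * (of_real r)\<^sup>2 = A (of_real r)"
proof -
  assume r: "r \<noteq> 0"
  have "mu M Q \<Lambda> r * r\<^sup>2 = r\<^sup>2 - 2 * M * r + Q\<^sup>2 - \<Lambda> / 3 * r ^ 4"
    using r by (simp add: mu_def field_simps power2_eq_square power4_eq_xxxx)
  then have "complex_of_real (mu M Q \<Lambda> r * r\<^sup>2) = of_real (r\<^sup>2 - 2 * M * r + Q\<^sup>2 - \<Lambda> / 3 * r ^ 4)" by simp
  then show ?thesis unfolding A_expand by simp
qed

lemma mu_factor: "r \<noteq> 0 \<Longrightarrow> mu M Q \<Lambda> r * r\<^sup>2 = \<Lambda> / 3 * ((r - rn) * (r - rc) * (r - a) * (b - r))"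
proof -
  assume "r \<noteq> 0"
  from A_mu[OF this] have "complex_of_real (mu M Q \<Lambda> r * r\<^sup>2) = of_real (\<Lambda> / 3 * ((r - rn) * (r - rc) * (r - a) * (b - r)))"
    by (simp add: A_def)
  then show ?thesis by (simp only: of_real_eq_iff)
qed

lemma mu_neg: "rc < r \<Longrightarrow> r < a \<Longrightarrow> mu M Q \<Lambda> r < 0"
proof -
  assume r: "rc < r" "r < a"
  have p: "(r - rn) * (r - rc) > 0" using r order by (intro mult_pos_pos) simp_all
  have q: "(r - a) * (b - r) < 0" using r order by (intro mult_neg_pos) simp_all
  have "\<Lambda> / 3 * (((r - rn) * (r - rc)) * ((r - a) * (b - r))) < 0"
    by (rule mult_pos_neg[OF _ mult_pos_neg[OF p q]]) (use \<Lambda> in simp)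
  then have "mu M Q \<Lambda> r * r\<^sup>2 < 0" using mu_factor[of r] r order by (simp add: mult.assoc)
  then show ?thesis by (simp add: mult_less_0_iff)
qed

text \<open>Smallness of \<open>\<Lambda>\<close> keeps \<open>\<mu>\<close> positive between
  \<open>2 * M\<close> and \<open>20 * M\<close>. Once \<open>rc < 2 * M\<close> is known, this
  interval must lie between \<open>a\<close> and \<open>b\<close>, so \<open>a\<close> is below
  \<open>2 * M\<close> and \<open>b\<close> above \<open>20 * M\<close>.\<close>

lemma outer_horizon_gt:
  assumes Q': "Q\<^sup>2 < 9 / 8 * M\<^sup>2" and small: "\<Lambda> * (20 * M) ^ 4 / 3 < Q\<^sup>2"
  shows "b > 5 * a"
proof -
  have p: "mu M Q \<Lambda> r > 0" if r: "2 * M \<le> r" "r \<le> 20 * M" for r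
  proof -
    have r0: "r > 0" using r M by linarith
    have "r ^ 4 \<le> (20 * M) ^ 4" using r r0 by (intro power_mono) auto
    then have "\<Lambda> / 3 * r ^ 4 \<le> \<Lambda> / 3 * (20 * M) ^ 4" using \<Lambda> by (intro mult_left_mono) auto
    moreover have "r * (r - 2 * M) \<ge> 0" using r r0 by simp
    ultimately have "0 < r * (r - 2 * M) + Q\<^sup>2 - \<Lambda> / 3 * r ^ 4" using small by linarith
    also have "\<dots> = mu M Q \<Lambda> r * r\<^sup>2"
      using r0 by (simp add: mu_def field_simps power2_eq_square power4_eq_xxxx)
    finally show ?thesis using r0 by (simp add: zero_less_mult_iff)
  qed
  have rc: "rc < 2 * M"
  proof (rule ccontr)
    assume "\<not> rc < 2 * M"
    \<comment> \<open>The alternative is that all positive roots exceed \<open>20 * M\<close>. By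
      Vieta the sum of their reciprocals is larger than \<open>2 * M / Q^2\<close>, whereas here it
      is at most \<open>3 / (20 * M)\<close>; the bound on \<open>Q\<close> excludes this.\<close>
    then have rc20: "rc > 20 * M" using p[of rc] mu_zero[of rc] by force
    have ab20: "a > 20 * M" "b > 20 * M" using rc20 order by auto
    have abc: "rc * a * b > 0" using order by simp
    have prod: "a * b > 0" "rc * b > 0" "rc * a > 0" using order by simp_all
    define S where "S = rc * a + rc * b + a * b"
    have "\<Lambda> / 3 * (rn * S) + \<Lambda> / 3 * (rc * a * b) = - 2 * M" using vieta(3) by (simp add: S_def algebra_simps)
    moreover have "\<Lambda> / 3 * (rc * a * b) > 0" using \<Lambda> abc by simp
    moreover have "\<Lambda> / 3 * (- rn) * S = - (\<Lambda> / 3 * (rn * S))" by simp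
    ultimately have 1: "2 * M < \<Lambda> / 3 * (- rn) * S" by linarith
    have 2: "Q\<^sup>2 = \<Lambda> / 3 * (- rn) * (rc * a * b)" using vieta(4) by (simp add: algebra_simps)
    have "20 * M * (a * b) \<le> rc * a * b" "20 * M * (rc * b) \<le> rc * a * b" "20 * M * (rc * a) \<le> rc * a * b"
      using rc20 ab20 prod mult_right_mono[of "20 * M" rc "a * b"] mult_right_mono[of "20 * M" a "rc * b"] mult_right_mono[of "20 * M" b "rc * a"]
      by (simp_all add: mult_ac)
    then have S3: "20 * M * S \<le> 3 * (rc * a * b)" by (simp add: S_def distrib_left)
    have "0 \<le> \<Lambda> / 3 * (- rn)" using \<Lambda> order by (intro mult_nonneg_nonneg) auto
    from mult_left_mono[OF S3 this]
    have "20 * M * (\<Lambda> / 3 * (- rn) * S) \<le> 3 * Q\<^sup>2" unfolding 2 by (simp add: algebra_simps)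
    moreover have "20 * M * (2 * M) < 20 * M * (\<Lambda> / 3 * (- rn) * S)"
      using 1 M by (intro mult_strict_left_mono) auto
    ultimately have "40 * (M * M) < 3 * Q\<^sup>2" by simp
    moreover have "M * M > 0" using M by simp
    ultimately show False using Q' unfolding power2_eq_square[of M] by linarith
  qed
  have inside: "a < r \<and> r < b" if "rc < r" "mu M Q \<Lambda> r > 0" for r
  proof -
    have r: "r > 0" using that order by linarith
    have "\<Lambda> / 3 * ((r - rn) * (r - rc)) * ((r - a) * (b - r)) > 0"
    proof -
      have "0 < mu M Q \<Lambda> r * r\<^sup>2" using r that(2) by (intro mult_pos_pos) auto
      then show ?thesis using mu_factor[of r] r by (simp only: mult.assoc)
    qed
    moreover have "\<Lambda> / 3 * ((r - rn) * (r - rc)) > 0" using \<Lambda> order that by simp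
    ultimately have "(r - a) * (b - r) > 0" by (rule zero_less_mult_pos)
    then show ?thesis using order by (auto simp: zero_less_mult_iff)
  qed
  have "a < 2 * M" using inside[OF rc p] M by auto
  moreover have "20 * M < b" using inside[of "20 * M"] p[of "20 * M"] rc M by auto
  ultimately show ?thesis using M by linarith
qed

text \<open>The equation \<open>\<mu>' r0 = 0\<close> solved for \<open>M\<close>, so that
  \<open>M\<close> can be eliminated in favour of \<open>r0\<close>.\<close>

lemma critical_point: "M = Q\<^sup>2 / r0 + \<Lambda> * r0 ^ 3 / 3"
proof -
  have r: "r0 > 0" using r0 order by linarith
  have "(mu M Q \<Lambda> has_real_derivative (2 * M / r0\<^sup>2 - 2 * Q\<^sup>2 / r0 ^ 3 - 2 * \<Lambda> * r0 / 3)) (at r0)"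
    unfolding mu_def[abs_def]
    by (rule derivative_eq_intros refl | (use r in simp; fail))+
      (use r in \<open>simp add: field_simps power2_eq_square power3_eq_cube\<close>)
  then have "2 * M / r0\<^sup>2 - 2 * Q\<^sup>2 / r0 ^ 3 - 2 * \<Lambda> * r0 / 3 = 0"
  proof (rule DERIV_local_max)
    show "0 < min (r0 - a) (b - r0)" using r0 by simp
    show "\<forall>y. \<bar>r0 - y\<bar> < min (r0 - a) (b - r0) \<longrightarrow> mu M Q \<Lambda> y \<le> mu M Q \<Lambda> r0"
      using r0(3) by auto
  qed
  then show ?thesis using r by (simp add: field_simps power2_eq_square power3_eq_cube)
qed

section \<open>Holomorphic continuation of \<open>\<nu>\<close>\<close>

definition B :: "complex \<Rightarrow> complex" where
  "B z = of_real (\<Lambda> / 3) * (z\<^sup>2 + 2 * of_real r0 * z) - of_real (Q\<^sup>2 / r0\<^sup>2)"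

definition Br :: "real \<Rightarrow> real" where
  "Br r = \<Lambda> / 3 * (r\<^sup>2 + 2 * r0 * r) - Q\<^sup>2 / r0\<^sup>2"

lemma B_real: "B (of_real r) = of_real (Br r)"
  by (simp add: B_def Br_def)

text \<open>\<open>r0\<close> is a double zero of \<open>\<mu>(r0) r\<^sup>2 - r\<^sup>2 \<mu>(r)\<close>; the quotient is the quadratic polynomial \<open>B\<close>.\<close>

lemma A_B: "(z - of_real r0)\<^sup>2 * B z = of_real (mu M Q \<Lambda> r0) * z\<^sup>2 - A z"
proof -
  have r: "r0 \<noteq> 0" using r0 order by linarith
  let ?c = complex_of_real
  have m: "mu M Q \<Lambda> r0 = 1 - Q\<^sup>2 / r0\<^sup>2 - \<Lambda> * r0\<^sup>2"
  proof -
    have "2 * M / r0 = 2 * (Q\<^sup>2 / r0 + \<Lambda> * r0 ^ 3 / 3) / r0" using critical_point by simp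
    also have "\<dots> = 2 * (Q\<^sup>2 / r0\<^sup>2) + 2 * \<Lambda> * r0\<^sup>2 / 3"
      using r by (simp add: field_simps power2_eq_square power3_eq_cube)
    finally show ?thesis unfolding mu_def by simp
  qed
  have mu': "?c (mu M Q \<Lambda> r0) = 1 - (?c Q)\<^sup>2 / (?c r0)\<^sup>2 - ?c \<Lambda> * (?c r0)\<^sup>2" unfolding m by simp
  have M': "?c M = (?c Q)\<^sup>2 / ?c r0 + ?c \<Lambda> * ?c r0 ^ 3 / 3" by (subst critical_point) simp
  have "?c r0 \<noteq> 0" using r by simp
  then show ?thesis
    unfolding A_expand B_def mu' unfolding M'
    by (simp add: field_simps power2_eq_square power3_eq_cube power4_eq_xxxx)
qed

lemma mu0_pos: "mu M Q \<Lambda> r0 > 0" using pos r0 by simp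

lemma c_sq: "(c_const M Q \<Lambda> r0)\<^sup>2 = 1 / mu M Q \<Lambda> r0" "c_const M Q \<Lambda> r0 > 0"
  using mu0_pos by (simp_all add: c_const_def inverse_eq_divide)

lemma Br_identity:
  assumes "r \<noteq> 0"
  shows "(r - r0)\<^sup>2 * Br r = (mu M Q \<Lambda> r0 - mu M Q \<Lambda> r) * r\<^sup>2"
proof -
  have "complex_of_real ((r - r0)\<^sup>2 * Br r) = of_real ((mu M Q \<Lambda> r0 - mu M Q \<Lambda> r) * r\<^sup>2)"
    using A_B[of "of_real r"] A_mu[OF assms] by (simp add: B_real left_diff_distrib)
  then show ?thesis by (simp only: of_real_eq_iff)
qed

text \<open>Between \<open>rc\<close> and \<open>a\<close>, where \<open>\<mu>\<close> is negative,
  the sign follows from \<open>Br_identity\<close>. It spreads to the right because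
  \<open>Br\<close> increases on the positive axis; this also covers \<open>r0\<close>, where the
  identity carries no information.\<close>

lemma Br_pos:
  assumes "rc < r" shows "Br r > 0"
proof -
  define s where "s = min r ((rc + a) / 2)"
  have s: "rc < s" "s < a" "s \<le> r" "s > 0" using assms order by (auto simp: s_def min_def)
  have "(s - r0)\<^sup>2 * Br s > 0"
    using Br_identity[of s] mu_neg[OF s(1,2)] mu0_pos s by simp
  then have "Br s > 0" by (simp add: zero_less_mult_iff)
  moreover have "Br s \<le> Br r" unfolding Br_def
    using \<Lambda> s r0 order by (intro diff_right_mono mult_left_mono add_mono power_mono) auto
  ultimately show ?thesis by linarith
qed

text \<open>The square root of \<open>1 - c^2 \<mu>\<close>, extracted as \<open>z - r0\<close>
  times the root of a function that is positive on the interval. The factor \<open>z - r0\<close>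
  changes sign at \<open>r0\<close> and so reproduces the case distinction in
  \<open>nu\<close>.\<close>

definition n :: "complex \<Rightarrow> complex" where
  "n z = - (of_real (c_const M Q \<Lambda> r0) / z) * (z - of_real r0) * csqrt (B z)"

lemma n_square: "z \<noteq> 0 \<Longrightarrow> (n z)\<^sup>2 * z\<^sup>2 = z\<^sup>2 - of_real ((c_const M Q \<Lambda> r0)\<^sup>2) * A z"
proof -
  assume z: "z \<noteq> 0"
  have "(n z)\<^sup>2 * z\<^sup>2 = of_real ((c_const M Q \<Lambda> r0)\<^sup>2) * ((z - of_real r0)\<^sup>2 * B z)"
    using z by (simp add: n_def power_mult_distrib power_divide mult_ac)
  also have "\<dots> = of_real ((c_const M Q \<Lambda> r0)\<^sup>2 * mu M Q \<Lambda> r0) * z\<^sup>2 - of_real ((c_const M Q \<Lambda> r0)\<^sup>2) * A z"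
    unfolding A_B by (simp add: algebra_simps)
  also have "(c_const M Q \<Lambda> r0)\<^sup>2 * mu M Q \<Lambda> r0 = 1" using c_sq(1) mu0_pos by simp
  finally show ?thesis by simp
qed

lemma nu_n: "rc < r \<Longrightarrow> complex_of_real (nu M Q \<Lambda> r0 r) = n (of_real r)"
proof -
  assume r: "rc < r"
  let ?c = "c_const M Q \<Lambda> r0"
  have r': "r > 0" using r order by linarith
  have B: "Br r > 0" by (rule Br_pos[OF r])
  have "1 - mu M Q \<Lambda> r * ?c\<^sup>2 = ?c\<^sup>2 * (mu M Q \<Lambda> r0 - mu M Q \<Lambda> r)"
    using c_sq(1) mu0_pos by (simp add: field_simps)
  also have "mu M Q \<Lambda> r0 - mu M Q \<Lambda> r = (r - r0)\<^sup>2 * Br r / r\<^sup>2"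
    using Br_identity[of r] r' by (simp add: field_simps)
  finally have "sqrt (1 - mu M Q \<Lambda> r * ?c\<^sup>2) = ?c * (\<bar>r - r0\<bar> * sqrt (Br r) / r)"
    using c_sq(2) r' by (simp add: real_sqrt_mult real_sqrt_divide)
  then have "nu M Q \<Lambda> r0 r = - (?c / r) * (r - r0) * sqrt (Br r)"
    unfolding nu_def using r' by (auto simp: abs_if field_simps)
  then show ?thesis using B by (simp add: n_def B_real csqrt_of_real_nonneg)
qed

lemma n_ends: "n (of_real a) = 1" "n (of_real b) = - 1"
proof -
  show "n (of_real a) = 1" using nu_n[of a] order r0 mu_zero[of a] by (simp add: nu_def)
  show "n (of_real b) = - 1" using nu_n[of b] order r0 mu_zero[of b] by (simp add: nu_def)
qed

section \<open>Sign of the coefficient of second order\<close>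

definition al :: real where "al = (a + b) / (a\<^sup>2 + b\<^sup>2)"
text \<open>The quadratic \<open>x * (1 - al * x)\<close> is symmetric about
  \<open>1 / (2 * al)\<close>; \<open>r1\<close> and \<open>r2\<close> are the reflections of
  \<open>a\<close> and \<open>b\<close>, where it takes the same values again.\<close>

definition r1 :: real where "r1 = 1 / al - a"
definition r2 :: real where "r2 = 1 / al - b"

text \<open>At first order \<open>e x = Q x (1 - al x)\<close>, so that \<open>(e x)\<^sup>2 - (e a)\<^sup>2\<close> has the roots \<open>a\<close>, \<open>b\<close>, \<open>r1\<close>, \<open>r2\<close>; \<open>rho\<close> is
  its quotient by \<open>A\<close> after cancelling the factors at \<open>a\<close> and \<open>b\<close>.\<close>

definition prof :: "real \<Rightarrow> real" where "prof x = (x - r2) / ((x - rn) * (x - rc))"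
definition rho :: "real \<Rightarrow> real" where "rho x = 3 * Q\<^sup>2 * al\<^sup>2 / \<Lambda> * ((r1 - x) * prof x)"

lemma ab_pos: "0 < a" "0 < b" "a < b" using order by auto

lemma al_pos: "al > 0" using ab_pos by (simp add: al_def add_pos_pos)

lemma r1_eq: "r1 = b * (b - a) / (a + b)" and r2_eq: "r2 = - (a * (b - a) / (a + b))"
proof -
  have "a + b \<noteq> 0" using ab_pos by simp
  moreover have "1 / al = (a\<^sup>2 + b\<^sup>2) / (a + b)" by (simp add: al_def)
  ultimately show "r1 = b * (b - a) / (a + b)" "r2 = - (a * (b - a) / (a + b))"
    unfolding r1_def r2_def by (simp_all add: field_simps power2_eq_square)
qed

lemma r2_neg: "r2 < 0" using ab_pos by (simp add: r2_eq)

lemma prof_pos: "a \<le> x \<Longrightarrow> prof x > 0"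
  using r2_neg order unfolding prof_def by (intro divide_pos_pos mult_pos_pos) auto

text \<open>A product of two decreasing positive factors, \<open>1 / (x - rn)\<close> and
  \<open>(x - r2) / (x - rc)\<close>; the second decreases because its zero \<open>r2\<close> lies
  to the left of its pole \<open>rc\<close>.\<close>

lemma prof_antimono:
  assumes "a \<le> x" "x \<le> y" shows "prof y \<le> prof x"
proof -
  have p: "x - rn > 0" "y - rn > 0" "x - rc > 0" "y - rc > 0" using assms order by auto
  have "(y - x) * (rc - r2) \<ge> 0" using assms order r2_neg by simp
  then have "(y - r2) * (x - rc) \<le> (x - r2) * (y - rc)" by (simp add: algebra_simps)
  then have v: "(y - r2) / (y - rc) \<le> (x - r2) / (x - rc)" using p by (simp add: divide_le_eq le_divide_eq mult.commute)
  have u: "1 / (y - rn) \<le> 1 / (x - rn)" using p assms by (intro divide_left_mono) auto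
  have "1 / (y - rn) * ((y - r2) / (y - rc)) \<le> 1 / (x - rn) * ((x - r2) / (x - rc))"
    using p assms order r2_neg by (intro mult_mono u v divide_nonneg_pos) auto
  then show ?thesis by (simp add: prof_def)
qed

text \<open>Since \<open>prof\<close> is decreasing, \<open>rho\<close> is bounded below by its linearisation \<open>h0 (r1 - x)\<close> at the zero \<open>r1\<close>, whose
  integral is positive as soon as \<open>r1\<close> lies to the right of the midpoint.\<close>

lemma rho_integral:
  assumes outer_horizon_gt: "b > 5 * a"
  obtains J where "J > 0" "(rho has_integral J) {a..b}"
proof -
  define K where "K = 3 * Q\<^sup>2 * al\<^sup>2 / \<Lambda>"
  have K: "K > 0" using Q al_pos \<Lambda> by (simp add: K_def)
  have cont: "continuous_on {a..b} rho" unfolding rho_def[abs_def] prof_def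
    using order by (intro continuous_intros) auto
  then have J: "(rho has_integral integral {a..b} rho) {a..b}"
    using integrable_continuous_interval integrable_integral by blast
  \<comment> \<open>By \<open>r1_eq\<close> this amounts to \<open>b^2 > 4 * a * b + a^2\<close>,
    which the factor 5 provides.\<close>
  have r1a: "r1 > (a + b) / 2"
  proof -
    have "(a + b) * (a + b) < 2 * (b * (b - a))"
    proof -
      have "b * (5 * a) < b * b" using outer_horizon_gt ab_pos by (intro mult_strict_left_mono) auto
      moreover have "a * a < a * b" using ab_pos by simp
      ultimately show ?thesis using mult_pos_pos[OF ab_pos(1,2)] by (simp add: algebra_simps)
    qed
    then show ?thesis unfolding r1_eq using ab_pos by (simp add: field_simps)
  qed
  have "a < (a + b) / 2" using ab_pos by simp
  then have a_r1: "a \<le> r1" using r1a by simp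
  define h0 where "h0 = K * prof r1"
  have h0: "h0 > 0" using K prof_pos[OF a_r1] by (simp add: h0_def)
  have l: "((\<lambda>x. h0 * (r1 - x)) has_integral (h0 * (r1 * b - b\<^sup>2 / 2) - h0 * (r1 * a - a\<^sup>2 / 2))) {a..b}"
    using ab_pos by (intro fundamental_theorem_of_calculus)
      (auto intro!: derivative_eq_intros simp: has_real_derivative_iff_has_vector_derivative[symmetric])
  have le: "h0 * (r1 - x) \<le> rho x" if "x \<in> {a..b}" for x
  proof -
    \<comment> \<open>On either side of \<open>r1\<close> monotonicity gives the two factors the
      same sign.\<close>
    have "(r1 - x) * (prof x - prof r1) \<ge> 0"
    proof (cases "x \<le> r1")
      case True then show ?thesis using prof_antimono[of x r1] that by simp
    next
      case False then show ?thesis using prof_antimono[of r1 x] a_r1 by (simp add: mult_nonpos_nonpos)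
    qed
    then have "(r1 - x) * prof r1 \<le> (r1 - x) * prof x" by (simp only: right_diff_distrib)
    then have "K * ((r1 - x) * prof r1) \<le> K * ((r1 - x) * prof x)"
      by (rule mult_left_mono) (use K in simp)
    moreover have "rho x = K * ((r1 - x) * prof x)" "h0 * (r1 - x) = K * ((r1 - x) * prof r1)"
      by (simp_all only: rho_def K_def h0_def mult_ac)
    ultimately show ?thesis by (simp only:)
  qed
  have "h0 * (r1 * b - b\<^sup>2 / 2) - h0 * (r1 * a - a\<^sup>2 / 2) \<le> integral {a..b} rho"
    by (rule has_integral_le[OF l J]) (rule le)
  moreover have "h0 * (r1 * b - b\<^sup>2 / 2) - h0 * (r1 * a - a\<^sup>2 / 2) = h0 * ((b - a) * (r1 - (a + b) / 2))"
    by (simp add: field_simps power2_eq_square)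
  moreover have "h0 * ((b - a) * (r1 - (a + b) / 2)) > 0"
    using h0 r1a ab_pos by (intro mult_pos_pos) auto
  ultimately have "integral {a..b} rho > 0" by linarith
  then show thesis using that J by blast
qed

text \<open>As \<open>e b = - e a\<close>, the difference of squares is
  \<open>(e x - e a) * (e x - e b)\<close>, and each factor splits at its known roots:
  \<open>a\<close> and \<open>r1\<close>, respectively \<open>b\<close> and \<open>r2\<close>. The
  linear factors at \<open>a\<close> and \<open>b\<close> are those of \<open>A\<close>.\<close>

lemma rho_A:
  assumes x: "a < x" "x < b"
  shows "of_real (rho x) * A (of_real x) =
    (- of_real (Q * al) * (of_real x * of_real x) + of_real Q * of_real x)\<^sup>2 - (- of_real (Q * al) * (of_real a * of_real a) + of_real Q * of_real a)\<^sup>2"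
proof -
  define e where "e t = - (Q * al) * (t * t) + Q * t" for t
  have p: "x - rn \<noteq> 0" "x - rc \<noteq> 0" "\<Lambda> \<noteq> 0" using x order \<Lambda> by auto
  have alr: "al * r1 = 1 - al * a" "al * r2 = 1 - al * b" using al_pos by (simp_all add: r1_def r2_def right_diff_distrib)
  have "a\<^sup>2 + b\<^sup>2 \<noteq> 0" using ab_pos by (simp add: sum_power2_eq_zero_iff)
  then have "al * (a\<^sup>2 + b\<^sup>2) = a + b" by (simp add: al_def)
  moreover have "e b + e a = Q * ((a + b) - al * (a\<^sup>2 + b\<^sup>2))" by (simp add: e_def algebra_simps power2_eq_square)
  ultimately have eb: "e b = - e a" by simp
  have em: "e x - e a = Q * (al * r1 - al * x) * (x - a)" unfolding alr e_def by (simp add: algebra_simps)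
  have ep: "e x - e b = Q * (al * x - al * r2) * (b - x)" unfolding alr e_def by (simp add: algebra_simps)
  have "rho x * (\<Lambda> / 3 * ((x - rn) * (x - rc) * (x - a) * (b - x))) = Q\<^sup>2 * al\<^sup>2 * ((r1 - x) * (x - r2)) * ((x - a) * (b - x))"
  proof -
    have "3 * Q\<^sup>2 * al\<^sup>2 / L * (g * (f / (u * v))) * (L / 3 * (u * v * s * t)) = Q\<^sup>2 * al\<^sup>2 * (g * f) * (s * t)"
      if "u \<noteq> 0" "v \<noteq> 0" "L \<noteq> 0" for L g f u v s t :: real
      using that by simp
    from this[OF p] show ?thesis unfolding rho_def prof_def .
  qed
  also have "\<dots> = (e x - e a) * (e x - e b)" unfolding em ep by (simp add: algebra_simps power2_eq_square)
  also have "\<dots> = (e x)\<^sup>2 - (e a)\<^sup>2" unfolding eb by (simp add: algebra_simps power2_eq_square)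
  finally have "complex_of_real (rho x * (\<Lambda> / 3 * ((x - rn) * (x - rc) * (x - a) * (b - x)))) = of_real ((e x)\<^sup>2 - (e a)\<^sup>2)" by (rule arg_cong)
  then show ?thesis by (simp add: A_def e_def)
qed

section \<open>Estimates on a complex neighbourhood of the radial interval\<close>

lemma A_holomorphic: "A holomorphic_on S"
  unfolding A_def[abs_def] by (intro holomorphic_intros)

text \<open>The distances to \<open>a\<close> and \<open>b\<close> add up to at least
  \<open>b - a\<close>, so the larger one is at least half of that. The factors belonging to
  \<open>rn\<close> and \<open>rc\<close> are at least \<open>d\<close>, because \<open>z\<close>
  stays that far to the right of \<open>rc\<close>.\<close>

lemma A_bound:
  assumes "Re z \<ge> d + rc" "d > 0"
  shows "\<Lambda> / 3 * (d * d) * ((b - a) / 2) * min (norm (z - of_real a)) (norm (z - of_real b)) \<le> norm (A z)"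
proof -
  let ?u = "norm (z - of_real a)" and ?v = "norm (z - of_real b)"
  have c: "d \<le> norm (z - of_real rc)" "d \<le> norm (z - of_real rn)"
    using assms order complex_Re_le_cmod[of "z - of_real rc"] complex_Re_le_cmod[of "z - of_real rn"] by simp_all
  have "norm (complex_of_real b - of_real a) \<le> ?u + ?v"
    using norm_triangle_ineq4[of "z - of_real a" "z - of_real b"] by simp
  moreover have "norm (complex_of_real b - of_real a) = b - a"
    using ab_pos by (simp only: of_real_diff[symmetric] norm_of_real)
  ultimately have "b - a \<le> ?u + ?v" by simp
  then have "(b - a) / 2 \<le> max ?u ?v" by (simp add: max_def)
  then have 1: "(b - a) / 2 * min ?u ?v \<le> max ?u ?v * min ?u ?v" by (intro mult_right_mono) auto
  have "max ?u ?v * min ?u ?v = ?u * ?v" by (simp add: max_def min_def mult.commute)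
  with 1 have 2: "(b - a) / 2 * min ?u ?v \<le> ?u * ?v" by simp
  have 3: "d * d \<le> norm (z - of_real rn) * norm (z - of_real rc)" using c assms by (intro mult_mono) auto
  have "\<Lambda> / 3 * (d * d) * ((b - a) / 2 * min ?u ?v) \<le> \<Lambda> / 3 * (norm (z - of_real rn) * norm (z - of_real rc)) * (?u * ?v)"
  proof (rule mult_mono[OF _ 2])
    show "\<Lambda> / 3 * (d * d) \<le> \<Lambda> / 3 * (norm (z - of_real rn) * norm (z - of_real rc))"
      by (rule mult_left_mono[OF 3]) (use \<Lambda> in simp)
  qed (use \<Lambda> ab_pos in auto)
  also have "\<dots> = norm (A z)" using \<Lambda> by (simp add: A_def norm_mult norm_minus_commute[of "of_real b"] mult_ac)
  finally show ?thesis by (simp only: mult.assoc)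
qed

lemma B_holomorphic: "B holomorphic_on S"
  unfolding B_def[abs_def] by (intro holomorphic_intros)

text \<open>Positive real part keeps \<open>B z\<close> off the branch cut of the square
  root.\<close>

lemma n_holomorphic:
  assumes "\<And>z. z \<in> S \<Longrightarrow> z \<noteq> 0 \<and> Re (B z) > 0"
  shows "n holomorphic_on S"
proof -
  have "csqrt holomorphic_on {z. Re z > 0}"
    by (rule holomorphic_on_csqrt') (auto simp: complex_nonpos_Reals_iff)
  then have "(csqrt \<circ> B) holomorphic_on S"
    using assms by (intro holomorphic_on_compose_gen[OF B_holomorphic]) auto
  then have "(\<lambda>z. csqrt (B z)) holomorphic_on S" by (simp add: o_def)
  note * = holomorphic_on_mult[OF holomorphic_on_mult[OF holomorphic_on_minus[OF holomorphic_on_divide[OF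
      holomorphic_on_const holomorphic_on_ident]] holomorphic_on_diff[OF holomorphic_on_ident holomorphic_on_const]] this]
  show ?thesis unfolding n_def[abs_def] by (rule *) (use assms in blast)
qed

text \<open>The domain is a uniform thickening of the interval: a sum of two convex sets, hence
  convex. Its closed counterpart is a compact subset of the open set \<open>W\<close> on which
  \<open>n\<close> is holomorphic, and compactness supplies the bounds, also for
  \<open>deriv n\<close>.\<close>

lemma complex_neighbourhood:
  assumes lo: "rc < lo" "lo < hi"
  shows "\<exists>U d N Z. open U \<and> convex U \<and> of_real ` {lo..hi} \<subseteq> U \<and> d > 0 \<and> n holomorphic_on U \<and>
    (\<forall>z\<in>U. Re z \<ge> d + rc \<and> norm z \<le> Z \<and> norm (n z) \<le> N \<and> norm (deriv n z) \<le> N)"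
proof -
  \<comment> \<open>\<open>d + rc\<close> is the midpoint between \<open>rc\<close> and
    \<open>lo\<close>.\<close>
  define d where "d = (lo - rc) / 2"
  define W where "W = {z. Re z > d + rc} \<inter> {z. Re (B z) > 0}"
  define I where "I = complex_of_real ` {lo..hi}"
  have d: "d > 0" "d + rc < lo" using lo by (auto simp: d_def field_simps)
  have cB: "continuous_on UNIV (\<lambda>z. Re (B z))"
    by (intro continuous_on_Re holomorphic_on_imp_continuous_on B_holomorphic)
  have W: "open W" unfolding W_def
    by (intro open_Int open_halfspace_Re_gt open_Collect_less continuous_on_const cB)
  have I: "compact I" unfolding I_def by (intro compact_continuous_image continuous_intros) auto
  have cI: "convex I" unfolding I_def
    by (intro convex_linear_image) (auto intro!: linearI simp: scaleR_conv_of_real)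
  have IW: "I \<subseteq> W"
  proof
    fix z assume "z \<in> I"
    then obtain r where r: "z = of_real r" "lo \<le> r" by (auto simp: I_def)
    then have "Br r > 0" using lo by (intro Br_pos) simp
    then show "z \<in> W" using r d by (simp add: W_def B_real)
  qed
  obtain e where e: "e > 0" "(\<Union>x\<in>I. cball x e) \<subseteq> W"
    using compact_subset_open_imp_cball_epsilon_subset[OF I W IW] by metis
  define U where "U = (\<Union>x\<in>I. \<Union>y\<in>ball 0 e. {x + y})"
  define K where "K = (\<Union>x\<in>I. \<Union>y\<in>cball 0 e. {x + y})"
  have sums: "z \<in> (\<Union>y\<in>S. {x + y}) \<longleftrightarrow> z - x \<in> S" for z x :: complex and S
    by (auto intro: bexI[of _ "z - x"])
  have "(\<Union>y\<in>ball 0 e. {x + y}) = ball x e" "(\<Union>y\<in>cball 0 e. {x + y}) = cball x e" for x :: complex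
    by (rule set_eqI, simp only: sums, simp add: dist_norm norm_minus_commute)+
  then have Ub: "U = (\<Union>x\<in>I. ball x e)" and Kb: "K = (\<Union>x\<in>I. cball x e)"
    by (simp_all only: U_def K_def)
  have U: "open U" "convex U"
  proof -
    show "open U" unfolding Ub by (intro open_UN ballI open_ball)
    show "convex U" unfolding U_def by (rule convex_sums[OF cI convex_ball])
  qed
  have K: "compact K" "K \<subseteq> W" "U \<subseteq> K"
  proof -
    show "compact K" unfolding K_def by (rule compact_sums'[OF I compact_cball])
    show "K \<subseteq> W" unfolding Kb by (rule e(2))
    show "U \<subseteq> K" unfolding Ub Kb using ball_subset_cball by blast
  qed
  have IU: "I \<subseteq> U" using e(1) by (auto simp: Ub)
  have nW: "n holomorphic_on W"
    by (rule n_holomorphic) (use d order in \<open>auto simp: W_def\<close>)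
  have bound: "\<exists>N. \<forall>z\<in>K. norm (f z) \<le> N" if "f holomorphic_on W" for f :: "complex \<Rightarrow> complex"
  proof -
    have "compact (f ` K)"
      by (rule compact_continuous_image[OF continuous_on_subset[OF holomorphic_on_imp_continuous_on[OF that] K(2)] K(1)])
    then have "bounded (f ` K)" by (rule compact_imp_bounded)
    then show ?thesis by (auto simp: bounded_iff)
  qed
  obtain N1 where N1: "\<forall>z\<in>K. norm (n z) \<le> N1" using bound[OF nW] by blast
  obtain N2 where N2: "\<forall>z\<in>K. norm (deriv n z) \<le> N2" using bound[OF holomorphic_deriv[OF nW W]] by blast
  obtain Z where Z: "\<forall>z\<in>K. norm z \<le> Z" using bound[OF holomorphic_on_ident] by blast
  have zU: "\<forall>z\<in>U. Re z \<ge> d + rc \<and> norm z \<le> Z \<and> norm (n z) \<le> max N1 N2 \<and> norm (deriv n z) \<le> max N1 N2"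
  proof
    fix z assume "z \<in> U"
    then have z: "z \<in> K" "z \<in> W" using K by auto
    then show "Re z \<ge> d + rc \<and> norm z \<le> Z \<and> norm (n z) \<le> max N1 N2 \<and> norm (deriv n z) \<le> max N1 N2"
      using N1 N2 Z unfolding W_def le_max_iff_disj by simp
  qed
  have nU: "n holomorphic_on U" by (rule holomorphic_on_subset[OF nW subset_trans[OF K(3) K(2)]])
  have sub: "of_real ` {lo..hi} \<subseteq> U" using IU by (simp add: I_def)
  show ?thesis
    by (rule exI[of _ U], rule exI[of _ d], rule exI[of _ "max N1 N2"], rule exI[of _ Z])
      (intro conjI U sub d(1) nU zU)
qed

text \<open>The holomorphic solution \<open>w\<close> of the radial equation becomes the radial
  distribution with profile \<open>z * w z\<close>. The bound on \<open>m^2 / q^2\<close> spends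
  half of \<open>J\<close>; the other half is left for growth.\<close>

lemma growing_mode:
  assumes J: "(rho has_integral J) {a..b}" "J > 0" and \<eta>: "\<eta> > 0" "rc < a - \<eta>"
  shows "\<exists>q0>0. \<exists>c1>0. \<forall>q m. 0 < \<bar>q\<bar> \<and> \<bar>q\<bar> < q0 \<and> m\<^sup>2 \<le> J / 2 / ((b ^ 3 - a ^ 3) / 3) * q\<^sup>2 \<longrightarrow>
    (\<exists>\<sigma>. Im \<sigma> \<ge> c1 * q\<^sup>2 \<and>
      (\<exists>u \<in> Ker_P_hat M Q \<Lambda> r0 \<gamma> (shell (a - \<eta>) (b + \<eta>)) \<sigma> (q * Q) m \<inter> Ker_sphere_laplacian (shell (a - \<eta>) (b + \<eta>)).
        \<not> vanishes_on (shell (a - \<eta>) (b + \<eta>)) u))"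
proof -
  have lohi: "rc < a - \<eta>" "a - \<eta> < b + \<eta>" using \<eta> order by auto
  obtain U d N Z where U: "open U" "convex U" "of_real ` {a - \<eta>..b + \<eta>} \<subseteq> U" and d: "d > 0" and nU: "n holomorphic_on U"
    and zU: "\<forall>z\<in>U. Re z \<ge> d + rc \<and> norm z \<le> Z \<and> norm (n z) \<le> N \<and> norm (deriv n z) \<le> N"
    using complex_neighbourhood[OF lohi] by (elim exE conjE)
  define c2 where "c2 = (c_const M Q \<Lambda> r0)\<^sup>2"
  define k where "k = \<Lambda> / 3 * (d * d) * ((b - a) / 2)"
  define m0 where "m0 = J / 2 / ((b ^ 3 - a ^ 3) / 3)"
  have ab3: "(b ^ 3 - a ^ 3) / 3 > 0" using ab_pos by (simp add: power_strict_mono)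
  have Unz: "z \<noteq> 0" if "z \<in> U" for z
  proof -
    have "d + rc \<le> Re z" using zU that by blast
    then have "Re z > 0" using d order by linarith
    then show ?thesis by auto
  qed
  interpret H: horizon_ode U A n a b Q c2 N k Z m0
  proof
    show "open U" "convex U" by (rule U)+
    show "0 < a" "a < b" by (rule ab_pos)+
    show "of_real a \<in> U" "of_real b \<in> U" using U(3) \<eta> ab_pos by (auto simp: image_subset_iff)
    show "A holomorphic_on U" by (rule A_holomorphic)
    show "A (of_real a) = 0" "A (of_real b) = 0" by (simp_all add: A_def)
    show "0 < k" using \<Lambda> d ab_pos by (simp add: k_def)
    show "n holomorphic_on U" by (rule nU)
    show "n (of_real a) = 1" "n (of_real b) = - 1" by (rule n_ends)+
    show "0 \<le> m0" using J ab3 by (simp add: m0_def)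
    fix z assume z: "z \<in> U"
    show "norm z \<le> Z" "norm (n z) \<le> N" "norm (deriv n z) \<le> N" using zU z by blast+
    show "k * min (norm (z - of_real a)) (norm (z - of_real b)) \<le> norm (A z)"
      unfolding k_def by (rule A_bound[OF _ d]) (use zU z in blast)
  qed
  interpret S: radial_shell U "a - \<eta>" "b + \<eta>"
  proof
    show "open U" "of_real ` {a - \<eta>..b + \<eta>} \<subseteq> U" by (rule U)+
    show "0 < a - \<eta>" "a - \<eta> < b + \<eta>" using lohi order by auto
    show "z \<noteq> 0" if "z \<in> U" for z by (rule Unz[OF that])
  qed
  let ?Y = "shell (a - \<eta>) (b + \<eta>)"
  have nA: "(n z)\<^sup>2 * z\<^sup>2 = z\<^sup>2 - of_real c2 * A z" if "z \<in> U" for z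
    unfolding c2_def by (rule n_square[OF Unz[OF that]])
  have sg1: "H.sg1 = - of_real (Q * al)" unfolding H.sg1_eq al_def by simp
  have rA: "of_real (rho x) * A (of_real x) = (H.e H.sg1 (of_real x))\<^sup>2 - (H.e H.sg1 (of_real a))\<^sup>2" if "a < x" "x < b" for x
    unfolding H.e_def sg1 by (rule rho_A[OF that])
  have J3: "m0 * ((b ^ 3 - a ^ 3) / 3) \<le> J / 2"
  proof -
    have "J / 2 / t * t \<le> J / 2" if "t > 0" for t using that by simp
    from this[OF ab3] show ?thesis unfolding m0_def .
  qed
  obtain q0 c1 where q0: "q0 > 0" and c1: "c1 > 0" and sol: "\<forall>q m. 0 < \<bar>q\<bar> \<and> \<bar>q\<bar> < q0 \<and> m\<^sup>2 \<le> m0 * q\<^sup>2 \<longrightarrow>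
     (\<exists>sig w. Im sig \<ge> c1 * q\<^sup>2 \<and> w holomorphic_on U \<and>
       (\<forall>z\<in>U. Re (w z) \<ge> 1 / 2) \<and>
       (\<forall>z\<in>U. deriv (\<lambda>z. A z * deriv w z) z =
          \<i> * deriv (\<lambda>z. n z * (sig * z\<^sup>2 + of_real (q * Q) * z) * w z) z
          + \<i> * (n z * (sig * z\<^sup>2 + of_real (q * Q) * z)) * deriv w z
          + (of_real (m\<^sup>2) * z\<^sup>2 - of_real c2 * (sig * z + of_real (q * Q))\<^sup>2) * w z))"
  proof -
    have "\<exists>q0>0. \<exists>c1>0. \<forall>q m. 0 < \<bar>q\<bar> \<and> \<bar>q\<bar> < q0 \<and> m\<^sup>2 \<le> m0 * q\<^sup>2 \<longrightarrow>
     (\<exists>sig w. Im sig \<ge> c1 * q\<^sup>2 \<and> w holomorphic_on U \<and>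
       (\<forall>z\<in>U. Re (w z) \<ge> 1 / 2) \<and>
       (\<forall>z\<in>U. deriv (\<lambda>z. A z * deriv w z) z =
          \<i> * deriv (\<lambda>z. n z * (sig * z\<^sup>2 + of_real (q * Q) * z) * w z) z
          + \<i> * (n z * (sig * z\<^sup>2 + of_real (q * Q) * z)) * deriv w z
          + (of_real (m\<^sup>2) * z\<^sup>2 - of_real c2 * (sig * z + of_real (q * Q))\<^sup>2) * w z))"
      using nA rA J J3 by (rule H.growing_solution)
    then show thesis using that by (elim exE conjE)
  qed
  have mode: "\<exists>\<sigma>. Im \<sigma> \<ge> c1 * q\<^sup>2 \<and> (\<exists>u \<in> Ker_P_hat M Q \<Lambda> r0 \<gamma> ?Y \<sigma> (q * Q) m \<inter> Ker_sphere_laplacian ?Y. \<not> vanishes_on ?Y u)"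
    if qm: "0 < \<bar>q\<bar> \<and> \<bar>q\<bar> < q0 \<and> m\<^sup>2 \<le> m0 * q\<^sup>2" for q m
  proof -
    obtain \<sigma> w where Im: "Im \<sigma> \<ge> c1 * q\<^sup>2" and w: "w holomorphic_on U" and Re_w: "\<forall>z\<in>U. Re (w z) \<ge> 1 / 2"
      and ode: "\<forall>z\<in>U. deriv (\<lambda>z. A z * deriv w z) z =
          \<i> * deriv (\<lambda>z. n z * (\<sigma> * z\<^sup>2 + of_real (q * Q) * z) * w z) z
          + \<i> * (n z * (\<sigma> * z\<^sup>2 + of_real (q * Q) * z)) * deriv w z
          + (of_real (m\<^sup>2) * z\<^sup>2 - of_real c2 * (\<sigma> * z + of_real (q * Q))\<^sup>2) * w z"
      using sol[rule_format, OF qm] by (elim exE conjE)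
    define u where "u = S.ud (\<lambda>z. z * w z)"
    have zw: "(\<lambda>z. z * w z) holomorphic_on U" by (intro holomorphic_intros w)
    have nu: "complex_of_real (nu M Q \<Lambda> r0 r) = n (of_real r)" if "a - \<eta> < r" "r < b + \<eta>" for r
      using nu_n[of r] that lohi by simp
    have mu: "complex_of_real (mu M Q \<Lambda> r) * (of_real r)\<^sup>2 = A (of_real r)" if "a - \<eta> < r" "r < b + \<eta>" for r
      using A_mu[of r] that lohi order by simp
    have P: "P_hat M Q \<Lambda> r0 \<sigma>' s' m' u \<phi> =
      S.ud (\<lambda>z. (\<i> * deriv (\<lambda>z. n z * (\<sigma>' * z\<^sup>2 + of_real s' * z) * w z) z
          + \<i> * (n z * (\<sigma>' * z\<^sup>2 + of_real s' * z)) * deriv w z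
          + (of_real (m'\<^sup>2) * z\<^sup>2 - (of_real (c_const M Q \<Lambda> r0))\<^sup>2 * (\<sigma>' * z + of_real s')\<^sup>2) * w z
          - deriv (\<lambda>z. A z * deriv w z) z) / z) \<phi>" if "\<phi> \<in> test_functions ?Y" for \<sigma>' s' m' \<phi>
      unfolding u_def using w nU A_holomorphic nu mu that by (rule S.P_hat_ud)
    have uH: "u \<in> H_bar \<gamma> ?Y" by (rule S.H_bar_ud[OF zw]) (simp add: u_def)
    have dw: "deriv w holomorphic_on U" by (rule holomorphic_deriv[OF w U(1)])
    \<comment> \<open>The image under the operator with all parameters zero again has a holomorphic
      radial profile, so \<open>H_bar_ud\<close> applies to it; this gives membership in
      \<open>X_space\<close>.\<close>
    define P0 where "P0 z = (\<i> * deriv (\<lambda>z. n z * (0 * z\<^sup>2 + of_real 0 * z) * w z) z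
          + \<i> * (n z * (0 * z\<^sup>2 + of_real 0 * z)) * deriv w z
          + (of_real (0\<^sup>2) * z\<^sup>2 - (of_real (c_const M Q \<Lambda> r0))\<^sup>2 * (0 * z + of_real 0)\<^sup>2) * w z
          - deriv (\<lambda>z. A z * deriv w z) z) / z" for z
    have P0_hol: "P0 holomorphic_on U" unfolding P0_def[abs_def]
      by (intro holomorphic_on_divide holomorphic_on_add holomorphic_on_diff holomorphic_on_mult holomorphic_on_power
          holomorphic_on_const holomorphic_on_ident holomorphic_deriv U(1) w nU A_holomorphic Unz dw)
    have X: "P_hat M Q \<Lambda> r0 0 0 0 u \<in> H_bar (\<gamma> - 1) ?Y"
    proof (rule S.H_bar_ud[OF P0_hol])
      show "P_hat M Q \<Lambda> r0 0 0 0 u \<phi> = S.ud P0 \<phi>" if "\<phi> \<in> test_functions ?Y" for \<phi>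
        unfolding P0_def[abs_def] by (rule P[OF that])
    qed
    have ker: "P_hat M Q \<Lambda> r0 \<sigma> (q * Q) m u \<phi> = 0" if \<phi>: "\<phi> \<in> test_functions ?Y" for \<phi>
    proof -
      have cs: "csupp ?Y 0 \<phi>" using \<phi> by (simp add: test_functions_csupp)
      have "P_hat M Q \<Lambda> r0 \<sigma> (q * Q) m u \<phi> = S.ud (\<lambda>_. 0) \<phi>"
        unfolding P[OF \<phi>]
      proof (rule S.ud_cong[OF cs])
        fix z assume "z \<in> U"
        with ode have "deriv (\<lambda>z. A z * deriv w z) z =
          \<i> * deriv (\<lambda>z. n z * (\<sigma> * z\<^sup>2 + of_real (q * Q) * z) * w z) z
          + \<i> * (n z * (\<sigma> * z\<^sup>2 + of_real (q * Q) * z)) * deriv w z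
          + (of_real (m\<^sup>2) * z\<^sup>2 - of_real c2 * (\<sigma> * z + of_real (q * Q))\<^sup>2) * w z" by blast
        moreover have "complex_of_real c2 = (of_real (c_const M Q \<Lambda> r0))\<^sup>2" by (simp add: c2_def)
        ultimately show "(\<i> * deriv (\<lambda>z. n z * (\<sigma> * z\<^sup>2 + of_real (q * Q) * z) * w z) z
          + \<i> * (n z * (\<sigma> * z\<^sup>2 + of_real (q * Q) * z)) * deriv w z
          + (of_real (m\<^sup>2) * z\<^sup>2 - (of_real (c_const M Q \<Lambda> r0))\<^sup>2 * (\<sigma> * z + of_real (q * Q))\<^sup>2) * w z
          - deriv (\<lambda>z. A z * deriv w z) z) / z = 0" by (simp only: diff_self div_0)
      qed
      then show ?thesis by (simp add: S.ud_def)
    qed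
    have sph: "sphere_laplacian u \<phi> = 0" if "\<phi> \<in> test_functions ?Y" for \<phi>
      unfolding sphere_laplacian_def u_def
      by (rule S.ud_sphere_laplacian[OF zw]) (use that in \<open>simp add: test_functions_csupp\<close>)
    have nv: "\<not> vanishes_on ?Y u" unfolding u_def
    proof (rule S.ud_not_vanishing[OF w])
      fix z assume "z \<in> U"
      then have "1 / 2 \<le> Re (w z)" using Re_w by blast
      then show "0 < Re (w z)" by linarith
    qed
    have "u \<in> Ker_P_hat M Q \<Lambda> r0 \<gamma> ?Y \<sigma> (q * Q) m \<inter> Ker_sphere_laplacian ?Y"
      using uH X ker sph by (simp add: Ker_P_hat_def X_space_def Ker_sphere_laplacian_def vanishes_on_def)
    then show ?thesis using Im nv by blast
  qed
  show ?thesis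
    using q0 c1 mode unfolding m0_def by blast
qed

end

theorem theorem3p2:
  fixes M Q :: real
  assumes "M > 0" and "0 < \<bar>Q\<bar>" and "\<bar>Q\<bar> < 3 * M / (2 * sqrt 2)"
  shows "\<exists>\<Lambda>0>0. \<forall>\<Lambda> r_n r_c r_minus r_plus r0.
       0 < \<Lambda> \<and> \<Lambda> < \<Lambda>0 \<and>
       dsrn_assumption M Q \<Lambda> r_n r_c r_minus r_plus \<and>
       single_nondegenerate_max (mu M Q \<Lambda>) r_minus r_plus r0 \<longrightarrow>
       (\<exists>c0>0. \<forall>\<eta> \<gamma>. admissible_collar M Q \<Lambda> r_minus r_plus \<eta> \<and> \<gamma> > 5 / 2 \<longrightarrow>
         (\<exists>q0>0. \<exists>c1>0. \<forall>q m :: real.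
            m > 0 \<and> m\<^sup>2 \<le> c0 * q\<^sup>2 \<and> 0 < \<bar>q\<bar> \<and> \<bar>q\<bar> < q0 \<longrightarrow>
            (\<exists>\<sigma> :: complex. Im \<sigma> \<ge> c1 * q\<^sup>2 \<and> c1 * q\<^sup>2 > 0 \<and>
               (let Y = shell (r_minus - \<eta>) (r_plus + \<eta>) in
                  \<exists>u \<in> Ker_P_hat M Q \<Lambda> r0 \<gamma> Y \<sigma> (q * Q) m \<inter> Ker_sphere_laplacian Y.
                    \<not> vanishes_on Y u))))"
proof -
  \<comment> \<open>The threshold at which \<open>\<Lambda> * (20 * M) ^ 4 / 3\<close> reaches
    \<open>Q^2\<close>, the smallness condition of \<open>outer_horizon_gt\<close>.\<close>
  define \<Lambda>0 where "\<Lambda>0 = 3 * Q\<^sup>2 / (20 * M) ^ 4"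
  have M4: "(20 * M) ^ 4 > 0" using assms(1) by simp
  have L0: "\<Lambda>0 > 0" using assms M4 by (simp add: \<Lambda>0_def)
  have Q2: "Q\<^sup>2 < 9 / 8 * M\<^sup>2"
  proof -
    have "\<bar>Q\<bar>\<^sup>2 < (3 * M / (2 * sqrt 2))\<^sup>2" using assms by (intro power_strict_mono) auto
    then show ?thesis by (simp add: power_divide power_mult_distrib)
  qed
  show ?thesis
  proof (rule exI[of _ \<Lambda>0], rule conjI[OF L0], intro allI impI)
    fix \<Lambda> r_n r_c r_minus r_plus r0
    assume asm: "0 < \<Lambda> \<and> \<Lambda> < \<Lambda>0 \<and>
       dsrn_assumption M Q \<Lambda> r_n r_c r_minus r_plus \<and>
       single_nondegenerate_max (mu M Q \<Lambda>) r_minus r_plus r0"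
    interpret dsrn M Q \<Lambda> r_n r_c r_minus r_plus r0
    proof
      show "M > 0" "Q \<noteq> 0" "\<Lambda> > 0" using assms asm by auto
    qed (use asm in \<open>auto simp: dsrn_assumption_def single_nondegenerate_max_def\<close>)
    have "\<Lambda> * (20 * M) ^ 4 < \<Lambda>0 * (20 * M) ^ 4" using asm M4 by (intro mult_strict_right_mono) auto
    then have "\<Lambda> * (20 * M) ^ 4 / 3 < Q\<^sup>2" using M4 by (simp add: \<Lambda>0_def)
    then have "r_plus > 5 * r_minus" by (rule outer_horizon_gt[OF Q2])
    then obtain J where J: "J > 0" "(rho has_integral J) {r_minus..r_plus}" by (rule rho_integral)
    \<comment> \<open>Half of the ratio \<open>m^2 / q^2\<close> at which the mass term would cancel
      \<open>J\<close>. It depends neither on the collar nor on \<open>\<gamma>\<close>.\<close>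
    define c0 where "c0 = J / 2 / ((r_plus ^ 3 - r_minus ^ 3) / 3)"
    have "r_minus ^ 3 < r_plus ^ 3" using ab_pos by (intro power_strict_mono) auto
    then have c0: "c0 > 0" using J(1) by (simp add: c0_def)
    show "\<exists>c0>0. \<forall>\<eta> \<gamma>. admissible_collar M Q \<Lambda> r_minus r_plus \<eta> \<and> \<gamma> > 5 / 2 \<longrightarrow>
         (\<exists>q0>0. \<exists>c1>0. \<forall>q m :: real.
            m > 0 \<and> m\<^sup>2 \<le> c0 * q\<^sup>2 \<and> 0 < \<bar>q\<bar> \<and> \<bar>q\<bar> < q0 \<longrightarrow>
            (\<exists>\<sigma> :: complex. Im \<sigma> \<ge> c1 * q\<^sup>2 \<and> c1 * q\<^sup>2 > 0 \<and>
               (let Y = shell (r_minus - \<eta>) (r_plus + \<eta>) in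
                  \<exists>u \<in> Ker_P_hat M Q \<Lambda> r0 \<gamma> Y \<sigma> (q * Q) m \<inter> Ker_sphere_laplacian Y.
                    \<not> vanishes_on Y u)))"
    proof (rule exI[of _ c0], rule conjI[OF c0], intro allI impI)
      fix \<eta> \<gamma> :: real assume col: "admissible_collar M Q \<Lambda> r_minus r_plus \<eta> \<and> \<gamma> > 5 / 2"
      then have \<eta>: "\<eta> > 0" and nz: "\<forall>r \<in> {r_minus - \<eta>..<r_minus}. mu M Q \<Lambda> r \<noteq> 0"
        by (auto simp: admissible_collar_def)
      \<comment> \<open>A collar reaching \<open>r_c\<close> would contain a root of
        \<open>\<mu>\<close>. The whole domain therefore lies to the right of \<open>r_c\<close>,
        where the continuation of \<open>\<nu>\<close> is available.\<close>
      have "r_c < r_minus - \<eta>"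
      proof (rule ccontr)
        assume "\<not> r_c < r_minus - \<eta>"
        then have "r_c \<in> {r_minus - \<eta>..<r_minus}" using order by simp
        then show False using nz mu_zero[of r_c] by blast
      qed
      from growing_mode[OF J(2,1) \<eta> this, of \<gamma>, folded c0_def] obtain q0 c1 where q0: "q0 > 0" and c1: "c1 > 0"
        and mode: "\<forall>q m. 0 < \<bar>q\<bar> \<and> \<bar>q\<bar> < q0 \<and> m\<^sup>2 \<le> c0 * q\<^sup>2 \<longrightarrow>
          (\<exists>\<sigma>. Im \<sigma> \<ge> c1 * q\<^sup>2 \<and>
            (\<exists>u \<in> Ker_P_hat M Q \<Lambda> r0 \<gamma> (shell (r_minus - \<eta>) (r_plus + \<eta>)) \<sigma> (q * Q) m \<inter> Ker_sphere_laplacian (shell (r_minus - \<eta>) (r_plus + \<eta>)).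
              \<not> vanishes_on (shell (r_minus - \<eta>) (r_plus + \<eta>)) u))"
        by (elim exE conjE)
      show "\<exists>q0>0. \<exists>c1>0. \<forall>q m :: real.
            m > 0 \<and> m\<^sup>2 \<le> c0 * q\<^sup>2 \<and> 0 < \<bar>q\<bar> \<and> \<bar>q\<bar> < q0 \<longrightarrow>
            (\<exists>\<sigma> :: complex. Im \<sigma> \<ge> c1 * q\<^sup>2 \<and> c1 * q\<^sup>2 > 0 \<and>
               (let Y = shell (r_minus - \<eta>) (r_plus + \<eta>) in
                  \<exists>u \<in> Ker_P_hat M Q \<Lambda> r0 \<gamma> Y \<sigma> (q * Q) m \<inter> Ker_sphere_laplacian Y.
                    \<not> vanishes_on Y u))"
      proof (rule exI[of _ q0], rule conjI[OF q0], rule exI[of _ c1], rule conjI[OF c1], intro allI impI)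
        fix q m :: real assume qm: "m > 0 \<and> m\<^sup>2 \<le> c0 * q\<^sup>2 \<and> 0 < \<bar>q\<bar> \<and> \<bar>q\<bar> < q0"
        then have "c1 * q\<^sup>2 > 0" using c1 by simp
        moreover have "0 < \<bar>q\<bar> \<and> \<bar>q\<bar> < q0 \<and> m\<^sup>2 \<le> c0 * q\<^sup>2" using qm by simp
        ultimately show "\<exists>\<sigma> :: complex. Im \<sigma> \<ge> c1 * q\<^sup>2 \<and> c1 * q\<^sup>2 > 0 \<and>
               (let Y = shell (r_minus - \<eta>) (r_plus + \<eta>) in
                  \<exists>u \<in> Ker_P_hat M Q \<Lambda> r0 \<gamma> Y \<sigma> (q * Q) m \<inter> Ker_sphere_laplacian Y.
                    \<not> vanishes_on Y u)"
          using mode unfolding Let_def by blast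
      qed
    qed
  qed
qed

end
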